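(* Let $m$ and $n$ be odd positive integers, let $u(x)=\|x\|^m$ and $g(x)=\|x\|^m\tanh\|x\|$ for $x\in\mathbb{R}^n$, and let $\hat u$ denote the generalised Fourier transform of $u$. Let $\Delta\subset\mathbb{Z}^n$ be a finite set and $(\mu_k)_{k\in\Delta}$ real coefficients such that the trigonometric polynomial $P(y)=\sum_{k\in\Delta}\mu_k\mathrm{e}^{-\mathrm{i}k\cdot y}$ and the function $\psi_u(x)=\sum_{k\in\Delta}\mu_k u(x-k)$ satisfy: (i) $|\psi_u(x)|=O(\|x\|^{-2n-m})$ for $\|x\|\to\infty$; (ii) $\hat\psi_u(y)=P(y)\hat u(y)=1+O(\|y\|^{n+m})$ in a neighbourhood of the origin; (iii) $\hat\psi_u(0)=1$, $D^\alpha\hat\psi_u(0)=0$ for all $\alpha\in\mathbb{N}_0^n$ with $1\le|\alpha|\le n+m-1$, and $D^\alpha\hat\psi_u(2\pi j)=0$ for all $j\in\mathbb{Z}^n\setminus\{0\}$ and all $\alpha\in\mathbb{N}_0^n$ with $|\alpha|\le n+m-1$. Define $\psi(x)=\sum_{k\in\Delta}\mu_k g(x-k)$ and, for $h>0$, $$Q_hf(x)=\sum_{j\in\mathbb{Z}^n}f(hj)\,\psi(x/h-j),\qquad x\in\mathbb{R}^n.$$ Then the quasi-interpolant $Q_h$ is well-defined and exact on $\mathbb{P}_{n+m-1}$ (that is, $Q_hp=p$ for every $p\in\mathbb{P}_{n+m-1}$), and the approximation error can be estimated by $$\|Q_hf-f\|_\infty=O\bigl(h^{n+m}\log(1/h)\bigr),\qquad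 h\to0,$$ for every bounded function $f\in C^{n+m}(\mathbb{R}^n)$ with bounded derivatives.
   Context: $\|\cdot\|$ is the Euclidean norm on $\mathbb{R}^n$, $\mathbb{P}_M$ is the linear space of polynomials in $n$ variables of total degree at most $M$, and $|\alpha|=\alpha_1+\cdots+\alpha_n$. Fourier transforms are normalised as $\hat f(y)=\int_{\mathbb{R}^n}f(x)\mathrm{e}^{-\mathrm{i}\,y\cdot x}\,\mathrm{d}x$ for $f\in L^1(\mathbb{R}^n)$ and are extended to tempered distributions (generalised Fourier transforms); since $m$ is odd, away from the origin $$\hat u(y)=\frac{\Gamma\left(\frac{m+n}{2}\right)}{\Gamma\left(-\frac m2\right)}2^{m+n}\pi^{n/2}\|y\|^{-m-n}.$$ For $m$, $n$ odd, it is a known result (used by the paper) that a finite set $\Delta$ and coefficients $\mu_k$ with properties (i)–(iii) exist. The constant implied in the error estimate may depend on $f$ but not on $h$. "Bounded derivatives" means that all partial derivatives of $f$ of total order at most $n+m$ are bounded. *)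

theory Defs
  imports "HOL-Analysis.Analysis" "HOL-Library.Landau_Symbols"
begin

text \<open>The dimension is \<open>n = CARD('n)\<close>; multi-integers live in \<open>int ^ 'n\<close> and are
  embedded into \<open>real ^ 'n\<close> componentwise.\<close>

definition vec_of_int :: "int ^ 'n \<Rightarrow> real ^ 'n" where
  "vec_of_int k = (\<chi> i. real_of_int (k $ i))"


subsection \<open>Partial derivatives, multi-indices and polynomials\<close>

definition partial_deriv ::
    "'n \<Rightarrow> (real ^ 'n \<Rightarrow> 'b::real_normed_vector) \<Rightarrow> real ^ 'n \<Rightarrow> 'b" where
  "partial_deriv i f x = vector_derivative (\<lambda>t. f (x + t *\<^sub>R axis i 1)) (at 0)"

text \<open>Mixed partial derivatives: a list of coordinates records the order of differentiation,
  its length is the total order.\<close>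

definition partials ::
    "'n list \<Rightarrow> (real ^ 'n \<Rightarrow> 'b::real_normed_vector) \<Rightarrow> real ^ 'n \<Rightarrow> 'b" where
  "partials is f = foldr partial_deriv is f"

definition C_k :: "nat \<Rightarrow> (real ^ 'n \<Rightarrow> 'b::real_normed_vector) \<Rightarrow> bool" where
  "C_k k f \<longleftrightarrow>
     (\<forall>is. length is \<le> k \<longrightarrow> continuous_on UNIV (partials is f)) \<and>
     (\<forall>is i x. length is < k \<longrightarrow>
        (\<lambda>t. partials is f (x + t *\<^sub>R axis i 1)) differentiable (at 0))"

definition multi_order :: "('n::finite \<Rightarrow> nat) \<Rightarrow> nat" where
  "multi_order \<alpha> = (\<Sum>i\<in>UNIV. \<alpha> i)"

text \<open>The derivative \<open>D\<^sup>\<alpha>\<close> with \<open>\<alpha> i\<close> differentiations in direction \<open>i\<close>. Since \<open>'n\<close> carries no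
  canonical order, the coordinates are taken in an arbitrary fixed order; for functions of class
  \<open>C\<^sup>k\<close> with \<open>k \<ge> multi_order \<alpha>\<close> the result does not depend on it.\<close>

definition multi_deriv ::
    "('n::finite \<Rightarrow> nat) \<Rightarrow> (real ^ 'n \<Rightarrow> 'b::real_normed_vector) \<Rightarrow> real ^ 'n \<Rightarrow> 'b" where
  "multi_deriv \<alpha> f = partials (SOME is. \<forall>i. count_list is i = \<alpha> i) f"

definition polys_upto :: "nat \<Rightarrow> (real ^ 'n \<Rightarrow> real) set" where
  "polys_upto M =
     {p. \<exists>c :: ('n \<Rightarrow> nat) \<Rightarrow> real.
           \<forall>x. p x = (\<Sum>\<alpha> | multi_order \<alpha> \<le> M. c \<alpha> * (\<Prod>i\<in>UNIV. (x $ i) ^ \<alpha> i))}"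


subsection \<open>Fourier transforms\<close>

definition fourier :: "(real ^ 'n \<Rightarrow> complex) \<Rightarrow> real ^ 'n \<Rightarrow> complex" where
  "fourier f y = (LINT x|lborel. f x * exp (- \<i> * complex_of_real (y \<bullet> x)))"

text \<open>A locally integrable function \<open>f\<close> of polynomial growth is a tempered distribution
  \<open>\<phi> \<mapsto> \<integral> f \<phi>\<close>; the Fourier transform of a tempered distribution \<open>T\<close> is \<open>\<phi> \<mapsto> T (fourier \<phi>)\<close>.\<close>

definition regular_distr :: "(real ^ 'n \<Rightarrow> complex) \<Rightarrow> (real ^ 'n \<Rightarrow> complex) \<Rightarrow> complex" where
  "regular_distr f \<phi> = (LINT x|lborel. f x * \<phi> x)"

definition distr_fourier ::
    "((real ^ 'n \<Rightarrow> complex) \<Rightarrow> complex) \<Rightarrow> (real ^ 'n \<Rightarrow> complex) \<Rightarrow> complex" where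
  "distr_fourier T \<phi> = T (fourier \<phi>)"

definition test_function_on :: "(real ^ 'n) set \<Rightarrow> (real ^ 'n \<Rightarrow> complex) \<Rightarrow> bool" where
  "test_function_on S \<phi> \<longleftrightarrow>
     (\<forall>k. C_k k \<phi>) \<and> compact (closure {x. \<phi> x \<noteq> 0}) \<and> closure {x. \<phi> x \<noteq> 0} \<subseteq> S"

text \<open>\<open>F\<close> is the generalised Fourier transform of \<open>f\<close> away from the origin: the distributional
  Fourier transform of \<open>f\<close> coincides on \<open>- {0}\<close> with the function \<open>F\<close>. Continuity makes the values
  of \<open>F\<close> on \<open>- {0}\<close> unique; its value at the origin is irrelevant.\<close>

definition is_generalised_fourier ::
    "(real ^ 'n \<Rightarrow> complex) \<Rightarrow> (real ^ 'n \<Rightarrow> complex) \<Rightarrow> bool" where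
  "is_generalised_fourier f F \<longleftrightarrow>
     continuous_on (- {0}) F \<and>
     (\<forall>\<phi>. test_function_on (- {0}) \<phi> \<longrightarrow>
        distr_fourier (regular_distr f) \<phi> = regular_distr F \<phi>)"


subsection \<open>Quasi-interpolation\<close>

definition rbf_u :: "nat \<Rightarrow> real ^ 'n \<Rightarrow> real" where
  "rbf_u m x = norm x ^ m"

definition rbf_g :: "nat \<Rightarrow> real ^ 'n \<Rightarrow> real" where
  "rbf_g m x = norm x ^ m * tanh (norm x)"

definition shift_comb ::
    "(int ^ 'n) set \<Rightarrow> (int ^ 'n \<Rightarrow> real) \<Rightarrow> (real ^ 'n \<Rightarrow> real) \<Rightarrow> real ^ 'n \<Rightarrow> real" where
  "shift_comb \<Delta> \<mu> \<phi> x = (\<Sum>k\<in>\<Delta>. \<mu> k * \<phi> (x - vec_of_int k))"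

definition trig_poly ::
    "(int ^ 'n) set \<Rightarrow> (int ^ 'n \<Rightarrow> real) \<Rightarrow> real ^ 'n \<Rightarrow> complex" where
  "trig_poly \<Delta> \<mu> y =
     (\<Sum>k\<in>\<Delta>. complex_of_real (\<mu> k) * exp (- \<i> * complex_of_real (vec_of_int k \<bullet> y)))"

definition quasi_term ::
    "(real ^ 'n \<Rightarrow> real) \<Rightarrow> real \<Rightarrow> (real ^ 'n \<Rightarrow> real) \<Rightarrow> real ^ 'n \<Rightarrow> int ^ 'n \<Rightarrow> real" where
  "quasi_term \<psi> h f x j = f (h *\<^sub>R vec_of_int j) * \<psi> (x /\<^sub>R h - vec_of_int j)"

definition quasi_interp ::
    "(real ^ 'n \<Rightarrow> real) \<Rightarrow> real \<Rightarrow> (real ^ 'n \<Rightarrow> real) \<Rightarrow> real ^ 'n \<Rightarrow> real" where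
  "quasi_interp \<psi> h f x = (\<Sum>\<^sub>\<infinity>j. quasi_term \<psi> h f x j)"

text \<open>\<open>infsum\<close> is 0 for a family that is not summable, so well-definedness of the
  quasi-interpolant has to be stated separately.\<close>

definition quasi_interp_defined ::
    "(real ^ 'n \<Rightarrow> real) \<Rightarrow> real \<Rightarrow> (real ^ 'n \<Rightarrow> real) \<Rightarrow> bool" where
  "quasi_interp_defined \<psi> h f \<longleftrightarrow> (\<forall>x. quasi_term \<psi> h f x summable_on UNIV)"

definition bounded_C_k :: "nat \<Rightarrow> (real ^ 'n \<Rightarrow> real) \<Rightarrow> bool" where
  "bounded_C_k k f \<longleftrightarrow> C_k k f \<and> (\<forall>is. length is \<le> k \<longrightarrow> bounded (range (partials is f)))"

end

theory Submission
  imports Defs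
begin

text \<open>
  Put \<open>N = n + m\<close> and split \<open>g = u + w\<close>, where \<open>w(x) = \<parallel>x\<parallel>\<^sup>m (tanh \<parallel>x\<parallel> - 1)\<close> decays exponentially.
  Correspondingly \<open>\<psi> = \<psi>\<^sub>u + W\<close> with \<open>W(x) = \<Sum>\<^sub>k \<mu>\<^sub>k w(x - k)\<close>, so \<open>\<psi>\<close> inherits the bound
  \<open>\<bar>\<psi>(x)\<bar> \<le> B / (1 + \<parallel>x\<parallel>)\<^bsup>N + n\<^esup>\<close> from \<open>\<psi>\<^sub>u\<close>. Everything else rests on the identities
  \<open>\<Sum>\<^sub>j (y - j)\<^sup>\<alpha> \<psi>(y - j) = \<delta>\<^bsub>\<alpha>,0\<^esub>\<close> for \<open>\<bar>\<alpha>\<bar> < N\<close>, which are proved for \<open>\<psi>\<^sub>u\<close> and \<open>W\<close> separately.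

  For \<open>\<psi>\<^sub>u\<close> these are the Strang-Fix conditions (\<open>strang_fix_reproduction\<close>). The function
  \<open>G(x) = x\<^sup>\<alpha> \<psi>\<^sub>u(x)\<close> is integrable, and the Fourier coefficients of its periodisation
  \<open>\<Sum>\<^sub>j G(y - j)\<close> are, up to powers of \<open>\<i>\<close>, the values of \<open>D\<^sup>\<alpha> \<psi>\<^sub>u\<close>-hat at the points \<open>2\<pi>k\<close>. All of them
  vanish except possibly the mean, hence the continuous periodisation is constant and equal to
  \<open>\<integral>G\<close> (\<open>periodisation_eq_integral\<close>, via density of trigonometric polynomials), and the conditions at
  the origin say \<open>\<integral>G = \<delta>\<^bsub>\<alpha>,0\<^esub>\<close>.

  For \<open>W\<close> all the sums are zero, because the coefficients \<open>\<mu>\<close> annihilate polynomials of degree less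
  than \<open>N\<close>: regrouping gives \<open>\<Sum>\<^sub>l w(y - l) \<Sum>\<^sub>k \<mu>\<^sub>k (y - l + k)\<^sup>\<alpha>\<close>. The annihilation is forced by the
  behaviour of \<open>P\<close> at the origin (\<open>annihilates_polynomials_if_product_tends_to_1\<close>). Since \<open>u\<close> is
  homogeneous of degree \<open>m\<close>, its transform is homogeneous of degree \<open>-N\<close> away from the origin
  (\<open>generalised_fourier_homogeneous\<close>); as the product of \<open>P\<close> with it tends to \<open>1\<close>, \<open>P(tv) = O(t\<^sup>N)\<close>
  along every ray. The Taylor coefficients of \<open>P(tv)\<close> in \<open>t\<close> are the power moments
  \<open>\<Sum>\<^sub>k \<mu>\<^sub>k (k \<bullet> v)\<^sup>i\<close>, and polarisation turns these into all moments of order below \<open>N\<close>.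

  Exactness on polynomials is then algebra. For the error at \<open>x\<close>, the Taylor polynomial of \<open>f\<close> of
  degree \<open>N - 1\<close> at \<open>x\<close> is reproduced with value \<open>f(x)\<close>, so only the Taylor remainder at the nodes
  is summed against \<open>\<psi>\<close>. With \<open>d\<^sub>j = \<parallel>x/h - j\<parallel>\<close> the remainder is at most a multiple of
  \<open>(h (1 + d\<^sub>j))\<^sup>N\<close> times \<open>min 1 (1 / (h (1 + d\<^sub>j)))\<close>, and the decay of \<open>\<psi>\<close> leaves
  \<open>h\<^sup>N \<Sum>\<^sub>j (1 + d\<^sub>j)\<^bsup>-n\<^esup> min 1 (1 / (h (1 + d\<^sub>j)))\<close>. Each of the about \<open>log (1/h)\<close> dyadic
  shells of radius up to \<open>1/h\<close> contributes a bounded amount and the outer shells form a geometric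
  series (\<open>lattice_log_bound\<close>): this is where the logarithm comes from (\<open>quasi_interp_error\<close>).
\<close>

section \<open>Sums over the integer lattice\<close>

definition dyadic_index :: "real \<Rightarrow> nat" where
  "dyadic_index d = (LEAST i. d \<le> 2 ^ i)"

lemma le_dyadic_index: "d \<le> 2 ^ dyadic_index d"
proof -
  obtain i where "d < 2 ^ i" using real_arch_pow[of 2 d] by auto
  then show ?thesis unfolding dyadic_index_def
    by (intro LeastI[of "\<lambda>i. d \<le> 2 ^ i" i]) simp
qed

lemma dyadic_index_le:
  assumes "0 \<le> d"
  shows "2 ^ dyadic_index d \<le> 2 * (1 + d)"
proof (cases "dyadic_index d")
  case 0 then show ?thesis using assms by simp
next
  case (Suc i)
  then have "\<not> d \<le> 2 ^ i"
    using not_less_Least[of i "\<lambda>i. d \<le> 2 ^ i"] by (simp add: dyadic_index_def)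
  then show ?thesis using Suc by simp
qed

lemma inverse_power_dyadic_le:
  assumes "0 \<le> d"
  shows "1 / (1 + d) ^ k \<le> 2 ^ k / (2 ^ dyadic_index d) ^ k"
proof -
  have "(2 ^ dyadic_index d) ^ k \<le> 2 ^ k * (1 + d) ^ k"
    using power_mono[OF dyadic_index_le[OF assms], of k] unfolding power_mult_distrib by simp
  then show ?thesis using assms by (simp add: divide_simps)
qed

lemma card_int_interval_le:
  assumes "0 \<le> R"
  shows "real (card {\<lceil>a - R\<rceil>..\<lfloor>a + R\<rfloor>}) \<le> 2 * R + 1"
proof -
  have "real_of_int (\<lfloor>a + R\<rfloor> + 1 - \<lceil>a - R\<rceil>) \<le> 2 * R + 1" by linarith
  then show ?thesis using assms by simp
qed

text \<open>The ball lies in a cube, and each coordinate of a lattice point in that cube has at most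
  \<open>2 * R + 1\<close> choices.\<close>

lemma lattice_ball:
  fixes x :: "real ^ 'n"
  assumes "0 \<le> R"
  shows finite_lattice_ball: "finite {j. norm (x - vec_of_int j) \<le> R}"
    and card_lattice_ball: "real (card {j. norm (x - vec_of_int j) \<le> R}) \<le> (2 * R + 1) ^ CARD('n)"
proof -
  let ?I = "\<lambda>i. {\<lceil>x $ i - R\<rceil>..\<lfloor>x $ i + R\<rfloor>}"
  let ?B = "{j. norm (x - vec_of_int j) \<le> R}"
  have sub: "?B \<subseteq> vec_lambda ` PiE UNIV ?I"
  proof
    fix j assume "j \<in> ?B"
    then have j: "norm (x - vec_of_int j) \<le> R" by simp
    have "j $ i \<in> ?I i" for i
    proof -
      have "\<bar>(x - vec_of_int j) $ i\<bar> \<le> R" using component_le_norm_cart[of "x - vec_of_int j" i] j by linarith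
      then have "\<bar>x $ i - real_of_int (j $ i)\<bar> \<le> R" by (simp add: vec_of_int_def)
      then show ?thesis by (auto simp: ceiling_le_iff le_floor_iff abs_le_iff)
    qed
    then show "j \<in> vec_lambda ` PiE UNIV ?I"
      by (intro image_eqI[of _ _ "vec_nth j"]) auto
  qed
  have fin: "finite (PiE (UNIV::'n set) ?I)" by (intro finite_PiE) auto
  show "finite ?B" using finite_subset[OF sub] fin by blast
  have "card ?B \<le> card (PiE (UNIV::'n set) ?I)"
    using card_mono[OF _ sub] card_image_le[OF fin, of vec_lambda] fin by fastforce
  then have "card ?B \<le> (\<Prod>i\<in>(UNIV::'n set). card (?I i))"
    by (simp add: card_PiE del: card_atLeastAtMost_int)
  then have "real (card ?B) \<le> real (\<Prod>i\<in>(UNIV::'n set). card (?I i))"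
    by (rule of_nat_mono)
  also have "\<dots> \<le> (\<Prod>i\<in>(UNIV::'n set). 2 * R + 1)"
    unfolding of_nat_prod by (intro prod_mono conjI of_nat_0_le_iff card_int_interval_le assms)
  finally show "real (card ?B) \<le> (2 * R + 1) ^ CARD('n)" by simp
qed

text \<open>A lattice sum is estimated shell by shell. The shell with index \<open>i\<close> lies in the ball of radius
  \<open>2 ^ i\<close>, which holds at most \<open>3 ^ n * (2 ^ i) ^ n\<close> lattice points.\<close>

lemma lattice_sum_dyadic:
  fixes x :: "real ^ 'n" and a :: "int ^ 'n \<Rightarrow> real" and b :: "nat \<Rightarrow> real"
  assumes a: "\<And>j. 0 \<le> a j" "\<And>j. a j \<le> b (dyadic_index (norm (x - vec_of_int j)))"
    and b: "\<And>i. 0 \<le> b i" "summable (\<lambda>i. b i * (2 ^ i) ^ CARD('n))"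
  shows "a summable_on UNIV"
    and "infsum a UNIV \<le> 3 ^ CARD('n) * (\<Sum>i. b i * (2 ^ i) ^ CARD('n))"
proof -
  let ?S = "3 ^ CARD('n) * (\<Sum>i. b i * (2 ^ i) ^ CARD('n))"
  let ?i = "\<lambda>j. dyadic_index (norm (x - vec_of_int j))"
  have bd: "sum a J \<le> ?S" if J: "finite J" for J
  proof -
    have "sum a J \<le> (\<Sum>j\<in>J. b (?i j))" by (intro sum_mono a)
    also have "\<dots> = (\<Sum>i\<in>?i ` J. \<Sum>j\<in>{j \<in> J. ?i j = i}. b (?i j))"
      by (rule sum.image_gen[OF J])
    also have "\<dots> = (\<Sum>i\<in>?i ` J. real (card {j \<in> J. ?i j = i}) * b i)"
      by (intro sum.cong refl) simp
    also have "\<dots> \<le> (\<Sum>i\<in>?i ` J. 3 ^ CARD('n) * (b i * (2 ^ i) ^ CARD('n)))"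
    proof (rule sum_mono)
      fix i
      let ?B = "{j. norm (x - vec_of_int j) \<le> 2 ^ i}"
      have "{j \<in> J. ?i j = i} \<subseteq> ?B" using le_dyadic_index by auto
      then have "real (card {j \<in> J. ?i j = i}) \<le> real (card ?B)"
        by (simp add: card_mono finite_lattice_ball)
      also have "\<dots> \<le> (2 * 2 ^ i + 1) ^ CARD('n)" by (rule card_lattice_ball) simp
      also have "\<dots> \<le> (3 * 2 ^ i) ^ CARD('n)" by (intro power_mono) auto
      finally have "real (card {j \<in> J. ?i j = i}) * b i \<le> (3 * 2 ^ i) ^ CARD('n) * b i"
        by (intro mult_right_mono b)
      then show "real (card {j \<in> J. ?i j = i}) * b i \<le> 3 ^ CARD('n) * (b i * (2 ^ i) ^ CARD('n))"
        by (simp add: power_mult_distrib mult_ac)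
    qed
    also have "\<dots> = 3 ^ CARD('n) * (\<Sum>i\<in>?i ` J. b i * (2 ^ i) ^ CARD('n))"
      by (simp add: sum_distrib_left)
    also have "\<dots> \<le> ?S"
      by (intro mult_left_mono sum_le_suminf b) (use J b in auto)
    finally show ?thesis .
  qed
  show summ: "a summable_on UNIV"
    by (rule nonneg_bdd_above_summable_on) (use a bd in \<open>auto intro!: bdd_aboveI2\<close>)
  show "infsum a UNIV \<le> ?S"
    by (rule infsum_le_finite_sums[OF summ bd])
qed

lemma lattice_weight_summable:
  fixes x :: "real ^ 'n"
  shows "(\<lambda>j. 1 / (1 + norm (x - vec_of_int j)) ^ (CARD('n) + 1)) summable_on UNIV"
proof (rule lattice_sum_dyadic(1)[where x = x and b = "\<lambda>i. 2 ^ (CARD('n) + 1) / (2 ^ i) ^ (CARD('n) + 1)"])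
  fix j :: "int ^ 'n"
  let ?d = "norm (x - vec_of_int j)"
  show "1 / (1 + ?d) ^ (CARD('n) + 1) \<le> 2 ^ (CARD('n) + 1) / (2 ^ dyadic_index ?d) ^ (CARD('n) + 1)"
    by (rule inverse_power_dyadic_le) simp
next
  have "(\<lambda>i. (2::real) ^ (CARD('n) + 1) / (2 ^ i) ^ (CARD('n) + 1) * (2 ^ i) ^ CARD('n))
      = (\<lambda>i. 2 ^ (CARD('n) + 1) * (1 / 2) ^ i)"
    by (auto simp: power_divide)
  then show "summable (\<lambda>i. (2::real) ^ (CARD('n) + 1) / (2 ^ i) ^ (CARD('n) + 1) * (2 ^ i) ^ CARD('n))"
    by (simp add: summable_mult del: power_Suc)
qed auto

text \<open>With \<open>b i\<close> the size of the weight on shell \<open>i\<close>, the factor \<open>b i * (2 ^ i) ^ n\<close> is a constant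
  multiple of \<open>min 1 (2 / (h * 2 ^ i))\<close>: equal to \<open>1\<close> for the about \<open>log 2 (1 / h)\<close> inner shells and
  geometrically decreasing afterwards.\<close>

lemma lattice_log_sum:
  fixes x :: "real ^ 'n"
  assumes h: "0 < h" "h < 1 / 2"
  defines "w \<equiv> \<lambda>j. min 1 (1 / (h * (1 + norm (x - vec_of_int j)))) / (1 + norm (x - vec_of_int j)) ^ CARD('n)"
  shows lattice_log_summable: "w summable_on UNIV"
    and lattice_log_bound: "infsum w UNIV \<le> 3 ^ CARD('n) * (2 ^ CARD('n) * (6 / ln 2 * ln (1 / h)))"
proof -
  let ?b = "\<lambda>i. 2 ^ CARD('n) * min 1 (2 / (h * 2 ^ i)) / (2 ^ i) ^ CARD('n)"
  define c where "c = (\<lambda>i. min 1 (2 / (h * 2 ^ i)))"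
  \<comment> \<open>The last shell whose radius does not exceed \<open>1 / h\<close>.\<close>
  define I where "I = nat \<lfloor>log 2 (1 / h)\<rfloor>"
  have log: "1 \<le> log 2 (1 / h)" using h by (simp add: le_log_iff divide_simps)
  have I1: "real I \<le> log 2 (1 / h)" and I2: "log 2 (1 / h) \<le> real (Suc I)"
    unfolding I_def using log by linarith+
  have hI: "1 / h \<le> 2 ^ Suc I"
    using I2 h by (subst (asm) log_le_iff) (auto simp: powr_realpow[symmetric] simp del: power_Suc)
  have c0: "0 \<le> c i" and c1: "c i \<le> 1" for i using h by (auto simp: c_def)
  have tail: "c (i + Suc I) \<le> 2 * (1 / 2) ^ i" for i
  proof -
    have "c (i + Suc I) \<le> 2 * (1 / h) / 2 ^ (i + Suc I)" unfolding c_def by (simp add: field_simps)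
    also have "\<dots> \<le> 2 * 2 ^ Suc I / 2 ^ (i + Suc I)"
      by (intro divide_right_mono mult_left_mono hI) auto
    also have "\<dots> = 2 * (1 / 2) ^ i" by (simp add: power_add power_divide)
    finally show ?thesis .
  qed
  have geo: "summable (\<lambda>i. 2 * (1 / 2 :: real) ^ i)" by (intro summable_mult summable_geometric) auto
  have summ': "summable (\<lambda>i. c (i + Suc I))"
    by (rule summable_comparison_test'[OF geo, of 0]) (use tail c0 in auto)
  then have summ: "summable c" by (simp only: summable_iff_shift)
  have "suminf c = (\<Sum>i. c (i + Suc I)) + (\<Sum>i<Suc I. c i)"
    by (rule suminf_split_initial_segment[OF summ])
  also have "\<dots> \<le> (\<Sum>i. 2 * (1 / 2 :: real) ^ i) + (\<Sum>i<Suc I. 1)"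
    by (intro add_mono suminf_le sum_mono tail summ' geo c1)
  also have "\<dots> \<le> log 2 (1 / h) + 5"
    using I1 suminf_geometric[of "1/2::real"] by (simp add: suminf_mult)
  also have "\<dots> \<le> 6 * log 2 (1 / h)" using log by simp
  finally have sumc: "suminf c \<le> 6 / ln 2 * ln (1 / h)" by (simp add: log_def)
  have bc: "(\<lambda>i. ?b i * (2 ^ i) ^ CARD('n)) = (\<lambda>i. 2 ^ CARD('n) * c i)"
    by (auto simp: c_def)
  have w0: "0 \<le> w j" for j unfolding w_def using h by (intro divide_nonneg_nonneg) (auto simp: add_nonneg_nonneg)
  have wb: "w j \<le> ?b (dyadic_index (norm (x - vec_of_int j)))" for j
  proof -
    let ?d = "norm (x - vec_of_int j)"
    let ?p = "2 ^ dyadic_index ?d :: real"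
    have p: "?p \<le> 2 * (1 + ?d)" by (intro dyadic_index_le) auto
    have d: "1 + ?d > 0" using norm_ge_zero[of "x - vec_of_int j"] by linarith
    have "1 / (h * (1 + ?d)) \<le> 2 / (h * ?p)" using p d h by (simp add: divide_simps)
    moreover have "1 / (1 + ?d) ^ CARD('n) \<le> 2 ^ CARD('n) / ?p ^ CARD('n)"
      by (rule inverse_power_dyadic_le) simp
    ultimately have "min 1 (1 / (h * (1 + ?d))) * (1 / (1 + ?d) ^ CARD('n))
        \<le> min 1 (2 / (h * ?p)) * (2 ^ CARD('n) / ?p ^ CARD('n))"
      using h d by (intro mult_mono min.mono) auto
    then show ?thesis by (simp add: w_def mult_ac)
  qed
  have b0: "0 \<le> ?b i" for i using h by simp
  have bs: "summable (\<lambda>i. ?b i * (2 ^ i) ^ CARD('n))" unfolding bc by (intro summable_mult summ)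
  show "w summable_on UNIV" by (rule lattice_sum_dyadic(1)[of w ?b x, OF w0 wb b0 bs])
  have "infsum w UNIV \<le> 3 ^ CARD('n) * (\<Sum>i. ?b i * (2 ^ i) ^ CARD('n))"
    by (rule lattice_sum_dyadic(2)[of w ?b x, OF w0 wb b0 bs])
  also have "\<dots> = 3 ^ CARD('n) * (2 ^ CARD('n) * suminf c)"
    unfolding bc by (simp add: suminf_mult summ)
  also have "\<dots> \<le> 3 ^ CARD('n) * (2 ^ CARD('n) * (6 / ln 2 * ln (1 / h)))"
    by (intro mult_left_mono sumc) auto
  finally show "infsum w UNIV \<le> 3 ^ CARD('n) * (2 ^ CARD('n) * (6 / ln 2 * ln (1 / h)))" .
qed

lemma lattice_abs_summable:
  fixes g :: "real ^ 'n \<Rightarrow> 'b::real_normed_vector"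
  assumes "\<And>z. norm (g z) \<le> C / (1 + norm z) ^ (CARD('n) + 1)"
  shows "(\<lambda>j. norm (g (x - vec_of_int j))) summable_on UNIV"
proof (rule summable_on_comparison_test)
  show "(\<lambda>j. C * (1 / (1 + norm (x - vec_of_int j)) ^ (CARD('n) + 1))) summable_on UNIV"
    by (intro summable_on_cmult_right lattice_weight_summable)
qed (use assms in auto)

section \<open>Monomials indexed by lists of coordinates\<close>

text \<open>Monomials are indexed by lists of coordinates, like the mixed derivatives \<open>partials\<close>. This suits
  induction on the order, and sums over all lists of length \<open>k\<close> absorb the multinomial coefficients
  of Taylor's formula.\<close>

definition mon :: "'n list \<Rightarrow> real ^ 'n \<Rightarrow> real" where
  "mon is x = (\<Prod>i\<leftarrow>is. x $ i)"

lemma mon_simps [simp]: "mon [] x = 1" "mon (i # is) x = x $ i * mon is x"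
  by (simp_all add: mon_def)

lemma abs_mon_le: "\<bar>mon is x\<bar> \<le> norm x ^ length is"
  by (induction "is") (auto simp: abs_mult intro!: mult_mono component_le_norm_cart)

lemma continuous_on_mon [continuous_intros]:
  "continuous_on S f \<Longrightarrow> continuous_on S (\<lambda>x. mon is (f x))"
  by (induction "is") (auto intro!: continuous_intros)

lemma mon_scaleR: "mon is (h *\<^sub>R x) = h ^ length is * mon is x"
  by (induction "is") auto

text \<open>A monomial of degree at most \<open>L\<close> costs at most \<open>L\<close> orders of decay.\<close>

lemma mon_decay:
  assumes decay: "\<And>x :: real ^ 'n. \<bar>\<psi> x\<bar> \<le> B / (1 + norm x) ^ (L + K)" and len: "length is \<le> L"
    and B: "0 \<le> B"
  shows "\<bar>mon is x * \<psi> x\<bar> \<le> B / (1 + norm x) ^ K"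
proof -
  have p: "1 \<le> 1 + norm x" by simp
  have "\<bar>mon is x\<bar> \<le> norm x ^ length is" by (rule abs_mon_le)
  also have "\<dots> \<le> (1 + norm x) ^ length is" by (intro power_mono) auto
  also have "\<dots> \<le> (1 + norm x) ^ L" by (rule power_increasing[OF len p])
  finally have "\<bar>mon is x * \<psi> x\<bar> \<le> (1 + norm x) ^ L * (B / (1 + norm x) ^ (L + K))"
    unfolding abs_mult by (intro mult_mono decay) (auto simp: add_nonneg_nonneg)
  also have "\<dots> = B / (1 + norm x) ^ K"
  proof -
    have "1 + norm x \<noteq> 0" using p by linarith
    then show ?thesis by (simp add: power_add)
  qed
  finally show ?thesis .
qed

lemma mon_eq_prod_count: "mon is x = (\<Prod>i\<in>UNIV. (x $ i) ^ count_list is i)"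
proof (induction "is")
  case (Cons j "is")
  have "(\<Prod>i\<in>UNIV. (x $ i) ^ count_list (j # is) i)
      = (\<Prod>i\<in>UNIV. (if i = j then x $ i else 1) * (x $ i) ^ count_list is i)"
    by (intro prod.cong) auto
  also have "\<dots> = x $ j * (\<Prod>i\<in>UNIV. (x $ i) ^ count_list is i)"
    by (simp add: prod.distrib)
  finally show ?case using Cons by simp
qed simp

lemma length_eq_multi_order: "length is = multi_order (count_list is)"
proof (induction "is")
  case (Cons j "is")
  have "multi_order (count_list (j # is)) = (\<Sum>i\<in>UNIV. (if i = j then 1 else 0) + count_list is i)"
    unfolding multi_order_def by (intro sum.cong) auto
  also have "\<dots> = 1 + multi_order (count_list is)"
    by (simp add: sum.distrib multi_order_def)
  finally show ?case using Cons by (simp del: count_list.simps)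
qed (simp add: multi_order_def)

text \<open>Every multi-index is the count function of some list, so monomials indexed by lists
  cover the monomials of \<open>polys_upto\<close>.\<close>

lemma ex_list_with_counts: "\<exists>is :: 'n::finite list. count_list is = \<alpha>"
proof -
  obtain xs :: "'n list" where xs: "set xs = UNIV" "distinct xs"
    using finite_distinct_list[of "UNIV :: 'n set"] by auto
  have rep: "count_list (replicate k i) j = (if i = j then k else 0)" for k and i j :: 'n
    by (induction k) auto
  have "count_list (concat (map (\<lambda>i. replicate (\<alpha> i) i) ys)) j = (if j \<in> set ys then \<alpha> j else 0)"
    if "distinct ys" for ys j
    using that by (induction ys) (auto simp: rep)
  from this[OF xs(2)] show ?thesis using xs(1) by (intro exI[of _ "concat (map (\<lambda>i. replicate (\<alpha> i) i) xs)"]) auto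
qed

text \<open>The list chosen inside \<open>multi_deriv\<close> is only known through its counts, which is enough
  to determine its length and its monomial.\<close>

lemma multi_deriv_eq_partials:
  obtains js where "multi_deriv (count_list is) f = partials js f" "mon js = mon is" "length js = length is"
proof -
  let ?js = "SOME js. \<forall>i. count_list js i = count_list is i"
  have "\<forall>i. count_list ?js i = count_list is i" by (rule someI[of _ "is"]) simp
  then have c: "count_list ?js = count_list is" by auto
  show ?thesis
  proof (rule that[of ?js])
    show "mon ?js = mon is" by (simp add: fun_eq_iff mon_eq_prod_count c)
    show "length ?js = length is" by (simp add: length_eq_multi_order c)
  qed (simp add: multi_deriv_def)
qed

section \<open>Lebesgue integration on Euclidean space\<close>

text \<open>A point of non-vanishing has a neighbourhood of positive measure.\<close>

lemma zero_if_AE_zero_on_open: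
  fixes f :: "real ^ 'n \<Rightarrow> real"
  assumes "open U" "continuous_on U f" "AE x in lborel. x \<in> U \<longrightarrow> f x = 0" "x \<in> U"
  shows "f x = 0"
proof (rule ccontr)
  assume "f x \<noteq> 0"
  let ?V = "U \<inter> f -` (- {0})"
  have "open ?V" using assms(1,2) by (simp add: continuous_open_preimage open_Compl)
  moreover have "negligible ?V"
  proof -
    have "AE x in lborel. x \<notin> ?V" using assms(3) by eventually_elim auto
    then have "AE x in lebesgue. x \<notin> ?V" by (rule AE_completion)
    then show ?thesis by (simp add: negligible_iff_null_sets AE_iff_null_sets \<open>open ?V\<close> borel_open)
  qed
  ultimately show False using open_not_negligible \<open>f x \<noteq> 0\<close> \<open>x \<in> U\<close> by blast
qed

lemma lborel_integral_affine:
  fixes f :: "real ^ 'n \<Rightarrow> 'b::{banach, second_countable_topology}"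
  assumes [measurable]: "f \<in> borel_measurable borel" and c: "c \<noteq> 0"
  shows "integral\<^sup>L lborel f = \<bar>c\<bar> ^ CARD('n) *\<^sub>R (LINT x|lborel. f (t + c *\<^sub>R x))"
proof -
  have "integral\<^sup>L lborel f = integral\<^sup>L (density (distr lborel borel (\<lambda>x. t + c *\<^sub>R x)) (\<lambda>_. \<bar>c\<bar> ^ CARD('n))) f"
    using lborel_affine[OF c, of t] by simp
  also have "\<dots> = (LINT x|distr lborel borel (\<lambda>x. t + c *\<^sub>R x). \<bar>c\<bar> ^ CARD('n) *\<^sub>R f x)"
    by (rule integral_density) auto
  also have "\<dots> = \<bar>c\<bar> ^ CARD('n) *\<^sub>R (LINT x|lborel. f (t + c *\<^sub>R x))"
    by (subst integral_distr) auto
  finally show ?thesis .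
qed

lemma lborel_integral_translate:
  fixes p :: "'a::euclidean_space \<Rightarrow> 'b::{banach, second_countable_topology}"
  assumes "p \<in> borel_measurable borel"
  shows "integral\<^sup>L lborel p = (LINT x|lborel. p (x + t))"
  using assms by (subst lborel_distr_plus[of t, symmetric], subst integral_distr) (auto simp: add.commute)

section \<open>Smooth test functions\<close>

text \<open>Letting \<open>p\<close> range over all polynomials makes this family of functions closed under differentiation,
  so its smoothness reduces to the computation of one derivative.\<close>

definition flat :: "real poly \<Rightarrow> real \<Rightarrow> real" where
  "flat p t = (if t \<le> 0 then 0 else poly p (1 / t) * exp (- (1 / t)))"

lemma poly_exp_tendsto_0: "((\<lambda>s. poly p s * exp (- s)) \<longlongrightarrow> (0::real)) at_top"
proof -
  have "((\<lambda>s. \<Sum>i\<le>degree p. coeff p i * (s ^ i / exp s)) \<longlongrightarrow> (\<Sum>i\<le>degree p. coeff p i * 0)) at_top"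
    by (intro tendsto_intros tendsto_power_div_exp_0)
  moreover have "(\<lambda>s. poly p s * exp (- s)) = (\<lambda>s. \<Sum>i\<le>degree p. coeff p i * (s ^ i / exp s))"
    by (simp add: poly_altdef sum_distrib_right exp_minus divide_inverse mult.assoc)
  ultimately show ?thesis by simp
qed

lemma flat_tendsto_0: "(flat p \<longlongrightarrow> 0) (at 0)"
proof (rule filterlim_split_at)
  show "(flat p \<longlongrightarrow> 0) (at_left 0)"
    by (rule tendsto_eventually) (auto simp: eventually_at_filter flat_def)
  have "((\<lambda>t. poly p (inverse t) * exp (- inverse t)) \<longlongrightarrow> 0) (at_right 0)"
    by (rule filterlim_compose[OF poly_exp_tendsto_0 filterlim_inverse_at_top_right])
  then show "(flat p \<longlongrightarrow> 0) (at_right 0)"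
    by (rule Lim_transform_eventually)
      (auto simp: eventually_at_filter flat_def divide_inverse)
qed

definition flat_diff :: "real poly \<Rightarrow> real poly" where
  "flat_diff p = [:0, 0, 1:] * (p - pderiv p)"

text \<open>At the origin the difference quotient of \<open>flat p\<close> is again a member of the family, with
  \<open>p\<close> multiplied by the variable, so it tends to \<open>0\<close> by the dominance of \<open>exp\<close>.\<close>

lemma DERIV_flat: "(flat p has_real_derivative flat (flat_diff p) t) (at t)"
proof -
  consider "t < 0" | "t = 0" | "t > 0" by linarith
  then show ?thesis
  proof cases
    case 1
    have "((\<lambda>t. 0::real) has_real_derivative 0) (at t)" by simp
    from has_field_derivative_transform_within_open[OF this, of "{..<0}" "flat p"]
    show ?thesis using 1 by (simp add: flat_def)
  next
    case 2
    have eq: "(flat p s - flat p 0) / (s - 0) = flat (pCons 0 p) s" for s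
      by (auto simp: flat_def)
    show ?thesis
      unfolding 2 has_field_derivative_iff eq using flat_tendsto_0[of "pCons 0 p"]
      by (simp add: flat_def[of _ 0])
  next
    case 3
    let ?f = "\<lambda>t. poly p (1 / t) * exp (- (1 / t))"
    have "(?f has_real_derivative
        poly (pderiv p) (1 / t) * (- 1 / t\<^sup>2) * exp (- (1 / t)) + exp (- (1 / t)) * (1 / t\<^sup>2) * poly p (1 / t)) (at t)"
    proof (intro DERIV_mult)
      have inv: "((\<lambda>t. 1 / t) has_real_derivative - 1 / t\<^sup>2) (at t)"
        using 3 by (auto intro!: derivative_eq_intros simp: power2_eq_square)
      show "((\<lambda>t. poly p (1 / t)) has_real_derivative poly (pderiv p) (1 / t) * (- 1 / t\<^sup>2)) (at t)"
        by (rule DERIV_chain2[OF poly_DERIV inv])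
      show "((\<lambda>t. exp (- (1 / t))) has_real_derivative exp (- (1 / t)) * (1 / t\<^sup>2)) (at t)"
        using 3 by (auto intro!: derivative_eq_intros simp: power2_eq_square)
    qed
    then have "(?f has_real_derivative flat (flat_diff p) t) (at t)"
      using 3 by (simp add: flat_def flat_diff_def algebra_simps power2_eq_square)
    from has_field_derivative_transform_within_open[OF this, of "{0<..}" "flat p"]
    show ?thesis using 3 by (simp add: flat_def)
  qed
qed

lemma continuous_flat: "continuous_on S (flat p)"
  using DERIV_isCont[OF DERIV_flat] by (simp add: continuous_at_imp_continuous_on)

text \<open>An algebra of smooth functions that is closed under partial derivatives and dilations, hence
  consists of functions of class \<open>C\<^sup>k\<close> for all \<open>k\<close>, and still contains bumps around every point.\<close>

inductive_set smooth_algebra :: "(real ^ 'n \<Rightarrow> complex) set" where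
  const: "(\<lambda>x. c) \<in> smooth_algebra"
| flat: "(\<lambda>x. complex_of_real (flat p (c + s * x $ i))) \<in> smooth_algebra"
| add: "f \<in> smooth_algebra \<Longrightarrow> g \<in> smooth_algebra \<Longrightarrow> (\<lambda>x. f x + g x) \<in> smooth_algebra"
| mult: "f \<in> smooth_algebra \<Longrightarrow> g \<in> smooth_algebra \<Longrightarrow> (\<lambda>x. f x * g x) \<in> smooth_algebra"

lemma smooth_algebra_continuous:
  assumes "f \<in> smooth_algebra"
  shows "continuous_on UNIV f"
  using assms
proof induction
  case (flat p c s i)
  have "continuous_on UNIV (\<lambda>x::real^'a. flat p (c + s * x $ i))"
    by (rule continuous_on_compose2[OF continuous_flat[of UNIV]]) (auto intro!: continuous_intros)
  then show ?case by (intro continuous_intros)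
qed (auto intro: continuous_intros)

text \<open>Closure under partial differentiation; iterating it yields \<open>C_k\<close> for every \<open>k\<close>.\<close>

lemma smooth_algebra_derivative:
  assumes "f \<in> smooth_algebra"
  obtains f' where "f' \<in> smooth_algebra"
    "\<And>x. ((\<lambda>t. f (x + t *\<^sub>R axis i 1)) has_vector_derivative f' x) (at 0)"
proof -
  have "\<exists>f'\<in>smooth_algebra. \<forall>x. ((\<lambda>t. f (x + t *\<^sub>R axis i 1)) has_vector_derivative f' x) (at 0)"
    using assms
  proof induction
    case (const c)
    show ?case by (rule bexI[OF _ smooth_algebra.const[of 0]]) auto
  next
    case (flat p c s j)
    let ?d = "axis i 1 $ j :: real"
    let ?f' = "\<lambda>x. complex_of_real (flat (flat_diff p) (c + s * x $ j)) * complex_of_real (s * ?d)"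
    have "((\<lambda>t. complex_of_real (flat p (c + s * (x + t *\<^sub>R axis i 1) $ j))) has_vector_derivative ?f' x) (at 0)"
      for x :: "real ^ 'a"
    proof -
      have "((\<lambda>t. c + s * (x $ j + t * ?d)) has_real_derivative s * ?d) (at 0)"
        by (auto intro!: derivative_eq_intros)
      from DERIV_chain2[OF DERIV_flat this]
      have "((\<lambda>t. flat p (c + s * (x $ j + t * ?d))) has_real_derivative
          flat (flat_diff p) (c + s * (x $ j + 0 * ?d)) * (s * ?d)) (at 0)" .
      then have "((\<lambda>t. complex_of_real (flat p (c + s * (x $ j + t * ?d)))) has_vector_derivative
          complex_of_real (flat (flat_diff p) (c + s * (x $ j + 0 * ?d)) * (s * ?d))) (at 0)"
        by (intro has_vector_derivative_of_real) (simp add: has_real_derivative_iff_has_vector_derivative)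
      then show ?thesis by simp
    qed
    moreover have "?f' \<in> smooth_algebra" by (intro smooth_algebra.intros)
    ultimately show ?case by (rule_tac bexI[of _ ?f']) auto
  next
    case (add f g)
    then obtain f' g' where "f' \<in> smooth_algebra" "g' \<in> smooth_algebra"
      and "\<And>x. ((\<lambda>t. f (x + t *\<^sub>R axis i 1)) has_vector_derivative f' x) (at 0)"
      and "\<And>x. ((\<lambda>t. g (x + t *\<^sub>R axis i 1)) has_vector_derivative g' x) (at 0)" by blast
    then show ?case
      by (intro bexI[of _ "\<lambda>x. f' x + g' x"] allI has_vector_derivative_add smooth_algebra.add)
  next
    case (mult f g)
    then obtain f' g' where S: "f' \<in> smooth_algebra" "g' \<in> smooth_algebra"
      and D: "\<And>x. ((\<lambda>t. f (x + t *\<^sub>R axis i 1)) has_vector_derivative f' x) (at 0)"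
        "\<And>x. ((\<lambda>t. g (x + t *\<^sub>R axis i 1)) has_vector_derivative g' x) (at 0)" by blast
    have "((\<lambda>t. f (x + t *\<^sub>R axis i 1) * g (x + t *\<^sub>R axis i 1)) has_vector_derivative
        (f x * g' x + f' x * g x)) (at 0)" for x
      using has_vector_derivative_mult[OF D(1)[of x] D(2)[of x]] by simp
    moreover have "(\<lambda>x. f x * g' x + f' x * g x) \<in> smooth_algebra"
      using mult S by (intro smooth_algebra.intros)
    ultimately show ?case by (intro bexI[of _ "\<lambda>x. f x * g' x + f' x * g x"]) auto
  qed
  then show ?thesis using that by blast
qed

lemma partials_smooth_algebra:
  assumes "f \<in> smooth_algebra"
  shows "partials is f \<in> smooth_algebra"
proof (induction "is")
  case Nil
  then show ?case using assms by (simp add: partials_def)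
next
  case (Cons i "is")
  obtain f' where f': "f' \<in> smooth_algebra"
    "\<And>x. ((\<lambda>t. partials is f (x + t *\<^sub>R axis i 1)) has_vector_derivative f' x) (at 0)"
    using smooth_algebra_derivative[OF Cons] by blast
  have "partials (i # is) f x = f' x" for x
    using vector_derivative_at[OF f'(2)[of x]] by (simp add: partials_def partial_deriv_def)
  then show ?case using f'(1) by presburger
qed

lemma smooth_algebra_C_k:
  assumes "f \<in> smooth_algebra"
  shows "C_k k f"
  unfolding C_k_def
proof (intro conjI allI impI)
  fix "is" i x
  obtain f' where "((\<lambda>t. partials is f (x + t *\<^sub>R axis i 1)) has_vector_derivative f' x) (at 0)"
    using smooth_algebra_derivative[OF partials_smooth_algebra[OF assms]] by metis
  then show "(\<lambda>t. partials is f (x + t *\<^sub>R axis i 1)) differentiable (at 0)"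
    using differentiableI_vector by blast
qed (intro smooth_algebra_continuous partials_smooth_algebra assms)

lemma smooth_algebra_scale:
  assumes "f \<in> smooth_algebra"
  shows "(\<lambda>x. f (r *\<^sub>R x)) \<in> smooth_algebra"
  using assms
proof induction
  case (flat p c s i)
  have "(\<lambda>x::real^'a. complex_of_real (flat p (c + (s * r) * x $ i))) \<in> smooth_algebra"
    by (rule smooth_algebra.flat)
  then show ?case by (simp add: mult.assoc)
qed (auto intro: smooth_algebra.intros)

lemma smooth_algebra_prod:
  assumes "finite A" "\<And>a. a \<in> A \<Longrightarrow> f a \<in> smooth_algebra"
  shows "(\<lambda>x. \<Prod>a\<in>A. f a x) \<in> smooth_algebra"
  using assms by (induction A rule: finite_induct) (auto intro: smooth_algebra.intros)

text \<open>A product over the coordinates of one-dimensional bumps \<open>flat 1 (r + s) * flat 1 (r - s)\<close>.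
  Its support is a cube of half-width \<open>r = e / n\<close>, which fits into the ball of radius \<open>e\<close>.\<close>

lemma bump_exists:
  fixes a :: "real ^ 'n"
  assumes S: "open S" "a \<in> S"
  obtains b :: "real ^ 'n \<Rightarrow> real"
  where "(\<lambda>x. complex_of_real (b x)) \<in> smooth_algebra"
    "test_function_on S (\<lambda>x. complex_of_real (b x))" "\<And>x. 0 \<le> b x" "0 < b a"
proof -
  obtain e where e: "e > 0" "cball a e \<subseteq> S" using S open_contains_cball by blast
  define r where "r = e / real CARD('n)"
  have r: "r > 0" using e by (simp add: r_def)
  define b where "b x = (\<Prod>i\<in>UNIV. flat 1 ((r - a $ i) + 1 * x $ i) * flat 1 ((r + a $ i) + (-1) * x $ i))"
    for x
  have smooth: "(\<lambda>x. complex_of_real (b x)) \<in> smooth_algebra"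
    unfolding b_def of_real_prod of_real_mult
    by (intro smooth_algebra_prod smooth_algebra.mult smooth_algebra.flat finite)
  have supp: "{x. complex_of_real (b x) \<noteq> 0} \<subseteq> cball a e"
  proof
    fix x assume "x \<in> {x. complex_of_real (b x) \<noteq> 0}"
    then have "\<bar>(x - a) $ i\<bar> \<le> r" for i
      by (auto simp: b_def flat_def abs_le_iff split: if_splits dest!: spec[of _ i])
    then have "(\<Sum>i\<in>UNIV. \<bar>(x - a) $ i\<bar>) \<le> (\<Sum>i\<in>(UNIV::'n set). r)" by (intro sum_mono)
    then have "norm (x - a) \<le> e" using norm_le_l1_cart[of "x - a"] by (simp add: r_def)
    then show "x \<in> cball a e" by (simp add: dist_norm norm_minus_commute)
  qed
  then have cl: "closure {x. complex_of_real (b x) \<noteq> 0} \<subseteq> cball a e"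
    by (simp add: closure_minimal)
  have "compact (closure {x. complex_of_real (b x) \<noteq> 0})"
    using bounded_subset[OF bounded_cball supp] by (subst compact_closure)
  then have "test_function_on S (\<lambda>x. complex_of_real (b x))"
    using cl e smooth_algebra_C_k[OF smooth] unfolding test_function_on_def by blast
  moreover have "0 \<le> b x" for x unfolding b_def by (intro prod_nonneg) (auto simp: flat_def)
  moreover have "0 < b a" unfolding b_def using r by (intro prod_pos) (auto simp: flat_def)
  ultimately show ?thesis using smooth that by blast
qed

lemma integrable_continuous_test_function:
  assumes S: "open S" "continuous_on S F" and \<phi>: "test_function_on S \<phi>"
  shows "integrable lborel (\<lambda>x. F x * \<phi> x :: complex)"
proof -
  define K where "K = closure {x. \<phi> x \<noteq> 0}"
  have K: "compact K" "K \<subseteq> S" using \<phi> by (auto simp: test_function_on_def K_def)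
  have "continuous_on UNIV (partials [] \<phi>)" using \<phi> unfolding test_function_on_def C_k_def by blast
  then have "continuous_on K (\<lambda>x. F x * \<phi> x)"
    using S K by (intro continuous_intros) (auto simp: partials_def intro: continuous_on_subset)
  from borel_integrable_compact[OF K(1) this]
  have "integrable lborel (\<lambda>x. indicator K x *\<^sub>R (F x * \<phi> x))" .
  moreover have "\<phi> x = 0" if "x \<notin> K" for x using that closure_subset[of "{x. \<phi> x \<noteq> 0}"] by (auto simp: K_def)
  then have "(\<lambda>x. indicator K x *\<^sub>R (F x * \<phi> x)) = (\<lambda>x. F x * \<phi> x)" by (auto simp: indicator_def)
  ultimately show ?thesis by simp
qed

text \<open>The fundamental lemma of the calculus of variations. If \<open>F a \<noteq> 0\<close>, then the real part of
  \<open>cnj (F a) * F\<close> stays above half of its positive value at \<open>a\<close> on a neighbourhood, and a bump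
  supported there has a non-zero integral against \<open>F\<close>.\<close>

lemma continuous_zero_if_test_integrals_zero:
  fixes F :: "real ^ 'n \<Rightarrow> complex"
  assumes S: "open S" "continuous_on S F" and a: "a \<in> S"
    and zero: "\<And>\<phi>. \<phi> \<in> smooth_algebra \<Longrightarrow> test_function_on S \<phi> \<Longrightarrow> (LINT x|lborel. F x * \<phi> x) = 0"
  shows "F a = 0"
proof (rule ccontr)
  assume c: "F a \<noteq> 0"
  let ?c = "F a"
  define R where "R x = Re (cnj ?c * F x)" for x
  have Ra: "R a = (norm ?c)\<^sup>2" unfolding R_def by (simp add: mult.commute[of "cnj _"] complex_mult_cnj cmod_power2)
  have Rc: "continuous_on S R" unfolding R_def using S by (intro continuous_intros)
  let ?U = "S \<inter> R -` {(norm ?c)\<^sup>2 / 2<..}"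
  have U: "open ?U" using continuous_on_open_vimage[OF S(1)] Rc by (metis Int_commute open_greaterThan)
  have aU: "a \<in> ?U" using a c Ra by simp
  obtain b where b: "(\<lambda>x. complex_of_real (b x)) \<in> smooth_algebra"
    "test_function_on ?U (\<lambda>x. complex_of_real (b x))" "\<And>x. 0 \<le> b x" "0 < b a"
    using bump_exists[OF U aU] by blast
  have tS: "test_function_on S (\<lambda>x. complex_of_real (b x))"
    using b(2) unfolding test_function_on_def by blast
  have ib: "integrable lborel b"
  proof -
    have "test_function_on UNIV (\<lambda>x. complex_of_real (b x))" using b(2) by (simp add: test_function_on_def)
    from integrable_continuous_test_function[OF open_UNIV continuous_on_const this, of 1]
    show ?thesis by (simp add: complex_of_real_integrable_eq)
  qed
  have iF: "integrable lborel (\<lambda>x. F x * complex_of_real (b x))"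
    by (rule integrable_continuous_test_function[OF S tS])
  have iR: "integrable lborel (\<lambda>x. R x * b x)"
    using integrable_Re[OF integrable_mult_right[OF iF, of "cnj ?c"]] by (simp add: R_def mult.assoc[symmetric])
  have "(LINT x|lborel. R x * b x) = Re (cnj ?c * (LINT x|lborel. F x * complex_of_real (b x)))"
    unfolding integral_mult_right_zero[symmetric]
    by (subst integral_Re[symmetric]) (use integrable_mult_right[OF iF, of "cnj ?c"] in \<open>auto simp: R_def algebra_simps\<close>)
  also have "\<dots> = 0" using zero[OF b(1) tS] by simp
  finally have 0: "(LINT x|lborel. R x * b x) = 0" .
  have "(norm ?c)\<^sup>2 / 2 * b x \<le> R x * b x" for x
  proof (cases "b x = 0")
    case False
    then have "x \<in> ?U" using b(2) closure_subset[of "{x. complex_of_real (b x) \<noteq> 0}"]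
      by (auto simp: test_function_on_def)
    then show ?thesis using b(3) by (intro mult_right_mono) auto
  qed simp
  then have "(LINT x|lborel. (norm ?c)\<^sup>2 / 2 * b x) \<le> (LINT x|lborel. R x * b x)"
    by (intro integral_mono iR integrable_mult_right ib)
  then have "(LINT x|lborel. b x) \<le> 0" using c 0 by (simp add: mult_le_0_iff)
  then have "(LINT x|lborel. b x) = 0" using b(3) by (simp add: antisym integral_nonneg)
  then have "AE x in lborel. b x = 0" using integral_nonneg_eq_0_iff_AE[OF ib] b(3) by simp
  moreover have "continuous_on UNIV b"
    using continuous_on_Re[OF smooth_algebra_continuous[OF b(1)]] by simp
  ultimately have "b a = 0" by (intro zero_if_AE_zero_on_open[of UNIV b]) auto
  then show False using b(4) by simp
qed

lemma borel_measurable_fourier: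
  assumes [measurable]: "f \<in> borel_measurable borel"
  shows "fourier f \<in> borel_measurable borel"
  unfolding fourier_def by measurable

section \<open>Homogeneity of the generalised Fourier transform\<close>

lemma test_function_smooth_scale:
  assumes "\<phi> \<in> smooth_algebra" "test_function_on (- {0}) \<phi>" "r > 0"
  shows "test_function_on (- {0}) (\<lambda>x. \<phi> (r *\<^sub>R x))"
proof -
  let ?K = "closure {x. \<phi> x \<noteq> 0}"
  let ?K' = "(\<lambda>x. inverse r *\<^sub>R x) ` ?K"
  have K: "compact ?K" "0 \<notin> ?K" using assms(2) by (auto simp: test_function_on_def)
  have "compact ?K'" by (intro compact_continuous_image continuous_intros K)
  moreover have "{x. \<phi> (r *\<^sub>R x) \<noteq> 0} \<subseteq> ?K'"
  proof
    fix x assume "x \<in> {x. \<phi> (r *\<^sub>R x) \<noteq> 0}"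
    then have "r *\<^sub>R x \<in> ?K" using closure_subset by fastforce
    then show "x \<in> ?K'" using assms(3) by (intro image_eqI[of _ _ "r *\<^sub>R x"]) auto
  qed
  ultimately have "closure {x. \<phi> (r *\<^sub>R x) \<noteq> 0} \<subseteq> ?K'" "compact (closure {x. \<phi> (r *\<^sub>R x) \<noteq> 0})"
    by (auto simp: closure_minimal compact_imp_closed compact_closure intro: bounded_subset compact_imp_bounded)
  moreover have "0 \<notin> ?K'" using K assms(3) by auto
  ultimately show ?thesis
    using smooth_algebra_C_k[OF smooth_algebra_scale[OF assms(1), of r]] unfolding test_function_on_def by blast
qed

text \<open>Dilating a test function by \<open>t\<close> multiplies the pairing with \<open>u\<close> by \<open>t\<^sup>-\<^sup>m\<close>, since \<open>u\<close> is
  homogeneous, and the pairing with \<open>F\<close> turns \<open>F\<close> into \<open>t\<^sup>n F(t \<cdot>)\<close>. Comparing the two for all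
  test functions identifies the continuous functions \<open>t\<^sup>n F(t y)\<close> and \<open>t\<^sup>-\<^sup>m F(y)\<close>.\<close>

lemma generalised_fourier_homogeneous:
  fixes F :: "real ^ 'n \<Rightarrow> complex"
  assumes F: "is_generalised_fourier (\<lambda>x. complex_of_real (rbf_u m x)) F"
    and t: "t > 0" and y: "y \<noteq> 0"
  shows "complex_of_real (t ^ (CARD('n) + m)) * F (t *\<^sub>R y) = F y"
proof -
  let ?n = "CARD('n)" and ?S = "- {0} :: (real ^ 'n) set"
  define D where "D y = complex_of_real (t ^ (?n + m)) * F (t *\<^sub>R y) - F y" for y
  have Fc: "continuous_on ?S F" using F by (simp add: is_generalised_fourier_def)
  have Ftc: "continuous_on ?S (\<lambda>y. F (t *\<^sub>R y))"
    by (rule continuous_on_compose2[OF Fc]) (use t in \<open>auto intro!: continuous_intros\<close>)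
  have "D y = 0"
  proof (rule continuous_zero_if_test_integrals_zero)
    show "open ?S" by (rule open_Compl) simp
    show "continuous_on ?S D" unfolding D_def by (intro continuous_intros Fc Ftc)
    fix \<phi> assume \<phi>: "\<phi> \<in> smooth_algebra" "test_function_on ?S \<phi>"
    define \<phi>t where "\<phi>t x = \<phi> (inverse t *\<^sub>R x)" for x
    have \<phi>t: "\<phi>t \<in> smooth_algebra" "test_function_on ?S \<phi>t"
      unfolding \<phi>t_def using \<phi> t smooth_algebra_scale test_function_smooth_scale[OF \<phi>] by auto
    have meas [measurable]: "\<phi> \<in> borel_measurable borel" "\<phi>t \<in> borel_measurable borel"
      using smooth_algebra_continuous \<phi> \<phi>t by (auto intro: borel_measurable_continuous_onI)
    have fm [measurable]: "fourier \<phi> \<in> borel_measurable borel" "fourier \<phi>t \<in> borel_measurable borel"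
      by (intro borel_measurable_fourier meas)+
    have [measurable]: "rbf_u m \<in> borel_measurable borel" unfolding rbf_u_def by measurable
    \<comment> \<open>The transform of the dilated test function, by the substitution \<open>x = t z\<close>.\<close>
    have ft: "fourier \<phi>t x = complex_of_real (t ^ ?n) * fourier \<phi> (t *\<^sub>R x)" for x
      unfolding fourier_def
      by (subst lborel_integral_affine[where c = t and t = 0])
        (use t in \<open>auto simp: \<phi>t_def scaleR_conv_of_real[where 'a = complex]\<close>)
    have FG: "(LINT x|lborel. complex_of_real (rbf_u m x) * fourier \<phi> x) = (LINT x|lborel. F x * \<phi> x)"
      if "test_function_on ?S \<phi>" for \<phi>
      using F that by (simp add: is_generalised_fourier_def distr_fourier_def regular_distr_def)
    have "(LINT x|lborel. F x * \<phi>t x) = (LINT x|lborel. complex_of_real (rbf_u m x) * fourier \<phi>t x)"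
      using FG[OF \<phi>t(2)] by simp
    also have "\<dots> = \<bar>inverse t\<bar> ^ ?n *\<^sub>R
        (LINT x|lborel. complex_of_real (rbf_u m (0 + inverse t *\<^sub>R x)) * fourier \<phi>t (0 + inverse t *\<^sub>R x))"
      by (rule lborel_integral_affine) (use t in auto)
    also have "\<dots> = complex_of_real (inverse t ^ m) * (LINT x|lborel. complex_of_real (rbf_u m x) * fourier \<phi> x)"
      using t by (simp add: ft rbf_u_def scaleR_conv_of_real[where 'a = complex] power_mult_distrib field_simps
          flip: integral_mult_right_zero)
    also have "\<dots> = complex_of_real (inverse t ^ m) * (LINT x|lborel. F x * \<phi> x)"
      by (simp add: FG[OF \<phi>(2)])
    finally have 1: "(LINT x|lborel. F x * \<phi>t x) = complex_of_real (inverse t ^ m) * (LINT x|lborel. F x * \<phi> x)" .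
    have Fm: "(\<lambda>x. F x * \<phi>t x) \<in> borel_measurable borel"
      using borel_measurable_integrable[OF integrable_continuous_test_function[OF _ Fc \<phi>t(2)]] by (simp add: open_Compl)
    have 2: "(LINT x|lborel. F x * \<phi>t x) = complex_of_real (t ^ ?n) * (LINT x|lborel. F (t *\<^sub>R x) * \<phi> x)"
      by (subst lborel_integral_affine[where c = t and t = 0, OF Fm])
        (use t in \<open>auto simp: \<phi>t_def scaleR_conv_of_real[where 'a = complex]\<close>)
    have "(LINT x|lborel. D x * \<phi> x) = complex_of_real (t ^ (?n + m)) * (LINT x|lborel. F (t *\<^sub>R x) * \<phi> x)
        - (LINT x|lborel. F x * \<phi> x)"
      unfolding D_def left_diff_distrib mult.assoc
      by (subst Bochner_Integration.integral_diff)
        (auto intro!: integrable_mult_right integrable_continuous_test_function[of ?S] open_Compl Fc Ftc \<phi>)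
    also have "\<dots> = complex_of_real (t ^ m) * (LINT x|lborel. F x * \<phi>t x) - (LINT x|lborel. F x * \<phi> x)"
      by (simp add: 2 power_add mult_ac)
    also have "\<dots> = 0" using t by (simp add: 1 power_mult_distrib[symmetric] mult.assoc[symmetric]
          of_real_power[symmetric] of_real_mult[symmetric] del: of_real_power of_real_mult)
    finally show "(LINT x|lborel. D x * \<phi> x) = 0" .
  qed (use y in auto)
  then show ?thesis by (simp add: D_def)
qed

section \<open>Vanishing discrete moments\<close>

lemma coeff_zero_if_poly_small:
  fixes p :: "complex poly"
  assumes "eventually (\<lambda>t. norm (poly p (of_real t)) \<le> C * t ^ N) (at_right 0)" and "i < N"
  shows "coeff p i = 0"
  using assms
proof (induction N arbitrary: p i)
  case (Suc N)
  have "((\<lambda>t. poly p (complex_of_real t)) \<longlongrightarrow> poly p (of_real 0)) (at_right 0)"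
    by (intro tendsto_intros)
  moreover have "((\<lambda>t. poly p (complex_of_real t)) \<longlongrightarrow> 0) (at_right 0)"
  proof (rule Lim_null_comparison[OF Suc.prems(1)])
    have "((\<lambda>t. C * t ^ Suc N) \<longlongrightarrow> C * 0 ^ Suc N) (at_right (0::real))"
      by (intro tendsto_intros)
    then show "((\<lambda>t. C * t ^ Suc N) \<longlongrightarrow> 0) (at_right (0::real))" by simp
  qed
  ultimately have "poly p 0 = 0"
    using tendsto_unique trivial_limit_at_right_real by (metis of_real_0)
  then obtain q where p: "p = pCons 0 q"
    by (metis pCons_cases poly_pCons mult_zero_left add.right_neutral)
  have "eventually (\<lambda>t. norm (poly q (of_real t)) \<le> C * t ^ N) (at_right 0)"
    using Suc.prems(1) eventually_at_right_less[of 0]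
  proof eventually_elim
    case (elim t)
    then have "t * norm (poly q (of_real t)) \<le> t * (C * t ^ N)"
      by (simp add: p norm_mult mult_ac)
    then show ?case using elim(2) by simp
  qed
  then show ?case using Suc.IH[of q "i - 1"] Suc.prems(2) by (cases i) (auto simp: p)
qed simp

text \<open>Replacing each exponential by its Taylor polynomial costs \<open>O(t\<^sup>N)\<close>, so a polynomial of degree
  below \<open>N\<close> is \<open>O(t\<^sup>N)\<close> at \<open>0\<close> and must vanish. Its coefficients are the moments up to non-zero
  factors.\<close>

lemma power_moments_zero_if_exp_sum_small:
  fixes a :: "'k \<Rightarrow> real" and \<mu> :: "'k \<Rightarrow> real"
  assumes small: "eventually (\<lambda>t. norm (\<Sum>k\<in>\<Delta>. complex_of_real (\<mu> k) * exp (- \<i> * complex_of_real (t * a k))) \<le> C * t ^ N) (at_right 0)"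
    and j: "j < N"
  shows "(\<Sum>k\<in>\<Delta>. \<mu> k * a k ^ j) = 0"
proof -
  obtain M where N: "N = Suc M" using j by (cases N) auto
  define z where "z k = - \<i> * complex_of_real (a k)" for k
  define p where "p = (\<Sum>k\<in>\<Delta>. \<Sum>i\<le>M. monom (complex_of_real (\<mu> k) * (z k ^ i / fact i)) i)"
  have pe: "poly p (of_real t) = (\<Sum>k\<in>\<Delta>. complex_of_real (\<mu> k) * (\<Sum>i\<le>M. (z k * of_real t) ^ i / fact i))" for t
    by (simp add: p_def poly_sum poly_monom sum_distrib_left power_mult_distrib mult_ac)
  define C' where "C' = (\<Sum>k\<in>\<Delta>. \<bar>\<mu> k\<bar> * (\<bar>a k\<bar> ^ N / fact M))"
  have "eventually (\<lambda>t. norm (poly p (of_real t)) \<le> (C + C') * t ^ N) (at_right 0)"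
    using small eventually_at_right_less[of 0]
  proof eventually_elim
    case (elim t)
    let ?E = "\<Sum>k\<in>\<Delta>. complex_of_real (\<mu> k) * exp (- \<i> * complex_of_real (t * a k))"
    have e: "- \<i> * complex_of_real (t * a k) = z k * of_real t" for k by (simp add: z_def)
    have "norm (?E - poly p (of_real t))
        = norm (\<Sum>k\<in>\<Delta>. complex_of_real (\<mu> k) * (exp (z k * of_real t) - (\<Sum>i\<le>M. (z k * of_real t) ^ i / fact i)))"
      unfolding pe e by (simp only: right_diff_distrib sum_subtractf)
    also have "\<dots> \<le> (\<Sum>k\<in>\<Delta>. \<bar>\<mu> k\<bar> * ((\<bar>a k\<bar> * t) ^ N / fact M))"
    proof (rule order_trans[OF norm_sum sum_mono])
      fix k
      have "norm (exp (z k * of_real t) - (\<Sum>i\<le>M. (z k * of_real t) ^ i / fact i)) \<le> (\<bar>a k\<bar> * t) ^ N / fact M"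
        using Taylor_exp[of "z k * of_real t" M] elim(2) by (simp add: z_def N norm_mult)
      then show "norm (complex_of_real (\<mu> k) * (exp (z k * of_real t) - (\<Sum>i\<le>M. (z k * of_real t) ^ i / fact i)))
          \<le> \<bar>\<mu> k\<bar> * ((\<bar>a k\<bar> * t) ^ N / fact M)"
        unfolding norm_mult norm_of_real by (rule mult_left_mono) simp
    qed
    also have "\<dots> = C' * t ^ N"
      by (simp add: C'_def sum_distrib_left sum_distrib_right power_mult_distrib mult_ac)
    finally have "norm (?E - poly p (of_real t)) \<le> C' * t ^ N" .
    moreover have "norm b \<le> norm a + norm (a - b)" for a b :: complex
      using norm_triangle_ineq4[of a "a - b"] by simp
    from this[of "poly p (of_real t)" ?E]
    have "norm (poly p (of_real t)) \<le> norm ?E + norm (?E - poly p (of_real t))" .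
    ultimately show ?case using elim(1) by (simp add: distrib_right)
  qed
  then have "coeff p j = 0" using j by (rule coeff_zero_if_poly_small)
  also have "coeff p j = (\<Sum>k\<in>\<Delta>. complex_of_real (\<mu> k) * (z k ^ j / fact j))"
    using j by (simp add: p_def coeff_sum N if_distrib sum.delta cong: if_cong)
  also have "\<dots> = (- \<i>) ^ j / fact j * complex_of_real (\<Sum>k\<in>\<Delta>. \<mu> k * a k ^ j)"
    unfolding of_real_sum sum_distrib_left
    by (intro sum.cong refl) (simp only: z_def power_mult_distrib of_real_mult of_real_power
        times_divide_eq_left times_divide_eq_right mult_ac)
  finally show ?thesis by (simp add: of_real_eq_0_iff del: of_real_sum of_real_mult of_real_power)
qed

text \<open>Differentiating the identity for exponent \<open>j + 1\<close> in direction \<open>w\<close> splits off a factor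
  \<open>\<kappa> k \<bullet> w\<close>; repeating this replaces powers of one linear form by products of arbitrary ones.\<close>

lemma polarised_moments_zero:
  fixes \<kappa> :: "'k \<Rightarrow> real ^ 'n"
  assumes "\<And>v j. j < N \<Longrightarrow> (\<Sum>k\<in>\<Delta>. \<mu> k * (\<kappa> k \<bullet> v) ^ j) = 0"
    and "length vs + j < N"
  shows "(\<Sum>k\<in>\<Delta>. \<mu> k * (\<Prod>v\<leftarrow>vs. \<kappa> k \<bullet> v) * (\<kappa> k \<bullet> y) ^ j) = 0"
  using assms(2)
proof (induction vs arbitrary: j y)
  case (Cons w vs)
  let ?G = "\<lambda>t. \<Sum>k\<in>\<Delta>. \<mu> k * (\<Prod>v\<leftarrow>vs. \<kappa> k \<bullet> v) * (\<kappa> k \<bullet> y + t * (\<kappa> k \<bullet> w)) ^ Suc j"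
  have "?G t = 0" for t
    using Cons.IH[of "Suc j" "y + t *\<^sub>R w"] Cons.prems by (simp add: inner_add_right)
  then have "(?G has_real_derivative 0) (at 0)" by simp
  moreover have "(?G has_real_derivative
      (\<Sum>k\<in>\<Delta>. \<mu> k * (\<Prod>v\<leftarrow>vs. \<kappa> k \<bullet> v) * (real (Suc j) * (\<kappa> k \<bullet> y) ^ j * (\<kappa> k \<bullet> w)))) (at 0)"
    by (auto intro!: derivative_eq_intros sum.cong simp del: power_Suc)
  ultimately have "(\<Sum>k\<in>\<Delta>. \<mu> k * (\<Prod>v\<leftarrow>vs. \<kappa> k \<bullet> v) * (real (Suc j) * (\<kappa> k \<bullet> y) ^ j * (\<kappa> k \<bullet> w))) = 0"
    using DERIV_unique by blast
  also have "(\<Sum>k\<in>\<Delta>. \<mu> k * (\<Prod>v\<leftarrow>vs. \<kappa> k \<bullet> v) * (real (Suc j) * (\<kappa> k \<bullet> y) ^ j * (\<kappa> k \<bullet> w)))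
      = real (Suc j) * (\<Sum>k\<in>\<Delta>. \<mu> k * (\<Prod>v\<leftarrow>w # vs. \<kappa> k \<bullet> v) * (\<kappa> k \<bullet> y) ^ j)"
    by (simp add: sum_distrib_left mult_ac del: of_nat_Suc)
  finally show ?case by (simp del: of_nat_Suc)
qed (use assms(1) in auto)

definition annihilates_polynomials :: "nat \<Rightarrow> (int ^ 'n) set \<Rightarrow> (int ^ 'n \<Rightarrow> real) \<Rightarrow> bool" where
  "annihilates_polynomials N \<Delta> \<mu> \<longleftrightarrow>
     (\<forall>is z. length is < N \<longrightarrow> (\<Sum>k\<in>\<Delta>. \<mu> k * mon is (z + vec_of_int k)) = 0)"

lemma annihilates_polynomials_if_power_moments_zero:
  fixes \<Delta> :: "(int ^ 'n) set"
  assumes "\<And>v j. j < N \<Longrightarrow> (\<Sum>k\<in>\<Delta>. \<mu> k * (vec_of_int k \<bullet> v) ^ j) = 0"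
  shows "annihilates_polynomials N \<Delta> \<mu>"
proof -
  have mom: "(\<Sum>k\<in>\<Delta>. \<mu> k * mon is (vec_of_int k)) = 0" if "length is < N" for "is"
    using polarised_moments_zero[of N \<mu> vec_of_int \<Delta> "map (\<lambda>i. axis i 1) is" 0] assms that
    by (simp add: mon_def o_def inner_axis)
  have "(\<Sum>k\<in>\<Delta>. \<mu> k * mon is (z + vec_of_int k) * mon js (vec_of_int k)) = 0"
    if "length is + length js < N" for "is" js z
    using that
  proof (induction "is" arbitrary: js)
    case Nil
    then show ?case using mom[of js] by simp
  next
    case (Cons i "is")
    have "(\<Sum>k\<in>\<Delta>. \<mu> k * mon (i # is) (z + vec_of_int k) * mon js (vec_of_int k))
        = z $ i * (\<Sum>k\<in>\<Delta>. \<mu> k * mon is (z + vec_of_int k) * mon js (vec_of_int k))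
          + (\<Sum>k\<in>\<Delta>. \<mu> k * mon is (z + vec_of_int k) * mon (i # js) (vec_of_int k))"
      by (simp add: sum_distrib_left sum.distrib[symmetric] algebra_simps)
    then show ?case using Cons.IH[of js] Cons.IH[of "i # js"] Cons.prems by simp
  qed
  from this[of _ "[]"] show ?thesis by (simp add: annihilates_polynomials_def)
qed

text \<open>On the ray through \<open>v\<close> homogeneity gives \<open>P(t v) F(v) = t\<^sup>N \<Psi>(t v)\<close>. The limit \<open>1\<close> of \<open>\<Psi>\<close> shows
  \<open>F(v) \<noteq> 0\<close>, and then \<open>P(t v) = O(t\<^sup>N)\<close>.\<close>

lemma annihilates_polynomials_if_product_tends_to_1:
  fixes F \<Psi> :: "real ^ 'n \<Rightarrow> complex"
  assumes F: "is_generalised_fourier (\<lambda>x. complex_of_real (rbf_u m x)) F"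
    and prod: "\<forall>\<^sub>F y in at 0. \<Psi> y = trig_poly \<Delta> \<mu> y * F y"
    and lim: "(\<Psi> \<longlongrightarrow> 1) (at 0)"
  shows "annihilates_polynomials (CARD('n) + m) \<Delta> \<mu>"
proof (rule annihilates_polynomials_if_power_moments_zero)
  let ?N = "CARD('n) + m"
  have nz: "(\<Sum>k\<in>\<Delta>. \<mu> k * (vec_of_int k \<bullet> v) ^ j) = 0" if v: "v \<noteq> 0" and j: "j < ?N" for v :: "real ^ 'n" and j
  proof -
    have "((\<lambda>t. t *\<^sub>R v) \<longlongrightarrow> 0 *\<^sub>R v) (at_right 0)" by (intro tendsto_intros)
    then have ray: "filterlim (\<lambda>t. t *\<^sub>R v) (at 0) (at_right 0)"
      using v by (auto simp: filterlim_at eventually_at_filter)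
    have P: "\<forall>\<^sub>F t in at_right 0. \<Psi> (t *\<^sub>R v) = trig_poly \<Delta> \<mu> (t *\<^sub>R v) * F (t *\<^sub>R v)"
      using ray prod by (rule eventually_compose_filterlim[rotated])
    have L: "((\<lambda>t. \<Psi> (t *\<^sub>R v)) \<longlongrightarrow> 1) (at_right 0)"
      by (rule filterlim_compose[OF lim ray])
    have "\<forall>\<^sub>F t in at_right 0. dist (\<Psi> (t *\<^sub>R v)) 1 < 1" using L by (simp add: tendsto_iff)
    then have near: "\<forall>\<^sub>F t in at_right 0. norm (\<Psi> (t *\<^sub>R v)) \<le> 2 \<and> \<Psi> (t *\<^sub>R v) \<noteq> 0"
    proof eventually_elim
      case (elim t)
      then have "norm (\<Psi> (t *\<^sub>R v) - 1) < 1" by (simp add: dist_norm)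
      moreover have "norm (\<Psi> (t *\<^sub>R v)) \<le> norm (\<Psi> (t *\<^sub>R v) - 1) + norm (1::complex)"
        by (metis add.commute diff_add_cancel norm_triangle_ineq)
      ultimately show ?case by auto
    qed
    have eq: "\<forall>\<^sub>F t in at_right 0. 0 < t \<and> trig_poly \<Delta> \<mu> (t *\<^sub>R v) * F v = of_real (t ^ ?N) * \<Psi> (t *\<^sub>R v)"
      using P eventually_at_right_less[of 0]
    proof eventually_elim
      case (elim t)
      then have "trig_poly \<Delta> \<mu> (t *\<^sub>R v) * F v
          = trig_poly \<Delta> \<mu> (t *\<^sub>R v) * (of_real (t ^ ?N) * F (t *\<^sub>R v))"
        using generalised_fourier_homogeneous[OF F elim(2) v] by simp
      then show ?case using elim by (simp only: mult_ac)
    qed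
    have Fv: "F v \<noteq> 0"
    proof
      assume 0: "F v = 0"
      have "\<forall>\<^sub>F t in at_right (0::real). False"
        using eq near
      proof eventually_elim
        case (elim t)
        then show False using 0 by auto
      qed
      then show False by simp
    qed
    have "\<forall>\<^sub>F t in at_right 0. norm (\<Sum>k\<in>\<Delta>. complex_of_real (\<mu> k) * exp (- \<i> * complex_of_real (t * (vec_of_int k \<bullet> v))))
        \<le> 2 / norm (F v) * t ^ ?N"
      using eq near
    proof eventually_elim
      case (elim t)
      have "norm (trig_poly \<Delta> \<mu> (t *\<^sub>R v)) * norm (F v) = t ^ ?N * norm (\<Psi> (t *\<^sub>R v))"
        using elim by (simp add: norm_mult[symmetric] norm_power) (simp add: norm_mult norm_power)
      also have "\<dots> \<le> t ^ ?N * 2" using elim by (intro mult_left_mono) auto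
      finally have "norm (trig_poly \<Delta> \<mu> (t *\<^sub>R v)) \<le> 2 / norm (F v) * t ^ ?N"
        using Fv by (simp add: field_simps)
      then show ?case by (simp add: trig_poly_def)
    qed
    then show ?thesis by (rule power_moments_zero_if_exp_sum_small) (rule j)
  qed
  fix v :: "real ^ 'n" and j
  assume j: "j < ?N"
  show "(\<Sum>k\<in>\<Delta>. \<mu> k * (vec_of_int k \<bullet> v) ^ j) = 0"
  proof (cases "v = 0")
    case True
    then show ?thesis using nz[of "axis undefined 1" 0] by (cases j) (auto simp: axis_eq_0_iff)
  qed (rule nz[OF _ j])
qed

section \<open>The exponentially decaying part\<close>

lemma power_le_fact_mult_exp:
  fixes x :: real
  assumes "0 \<le> x"
  shows "x ^ M \<le> fact M * exp x"
proof -
  have "(\<Sum>i\<in>{M}. x ^ i /\<^sub>R fact i) \<le> (\<Sum>i. x ^ i /\<^sub>R fact i)"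
    by (rule sum_le_suminf[OF summable_exp_generic]) (use assms in auto)
  then show ?thesis by (simp add: exp_def field_simps)
qed

definition rbf_diff :: "nat \<Rightarrow> real ^ 'n \<Rightarrow> real" where
  "rbf_diff m x = rbf_g m x - rbf_u m x"

text \<open>Since \<open>1 - tanh s = 2 / (exp (2 s) + 1)\<close>, the exponential beats any power of \<open>1 + s\<close>.\<close>

lemma rbf_diff_decay:
  obtains C where "0 \<le> C" "\<And>z :: real ^ 'n. \<bar>rbf_diff m z\<bar> \<le> C / (1 + norm z) ^ K"
proof
  let ?C = "2 * (fact (m + K) * exp 1) :: real"
  show "0 \<le> ?C" by simp
  fix z :: "real ^ 'n"
  let ?s = "norm z"
  have tanh: "1 - tanh ?s = 2 / (exp (2 * ?s) + 1)"
  proof -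
    have "1 - (1 - inverse E) / (1 + inverse E) = 2 / (E + 1)" if "0 < E" for E :: real
      using that by (simp add: divide_simps)
    from this[of "exp (2 * ?s)"] show ?thesis by (simp add: tanh_real_altdef exp_minus)
  qed
  have "?s ^ m * (1 + ?s) ^ K \<le> (1 + ?s) ^ (m + K)"
    unfolding power_add by (intro mult_right_mono power_mono) auto
  also have "\<dots> \<le> fact (m + K) * exp (1 + ?s)" by (rule power_le_fact_mult_exp) simp
  also have "\<dots> \<le> fact (m + K) * exp 1 * (exp (2 * ?s) + 1)"
  proof -
    have "exp ?s \<le> exp (2 * ?s) + 1" by (smt (verit) exp_le_cancel_iff norm_ge_zero)
    then show ?thesis by (simp add: exp_add)
  qed
  finally have "?s ^ m * (1 + ?s) ^ K \<le> fact (m + K) * exp 1 * (exp (2 * ?s) + 1)" .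
  moreover have "\<bar>rbf_diff m z\<bar> = ?s ^ m * (1 - tanh ?s)"
  proof -
    have "rbf_diff m z = - (?s ^ m * (1 - tanh ?s))" by (simp add: rbf_diff_def rbf_g_def rbf_u_def algebra_simps)
    moreover have "0 \<le> 1 - tanh ?s" by (simp add: tanh add_nonneg_nonneg)
    ultimately show ?thesis by (simp add: abs_mult)
  qed
  moreover have "0 < exp (2 * ?s) + 1" by (simp add: add_pos_pos)
  ultimately have "\<bar>rbf_diff m z\<bar> * (1 + ?s) ^ K * (exp (2 * ?s) + 1) \<le> ?C * (exp (2 * ?s) + 1)"
    by (simp add: tanh)
  with \<open>0 < exp (2 * ?s) + 1\<close> have "\<bar>rbf_diff m z\<bar> * (1 + ?s) ^ K \<le> ?C"
    by (simp only: mult_le_cancel_right_pos)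
  moreover have "0 < (1 + ?s) ^ K" by (simp add: add_pos_nonneg)
  ultimately show "\<bar>rbf_diff m z\<bar> \<le> ?C / (1 + ?s) ^ K"
    by (simp add: pos_le_divide_eq)
qed

lemma has_sum_finite_sum:
  fixes f :: "'k \<Rightarrow> 'a \<Rightarrow> 'b::topological_comm_monoid_add"
  assumes "finite K" "\<And>k. k \<in> K \<Longrightarrow> (f k has_sum s k) A"
  shows "((\<lambda>x. \<Sum>k\<in>K. f k x) has_sum (\<Sum>k\<in>K. s k)) A"
  using assms by (induction K rule: finite_induct) (auto intro: has_sum_add)

lemma vec_of_int_add: "vec_of_int (j + k) = vec_of_int j + vec_of_int k"
  by (simp add: vec_of_int_def vec_eq_iff)

text \<open>Substituting \<open>l = j + k\<close> in each of the finitely many series moves the lattice shift from \<open>w\<close>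
  to the monomial. For every fixed \<open>l\<close> the coefficients then act on a polynomial in \<open>k\<close>
  and give zero.\<close>

lemma has_sum_shift_comb_zero:
  fixes w :: "real ^ 'n \<Rightarrow> real"
  assumes ann: "annihilates_polynomials N \<Delta> \<mu>" and len: "length is < N"
    and w: "\<And>z. \<bar>w z\<bar> \<le> C / (1 + norm z) ^ (length is + CARD('n) + 1)" and C: "0 \<le> C"
    and fin: "finite \<Delta>"
  shows "((\<lambda>j. mon is (y - vec_of_int j) * shift_comb \<Delta> \<mu> w (y - vec_of_int j)) has_sum 0) UNIV"
proof -
  let ?L = "length is"
  define f where "f k l = mon is (y - vec_of_int l + vec_of_int k) * w (y - vec_of_int l)" for k l
  define s where "s k = infsum (f k) UNIV" for k
  have f: "(f k has_sum s k) UNIV" for k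
  proof -
    let ?c = "norm (vec_of_int k)"
    have "norm (mon is (z + vec_of_int k) * w z) \<le> (1 + ?c) ^ ?L * C / (1 + norm z) ^ (CARD('n) + 1)" for z
    proof -
      have "norm (z + vec_of_int k) \<le> norm z + ?c" by (rule norm_triangle_ineq)
      also have "\<dots> \<le> (1 + ?c) * (1 + norm z)" by (simp add: algebra_simps)
      finally have "\<bar>mon is (z + vec_of_int k)\<bar> \<le> ((1 + ?c) * (1 + norm z)) ^ ?L"
        using abs_mon_le[of "is" "z + vec_of_int k"] power_mono norm_ge_zero by (meson order_trans)
      then have "norm (mon is (z + vec_of_int k) * w z) \<le>
          ((1 + ?c) * (1 + norm z)) ^ ?L * (C / (1 + norm z) ^ (?L + CARD('n) + 1))"
        unfolding real_norm_def abs_mult by (intro mult_mono w) (auto intro: order_trans[OF abs_ge_zero])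
      moreover have "1 + norm z \<noteq> 0" by (smt (verit) norm_ge_zero)
      moreover have "(c * a) ^ ?L * (C / a ^ (?L + CARD('n) + 1)) = c ^ ?L * C / a ^ (CARD('n) + 1)"
        if "a \<noteq> 0" for a c :: real
        using that by (simp add: power_mult_distrib power_add)
      ultimately show ?thesis by simp
    qed
    from lattice_abs_summable[of "\<lambda>z. mon is (z + vec_of_int k) * w z", OF this]
    have "f k summable_on UNIV" unfolding f_def by (rule abs_summable_summable)
    then show ?thesis unfolding s_def by (rule has_sum_infsum)
  qed
  have "((\<lambda>l. \<Sum>k\<in>\<Delta>. \<mu> k * f k l) has_sum (\<Sum>k\<in>\<Delta>. \<mu> k * s k)) UNIV"
    by (intro has_sum_finite_sum has_sum_cmult_right f fin)
  moreover have "(\<Sum>k\<in>\<Delta>. \<mu> k * f k l) = 0" for l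
  proof -
    have "(\<Sum>k\<in>\<Delta>. \<mu> k * f k l) = (\<Sum>k\<in>\<Delta>. \<mu> k * mon is (y - vec_of_int l + vec_of_int k)) * w (y - vec_of_int l)"
      by (simp add: f_def sum_distrib_left mult_ac)
    then show ?thesis using ann len by (simp add: annihilates_polynomials_def)
  qed
  ultimately have 0: "(\<Sum>k\<in>\<Delta>. \<mu> k * s k) = 0"
    by (auto intro: has_sum_unique)
  have "((\<lambda>j. f k (j + k)) has_sum s k) UNIV" for k
    using f[of k] by (subst has_sum_reindex_bij_betw[OF bij_plus_right[of k]]) auto
  then have "((\<lambda>j. \<Sum>k\<in>\<Delta>. \<mu> k * f k (j + k)) has_sum (\<Sum>k\<in>\<Delta>. \<mu> k * s k)) UNIV"
    by (intro has_sum_finite_sum has_sum_cmult_right fin)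
  then show ?thesis unfolding 0
    by (simp add: f_def shift_comb_def sum_distrib_left vec_of_int_add algebra_simps)
qed

section \<open>Periodisation\<close>

text \<open>Peetre's inequality, in the form that transports decay estimates under translations.\<close>

lemma one_plus_norm_le:
  fixes x y :: "'a::real_normed_vector"
  shows "1 + norm x \<le> (1 + norm y) * (1 + norm (x - y))"
proof -
  have "norm x \<le> norm y + norm (x - y)" by (metis add.commute diff_add_cancel norm_triangle_ineq)
  moreover have "0 \<le> norm y * norm (x - y)" by simp
  moreover have "(1 + norm y) * (1 + norm (x - y)) = 1 + norm y + norm (x - y) + norm y * norm (x - y)"
    by (simp add: algebra_simps)
  ultimately show ?thesis by linarith
qed

lemma decay_translate:
  fixes H :: "'a::real_normed_vector \<Rightarrow> 'b::real_normed_vector"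
  assumes "\<And>x. norm (H x) \<le> B / (1 + norm x) ^ K" "0 \<le> B" "norm y \<le> R"
  shows "norm (H (y - x)) \<le> B * (1 + R) ^ K / (1 + norm x) ^ K"
proof -
  have p: "0 < 1 + norm x" "0 < 1 + norm (y - x)" by (simp_all add: add_pos_nonneg)
  have "(1 + norm x) ^ K \<le> ((1 + norm y) * (1 + norm (y - x))) ^ K"
    using one_plus_norm_le[of x y] p by (intro power_mono) (auto simp: norm_minus_commute)
  also have "\<dots> \<le> ((1 + R) * (1 + norm (y - x))) ^ K"
    using assms(3) p norm_ge_zero[of y] by (intro power_mono mult_right_mono mult_nonneg_nonneg) auto
  finally have le: "(1 + norm x) ^ K \<le> (1 + R) ^ K * (1 + norm (y - x)) ^ K" by (simp add: power_mult_distrib)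
  have "norm (H (y - x)) \<le> B / (1 + norm (y - x)) ^ K" by (rule assms)
  also have "\<dots> = B * (1 / (1 + norm (y - x)) ^ K)" by simp
  also have "\<dots> \<le> B * ((1 + R) ^ K / (1 + norm x) ^ K)"
    using le p by (intro mult_left_mono assms(2)) (simp add: divide_simps mult_ac)
  finally show ?thesis by simp
qed

definition periodisation :: "(real ^ 'n \<Rightarrow> 'b::{t2_space, comm_monoid_add}) \<Rightarrow> real ^ 'n \<Rightarrow> 'b" where
  "periodisation H x = (\<Sum>\<^sub>\<infinity>j. H (x - vec_of_int j))"

text \<open>Half-open, so that its lattice translates partition the space.\<close>

definition unit_cell :: "(real ^ 'n) set" where
  "unit_cell = {x. \<forall>i. 0 \<le> x $ i \<and> x $ i < 1}"

lemma norm_unit_cell: "x \<in> unit_cell \<Longrightarrow> norm (x :: real ^ 'n) \<le> real CARD('n)"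
proof -
  assume "x \<in> unit_cell"
  then have "(\<Sum>i\<in>UNIV. \<bar>x $ i\<bar>) \<le> (\<Sum>i\<in>(UNIV::'n set). 1)"
    by (intro sum_mono) (auto simp: unit_cell_def abs_le_iff intro: order_trans[of _ 0] less_imp_le)
  then show ?thesis using norm_le_l1_cart[of x] by simp
qed

lemma unit_cell_measurable [measurable]: "(unit_cell :: (real ^ 'n) set) \<in> sets borel"
  unfolding unit_cell_def by measurable

lemma emeasure_unit_cell_finite: "emeasure lborel (unit_cell :: (real ^ 'n) set) < \<infinity>"
  by (rule emeasure_bounded_finite) (auto simp: bounded_iff intro: norm_unit_cell)

lemma unit_cell_box: "box 0 1 \<subseteq> (unit_cell :: (real ^ 'n) set)" "unit_cell \<subseteq> (cbox 0 1 :: (real ^ 'n) set)"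
  by (auto simp: unit_cell_def mem_box_cart less_imp_le)

lemma content_unit_cube: "measure lborel (cbox 0 1 :: (real ^ 'n) set) = 1"
proof -
  have "(0 :: real ^ 'n) \<in> cbox 0 1" by (simp add: mem_box_cart)
  then show ?thesis using content_cbox_cart[of "0 :: real ^ 'n" 1] by auto
qed

lemma measure_unit_cell: "measure lborel (unit_cell :: (real ^ 'n) set) = 1"
proof (rule antisym)
  have "measure lborel (unit_cell :: (real ^ 'n) set) \<le> measure lborel (cbox 0 1 :: (real ^ 'n) set)"
    by (intro measure_mono_fmeasurable unit_cell_box) auto
  also have "\<dots> = 1" by (rule content_unit_cube)
  finally show "measure lborel (unit_cell :: (real ^ 'n) set) \<le> 1" .
  have "1 = measure lborel (cbox 0 1 :: (real ^ 'n) set)"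
    by (rule content_unit_cube[symmetric])
  also have "\<dots> = measure lborel (box 0 1 :: (real ^ 'n) set)" by (simp add: measure_lborel_box_eq measure_lborel_cbox_eq)
  also have "\<dots> \<le> measure lborel (unit_cell :: (real ^ 'n) set)"
    by (intro measure_mono_fmeasurable unit_cell_box fmeasurableI emeasure_unit_cell_finite) auto
  finally show "1 \<le> measure lborel (unit_cell :: (real ^ 'n) set)" .
qed

lemma translate_unit_cell_iff:
  "x + vec_of_int k \<in> unit_cell \<longleftrightarrow> k = (\<chi> i. - \<lfloor>x $ i\<rfloor>)"
proof -
  have "(0 \<le> a + real_of_int b \<and> a + real_of_int b < 1) \<longleftrightarrow> b = - \<lfloor>a\<rfloor>" for a b by linarith
  then show ?thesis by (simp add: unit_cell_def vec_of_int_def vec_eq_iff)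
qed

lemma lattice_enumeration:
  obtains e :: "nat \<Rightarrow> int ^ 'n" where "bij e"
proof -
  have "inj (\<lambda>k. (\<chi> i. k) :: int ^ 'n)" by (auto intro!: injI simp: vec_eq_iff)
  then have "infinite (UNIV :: (int ^ 'n) set)" using infinite_UNIV_int infinite_super range_inj_infinite
    by (metis finite_imageD finite_subset subset_UNIV)
  then show ?thesis using that bij_betw_from_nat_into[of "UNIV :: (int ^ 'n) set"] by blast
qed

context
  fixes H :: "real ^ 'n \<Rightarrow> 'b::{banach, second_countable_topology}" and B :: real
  assumes decay: "\<And>x. norm (H x) \<le> B / (1 + norm x) ^ (CARD('n) + 1)" and B: "0 \<le> B"
begin

lemma decay_weight_summable:
  assumes "bij e"
  shows "summable (\<lambda>i. B * (1 + R) ^ (CARD('n) + 1) / (1 + norm (vec_of_int (e i) :: real ^ 'n)) ^ (CARD('n) + 1))"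
proof -
  have "(\<lambda>j::int ^ 'n. 1 / (1 + norm (0 - vec_of_int j :: real ^ 'n)) ^ (CARD('n) + 1)) summable_on UNIV"
    by (rule lattice_weight_summable)
  then have "(\<lambda>i. 1 / (1 + norm (vec_of_int (e i) :: real ^ 'n)) ^ (CARD('n) + 1)) summable_on UNIV"
    using summable_on_reindex_bij_betw[OF assms, of "\<lambda>j. 1 / (1 + norm (0 - vec_of_int j :: real ^ 'n)) ^ (CARD('n) + 1)"]
    by simp
  from summable_mult[OF summable_on_imp_summable[OF this], of "B * (1 + R) ^ (CARD('n) + 1)"]
  show ?thesis by simp
qed

lemma periodisation_summable: "(\<lambda>j. H (x - vec_of_int j)) summable_on UNIV"
  by (rule abs_summable_summable, rule lattice_abs_summable, rule decay)

lemma periodisation_sums: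
  assumes "bij e"
  shows "(\<lambda>i. H (x - vec_of_int (e i))) sums periodisation H x"
proof -
  have "((\<lambda>j. H (x - vec_of_int j)) has_sum periodisation H x) UNIV"
    unfolding periodisation_def by (rule has_sum_infsum[OF periodisation_summable])
  then have "((\<lambda>i. H (x - vec_of_int (e i))) has_sum periodisation H x) UNIV"
    by (subst has_sum_reindex_bij_betw[OF assms])
  then show ?thesis by (rule has_sum_imp_sums)
qed

lemma continuous_on_periodisation:
  assumes "continuous_on UNIV H"
  shows "continuous_on (cball 0 R) (periodisation H)"
proof -
  obtain e :: "nat \<Rightarrow> int ^ 'n" where e: "bij e" by (rule lattice_enumeration)
  have "uniform_limit (cball 0 R) (\<lambda>n x. \<Sum>i<n. H (x - vec_of_int (e i)))
      (\<lambda>x. \<Sum>i. H (x - vec_of_int (e i))) sequentially"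
    by (rule Weierstrass_m_test[OF _ decay_weight_summable[OF e, of R]])
      (rule decay_translate[OF decay B], simp)
  then have "continuous_on (cball 0 R) (\<lambda>x. \<Sum>i. H (x - vec_of_int (e i)))"
    by (rule uniform_limit_theorem[rotated])
      (auto intro!: always_eventually continuous_intros continuous_on_compose2[OF assms])
  then show ?thesis using sums_unique[OF periodisation_sums[OF e]] by (simp add: fun_eq_iff)
qed

text \<open>Cutting the space into lattice translates of the cell and moving each piece back to the cell
  turns the integral into a series of integrals over the cell. The decay makes the pieces summable
  uniformly on the cell, which gives integrability and permits summation under the integral.\<close>

lemma
  assumes H [measurable]: "H \<in> borel_measurable borel"
  shows integrable_if_decay: "integrable lborel H"
    and integral_eq_periodisation:
      "integral\<^sup>L lborel H = (LINT x|lborel. indicator unit_cell x *\<^sub>R periodisation H x)"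
proof -
  obtain e :: "nat \<Rightarrow> int ^ 'n" where e: "bij e" by (rule lattice_enumeration)
  let ?v = "\<lambda>i. vec_of_int (e i) :: real ^ 'n"
  define f where "f i x = indicator unit_cell x *\<^sub>R H (x - ?v i)" for i x
  define g where "g i x = indicator unit_cell (x + ?v i) *\<^sub>R H x" for i x
  define \<beta> where "\<beta> i = B * (1 + real CARD('n)) ^ (CARD('n) + 1) / (1 + norm (?v i)) ^ (CARD('n) + 1)" for i
  have \<beta>: "summable \<beta>" unfolding \<beta>_def by (rule decay_weight_summable[OF e])
  have gf: "g i (x - ?v i) = f i x" for i x by (simp add: g_def f_def)
  have gf': "g i x = f i (x + ?v i)" for i x by (simp add: g_def f_def)
  have fb: "norm (f i x) \<le> indicator unit_cell x * \<beta> i" for i x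
    using decay_translate[OF decay B norm_unit_cell] by (simp add: f_def \<beta>_def indicator_def)
  have [measurable]: "f i \<in> borel_measurable borel" "g i \<in> borel_measurable borel" for i
    unfolding f_def g_def by measurable
  have ind: "integrable lborel (\<lambda>x::real ^ 'n. indicator unit_cell x * \<beta> i)" for i
    using emeasure_unit_cell_finite by (intro integrable_mult_left integrable_real_indicator) auto
  have intf: "integrable lborel (f i)" for i
    by (rule Bochner_Integration.integrable_bound[OF ind[of i]]) (auto intro!: always_eventually order_trans[OF fb abs_ge_self])
  have transi: "integrable lborel (\<lambda>x. p (x + t))"
    if "integrable lborel p" "p \<in> borel_measurable borel" for p :: "real ^ 'n \<Rightarrow> 'b" and t
    using that by (subst (asm) lborel_distr_plus[of t, symmetric], subst (asm) integrable_distr_eq) (auto simp: add.commute)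
  have intg: "integrable lborel (g i)" for i
    using transi[OF intf, of i "?v i"] by (simp add: gf'[abs_def])
  have int_eq: "integral\<^sup>L lborel (g i) = integral\<^sup>L lborel (f i)" for i
    using lborel_integral_translate[of "f i" "?v i"] by (simp add: gf'[abs_def])
  have int_norm_eq: "(LINT x|lborel. norm (g i x)) = (LINT x|lborel. norm (f i x))" for i
    using lborel_integral_translate[of "\<lambda>x. norm (f i x)" "?v i"] by (simp add: gf'[abs_def])
  have int_norm: "(LINT x|lborel. norm (f i x)) \<le> \<beta> i" for i
  proof -
    have "(LINT x|lborel. norm (f i x)) \<le> (LINT x|lborel. indicator unit_cell (x::real^'n) * \<beta> i)"
      by (intro integral_mono fb integrable_norm intf ind)
    then show ?thesis by (simp add: measure_unit_cell)
  qed
  have sum_norm_f: "summable (\<lambda>i. LINT x|lborel. norm (f i x))"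
    by (rule summable_comparison_test'[OF \<beta>, of 0]) (use int_norm in auto)
  have sum_norm_g: "summable (\<lambda>i. LINT x|lborel. norm (g i x))"
    unfolding int_norm_eq by (rule sum_norm_f)
  have fsum: "summable (\<lambda>i. norm (f i x))" for x
    by (rule summable_comparison_test'[OF \<beta>, of 0])
      (use order_trans[OF fb[of _ x]] in \<open>auto simp: indicator_def \<beta>_def B split: if_splits\<close>)
  have gsingle: "\<exists>i0. \<forall>i. i \<noteq> i0 \<longrightarrow> g i x = 0" "(\<lambda>i. g i x) sums H x" for x
  proof -
    obtain i0 where i0: "e i0 = (\<chi> i. - \<lfloor>x $ i\<rfloor>)" using e by (metis bij_pointE)
    have z: "g i x = 0" if "i \<noteq> i0" for i
    proof -
      have "e i \<noteq> e i0" using that e by (auto dest: bij_is_inj injD)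
      then show ?thesis using i0 by (simp add: g_def translate_unit_cell_iff)
    qed
    then show "\<exists>i0. \<forall>i. i \<noteq> i0 \<longrightarrow> g i x = 0" by blast
    have "g i0 x = H x" using i0 translate_unit_cell_iff[of x "e i0"] by (simp add: g_def)
    moreover have "(\<lambda>i. g i x) sums (\<Sum>i\<in>{i0}. g i x)" by (rule sums_finite) (use z in auto)
    ultimately show "(\<lambda>i. g i x) sums H x" by simp
  qed
  have gsum: "summable (\<lambda>i. norm (g i x))" for x
  proof -
    obtain i0 where "\<forall>i. i \<noteq> i0 \<longrightarrow> g i x = 0" using gsingle(1)[of x] by blast
    then show ?thesis by (intro summable_finite[of "{i0}"]) auto
  qed
  have H_eq: "(\<Sum>i. g i x) = H x" for x using sums_unique[OF gsingle(2)] by simp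
  show "integrable lborel H"
    using integrable_suminf[OF intg _ sum_norm_g] gsum by (simp add: H_eq)
  have "integral\<^sup>L lborel H = (\<Sum>i. integral\<^sup>L lborel (g i))"
    using integral_suminf[OF intg _ sum_norm_g] gsum by (simp add: H_eq)
  also have "\<dots> = (\<Sum>i. integral\<^sup>L lborel (f i))" by (simp add: int_eq)
  also have "\<dots> = (LINT x|lborel. (\<Sum>i. f i x))"
    using integral_suminf[OF intf _ sum_norm_f] fsum by simp
  also have "(\<lambda>x. \<Sum>i. f i x) = (\<lambda>x. indicator unit_cell x *\<^sub>R periodisation H x)"
    using periodisation_sums[OF e] by (auto simp: f_def fun_eq_iff indicator_def sums_iff)
  finally show "integral\<^sup>L lborel H = (LINT x|lborel. indicator unit_cell x *\<^sub>R periodisation H x)" .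
qed

end

lemma periodisation_periodic: "periodisation H (x + vec_of_int k) = periodisation H x"
proof -
  have "bij (\<lambda>j. j + k)" by (rule bij_plus_right)
  from infsum_reindex_bij_betw[OF this, of "\<lambda>j. H (x + vec_of_int k - vec_of_int j)"]
  show ?thesis unfolding periodisation_def by (simp add: vec_of_int_add algebra_simps)
qed

section \<open>Trigonometric approximation on the torus\<close>

definition character :: "int ^ 'n \<Rightarrow> real ^ 'n \<Rightarrow> complex" where
  "character k x = exp (- \<i> * complex_of_real ((2 * pi) * (vec_of_int k \<bullet> x)))"

lemma norm_character [simp]: "norm (character k x) = 1"
  by (simp add: character_def)

lemma character_add: "character (j + k) x = character j x * character k x"
  by (simp add: character_def vec_of_int_add inner_add_left algebra_simps exp_add[symmetric])

lemma character_translate: "character k (x + y) = character k x * character k y"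
  by (simp add: character_def inner_add_right algebra_simps exp_add[symmetric])

lemma character_minus_int: "character k (x - vec_of_int j) = character k x"
proof -
  have "vec_of_int k \<bullet> (vec_of_int j :: real ^ 'a) = real_of_int (\<Sum>i\<in>UNIV. k $ i * j $ i)"
    by (simp add: inner_vec_def vec_of_int_def)
  then have "character k (- vec_of_int j) = exp (complex_of_real (2 * of_int (\<Sum>i\<in>UNIV. k $ i * j $ i) * pi) * \<i>)"
    unfolding character_def inner_minus_right by (simp only: of_real_minus of_real_mult) (simp add: mult_ac)
  also have "\<dots> = 1" by (rule exp_integer_2pi) (rule Ints_of_int)
  finally show ?thesis using character_translate[of k x "- vec_of_int j"] by simp
qed

lemma continuous_character: "continuous_on S (character k)"
  unfolding character_def by (intro continuous_intros)

text \<open>Trigonometric polynomials with complex coefficients and period one in each coordinate.\<close>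

inductive_set trig_span :: "(real ^ 'n \<Rightarrow> complex) set" where
  character: "(\<lambda>x. c * character k x) \<in> trig_span"
| add: "f \<in> trig_span \<Longrightarrow> g \<in> trig_span \<Longrightarrow> (\<lambda>x. f x + g x) \<in> trig_span"

lemma trig_span_const: "(\<lambda>x. c) \<in> trig_span"
  using trig_span.character[of c 0] by (simp add: character_def vec_of_int_def inner_vec_def)

lemma trig_span_mult:
  assumes "f \<in> trig_span" "g \<in> trig_span"
  shows "(\<lambda>x. f x * g x) \<in> trig_span"
  using assms
proof induction
  case (character c k)
  from character show ?case
  proof induction
    case (character d l)
    have "(\<lambda>x. (c * d) * character (k + l) x) \<in> trig_span" by (rule trig_span.character)
    then show ?case by (simp add: character_add mult_ac)
  next
    case (add f g)
    from trig_span.add[OF add.IH] show ?case by (simp add: algebra_simps)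
  qed
next
  case (add f' g')
  from trig_span.add[OF add.IH(1)[OF add.prems] add.IH(2)[OF add.prems]] show ?case
    by (simp add: algebra_simps)
qed

lemma trig_span_sum:
  assumes "finite A" "\<And>a. a \<in> A \<Longrightarrow> f a \<in> trig_span"
  shows "(\<lambda>x. \<Sum>a\<in>A. f a x) \<in> trig_span"
  using assms by (induction A rule: finite_induct) (auto intro: trig_span.add trig_span_const)

lemma trig_span_periodic: "f \<in> trig_span \<Longrightarrow> f (x - vec_of_int j) = f x"
  by (induction rule: trig_span.induct) (auto simp: character_minus_int)

lemma trig_span_bounded: "f \<in> trig_span \<Longrightarrow> \<exists>M\<ge>0. \<forall>x. norm (f x) \<le> M"
proof (induction rule: trig_span.induct)
  case (character c k)
  then show ?case by (intro exI[of _ "norm c"]) (simp add: norm_mult)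
next
  case (add f g)
  then obtain M M' where "0 \<le> M" "\<forall>x. norm (f x) \<le> M" "0 \<le> M'" "\<forall>x. norm (g x) \<le> M'" by blast
  then show ?case by (intro exI[of _ "M + M'"]) (auto intro: order_trans[OF norm_triangle_ineq] add_mono)
qed

text \<open>The embedding of the torus into Euclidean space. Polynomials in its components are trigonometric
  polynomials, so the Stone-Weierstrass theorem for ordinary polynomials applies on the compact image.\<close>

definition torus :: "real ^ 'n \<Rightarrow> (real ^ 'n) \<times> (real ^ 'n)" where
  "torus x = ((\<chi> i. cos (2 * pi * x $ i)), (\<chi> i. sin (2 * pi * x $ i)))"

lemma trig_span_cos_sin:
  shows "(\<lambda>x. complex_of_real (cos (2 * pi * x $ i))) \<in> trig_span"
    and "(\<lambda>x. complex_of_real (sin (2 * pi * x $ i))) \<in> trig_span"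
proof -
  have a: "vec_of_int (axis i s) \<bullet> x = real_of_int s * x $ i" for s :: int and x :: "real ^ 'a"
  proof -
    have "vec_of_int (axis i s) = (axis i (real_of_int s) :: real ^ 'a)"
      by (auto simp: vec_of_int_def axis_def vec_eq_iff)
    then show ?thesis by (simp add: inner_axis' )
  qed
  have 1: "character (axis i 1) x = exp (- (\<i> * complex_of_real (2 * pi * x $ i)))" for x
    by (simp add: character_def a mult_ac)
  have 2: "character (axis i (-1)) x = exp (\<i> * complex_of_real (2 * pi * x $ i))" for x
    by (simp add: character_def a mult_ac)
  have "(\<lambda>x. 1 / 2 * character (axis i (-1)) x + 1 / 2 * character (axis i 1) x) \<in> trig_span"
    by (intro trig_span.intros)
  then show "(\<lambda>x. complex_of_real (cos (2 * pi * x $ i))) \<in> trig_span"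
    unfolding 1 2 cos_of_real[symmetric] cos_exp_eq by (simp add: add_divide_distrib)
  have "(\<lambda>x. 1 / (2 * \<i>) * character (axis i (-1)) x + (- 1 / (2 * \<i>)) * character (axis i 1) x) \<in> trig_span"
    by (intro trig_span.intros)
  moreover have eq: "1 / (2 * \<i>) * a + (- 1 / (2 * \<i>)) * b = (a - b) / (2 * \<i>)" for a b
    by (simp add: algebra_simps add_divide_distrib diff_divide_distrib)
  ultimately show "(\<lambda>x. complex_of_real (sin (2 * pi * x $ i))) \<in> trig_span"
    unfolding 1 2 sin_of_real[symmetric] sin_exp_eq eq by simp
qed

lemma trig_span_polynomial_torus:
  fixes g :: "(real ^ 'n) \<times> (real ^ 'n) \<Rightarrow> real"
  assumes "real_polynomial_function g"
  shows "(\<lambda>x. complex_of_real (g (torus x))) \<in> trig_span"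
  using assms
proof induction
  case (linear g)
  interpret bounded_linear g by (rule linear)
  have g: "g (u, v) = (\<Sum>i\<in>UNIV. u $ i * g (axis i 1, 0)) + (\<Sum>i\<in>UNIV. v $ i * g (0, axis i 1))" for u v
  proof -
    have e: "(\<Sum>i\<in>UNIV. (w $ i) *\<^sub>R axis i 1) = w" for w :: "real ^ 'n"
      using basis_expansion[of w] by (simp add: scalar_mult_eq_scaleR)
    have "(u, v) = (\<Sum>i\<in>UNIV. (u $ i) *\<^sub>R (axis i 1, 0)) + (\<Sum>i\<in>UNIV. (v $ i) *\<^sub>R (0, axis i 1))"
      by (rule prod_eqI) (simp_all add: fst_sum snd_sum e)
    then have "g (u, v) = g (\<dots>)" by simp
    also have "\<dots> = (\<Sum>i\<in>UNIV. u $ i * g (axis i 1, 0)) + (\<Sum>i\<in>UNIV. v $ i * g (0, axis i 1))"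
      by (simp only: add sum scaleR real_scaleR_def)
    finally show ?thesis .
  qed
  have "(\<lambda>x. complex_of_real (g (torus x))) = (\<lambda>x.
      (\<Sum>i\<in>UNIV. complex_of_real (cos (2 * pi * x $ i)) * complex_of_real (g (axis i 1, 0)))
      + (\<Sum>i\<in>UNIV. complex_of_real (sin (2 * pi * x $ i)) * complex_of_real (g (0, axis i 1))))"
    unfolding torus_def by (subst g) simp
  also have "\<dots> \<in> trig_span"
    by (intro trig_span.add trig_span_sum trig_span_mult trig_span_cos_sin trig_span_const finite)
  finally show ?case .
qed (auto intro: trig_span_const trig_span.add trig_span_mult)

lemma torus_eqD:
  assumes "torus x = torus y"
  obtains k where "y = x + vec_of_int k"
proof -
  have "\<exists>k::int. y $ i = x $ i + of_int k" for i
  proof -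
    have "sin (2 * pi * y $ i) = sin (2 * pi * x $ i) \<and> cos (2 * pi * y $ i) = cos (2 * pi * x $ i)"
      using assms by (auto simp: torus_def vec_eq_iff)
    then obtain k :: int where "2 * pi * y $ i = 2 * pi * x $ i + 2 * pi * of_int k"
      unfolding sin_cos_eq_iff by auto
    then have "2 * pi * (y $ i) = 2 * pi * (x $ i + of_int k)" by (simp add: algebra_simps)
    then show ?thesis by auto
  qed
  then obtain k where "\<And>i. y $ i = x $ i + of_int (k i)" by metis
  then show ?thesis by (intro that[of "\<chi> i. k i"]) (simp add: vec_eq_iff vec_of_int_def)
qed

text \<open>Periodicity makes \<open>\<Phi>\<close> a function of the point on the torus, and this function is continuous
  because the torus map sends compact sets to compact sets.\<close>

lemma trig_approximation:
  fixes \<Phi> :: "real ^ 'n \<Rightarrow> real"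
  assumes cont: "continuous_on (cbox 0 1) \<Phi>" and per: "\<And>x k. \<Phi> (x + vec_of_int k) = \<Phi> x" and e: "0 < e"
  obtains T where "(\<lambda>x. complex_of_real (T x)) \<in> trig_span" "\<And>x. x \<in> cbox 0 1 \<Longrightarrow> \<bar>\<Phi> x - T x\<bar> < e"
proof -
  let ?Q = "cbox 0 1 :: (real ^ 'n) set"
  let ?K = "torus ` ?Q"
  have tc: "continuous_on S torus" for S :: "(real ^ 'n) set"
    unfolding torus_def by (intro continuous_intros)
  have K: "compact ?K" by (intro compact_continuous_image tc) simp
  define F where "F z = \<Phi> (SOME x. x \<in> ?Q \<and> torus x = z)" for z
  have F: "F (torus x) = \<Phi> x" if "x \<in> ?Q" for x
  proof -
    let ?y = "SOME y. y \<in> ?Q \<and> torus y = torus x"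
    have "?y \<in> ?Q \<and> torus ?y = torus x" by (rule someI[of _ x]) (use that in simp)
    then obtain k where "x = ?y + vec_of_int k" using torus_eqD[of ?y x] by metis
    then show ?thesis unfolding F_def using per by metis
  qed
  have "continuous_on ?K F"
    unfolding continuous_on_closed_vimage[OF compact_imp_closed[OF K]]
  proof (intro allI impI)
    fix B :: "real set" assume B: "closed B"
    have "F -` B \<inter> ?K = torus ` (?Q \<inter> \<Phi> -` B)" using F by auto
    moreover have "compact (?Q \<inter> \<Phi> -` B)"
      using continuous_closed_preimage[OF cont closed_cbox B]
      by (simp add: compact_eq_bounded_closed bounded_Int)
    ultimately show "closed (F -` B \<inter> ?K)"
      by (simp add: compact_continuous_image[OF tc] compact_imp_closed)
  qed
  from Stone_Weierstrass_real_polynomial_function[OF K this e]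
  obtain g where g: "real_polynomial_function g" "\<And>z. z \<in> ?K \<Longrightarrow> \<bar>F z - g z\<bar> < e" by blast
  show ?thesis
  proof (rule that)
    show "(\<lambda>x. complex_of_real (g (torus x))) \<in> trig_span" by (rule trig_span_polynomial_torus[OF g(1)])
    show "\<bar>\<Phi> x - g (torus x)\<bar> < e" if "x \<in> ?Q" for x using g(2)[of "torus x"] F[OF that] that by simp
  qed
qed

section \<open>Fourier coefficients of a periodisation\<close>

lemma integrable_decay_times_trig:
  fixes G :: "real ^ 'n \<Rightarrow> real"
  assumes decay: "\<And>x. \<bar>G x\<bar> \<le> B / (1 + norm x) ^ (CARD('n) + 1)" and B: "0 \<le> B"
    and [measurable]: "G \<in> borel_measurable borel"
    and z: "\<And>k. (LINT x|lborel. complex_of_real (G x) * character k x) = 0"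
    and f: "f \<in> trig_span"
  shows "integrable lborel (\<lambda>x. complex_of_real (G x) * f x)
    \<and> (LINT x|lborel. complex_of_real (G x) * f x) = 0"
  using f
proof induction
  case (character c k)
  have [measurable]: "character k \<in> borel_measurable borel"
    using continuous_character by (rule borel_measurable_continuous_onI)
  have "integrable lborel (\<lambda>x. complex_of_real (G x) * character k x)"
    by (rule integrable_if_decay[OF _ B]) (use decay in \<open>auto simp: norm_mult\<close>)
  from integrable_mult_right[OF this, of c] show ?case
    using z[of k] by (simp add: mult.left_commute)
next
  case (add f g)
  then show ?case by (simp add: distrib_left)
qed

text \<open>The vanishing Fourier coefficients make the periodisation \<open>\<Phi>\<close> orthogonal, on the cell, to every
  trigonometric polynomial. Approximating \<open>\<Phi>\<close> itself by such polynomials shows that the integral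
  of \<open>\<Phi>\<^sup>2\<close> is zero.\<close>

lemma periodisation_zero:
  fixes G :: "real ^ 'n \<Rightarrow> real"
  assumes decay: "\<And>x. \<bar>G x\<bar> \<le> B / (1 + norm x) ^ (CARD('n) + 1)" and B: "0 \<le> B"
    and cont: "continuous_on UNIV G"
    and z: "\<And>k. (LINT x|lborel. complex_of_real (G x) * character k x) = 0"
  shows "periodisation G x = 0"
proof -
  let ?\<Phi> = "periodisation G"
  let ?Q = "cbox 0 1 :: (real ^ 'n) set"
  have Gm [measurable]: "G \<in> borel_measurable borel" using cont by (rule borel_measurable_continuous_onI)
  have decay': "norm (G x) \<le> B / (1 + norm x) ^ (CARD('n) + 1)" for x using decay by simp
  have contR: "continuous_on (cball 0 R) ?\<Phi>" for R
    by (rule continuous_on_periodisation[OF decay' B cont])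
  \<comment> \<open>The uniform bounds hold on balls only; continuity is local, so this suffices.\<close>
  have contU: "continuous_on S ?\<Phi>" for S
  proof -
    have "isCont ?\<Phi> x" for x
      using contR[of "norm x + 1"] by (rule continuous_on_interior) simp
    then show ?thesis by (simp add: continuous_at_imp_continuous_on)
  qed
  have \<Phi>m [measurable]: "?\<Phi> \<in> borel_measurable borel" using contU by (rule borel_measurable_continuous_onI)
  have compQ: "compact ?Q" by simp
  obtain M where M: "\<And>x. x \<in> ?Q \<Longrightarrow> \<bar>?\<Phi> x\<bar> \<le> M"
    using compact_imp_bounded[OF compact_continuous_image[OF contU compQ]] by (auto simp: bounded_iff)
  have M0: "0 \<le> M" using order_trans[OF abs_ge_zero M[of 0]] by (simp add: mem_box_cart)
  have bdint: "integrable lborel (\<lambda>x. indicator unit_cell x *\<^sub>R p x)"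
    if "p \<in> borel_measurable borel" "\<And>x. x \<in> unit_cell \<Longrightarrow> \<bar>p x\<bar> \<le> c" for p :: "real ^ 'n \<Rightarrow> real" and c
    using that emeasure_unit_cell_finite by (intro integrableI_bounded_set_indicator) auto
  let ?I = "LINT x|lborel. indicator unit_cell x *\<^sub>R (?\<Phi> x * ?\<Phi> x)"
  have i2: "integrable lborel (\<lambda>x. indicator unit_cell x *\<^sub>R (?\<Phi> x * ?\<Phi> x))"
  proof (rule bdint)
    show "\<bar>?\<Phi> x * ?\<Phi> x\<bar> \<le> M * M" if "x \<in> unit_cell" for x
      using M[of x] M0 that unit_cell_box(2) unfolding abs_mult by (intro mult_mono) auto
  qed simp
  have small: "?I \<le> M * e" if e: "0 < e" for e
  proof -
    obtain T where T: "(\<lambda>x. complex_of_real (T x)) \<in> trig_span" "\<And>x. x \<in> ?Q \<Longrightarrow> \<bar>?\<Phi> x - T x\<bar> < e"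
      using trig_approximation[OF contU periodisation_periodic e] by blast
    have Tp: "T (x - vec_of_int j) = T x" for x j using trig_span_periodic[OF T(1), of x j] by simp
    obtain M' where M': "0 \<le> M'" "\<And>x. \<bar>T x\<bar> \<le> M'" using trig_span_bounded[OF T(1)] by auto
    have "(\<lambda>x. complex_of_real (T x)) \<in> borel_measurable borel"
    proof (rule borel_measurable_continuous_onI)
      have "continuous_on UNIV f" if "f \<in> trig_span" for f :: "real ^ 'n \<Rightarrow> complex"
        using that by induction (auto intro!: continuous_intros continuous_character)
      then show "continuous_on UNIV (\<lambda>x. complex_of_real (T x))" using T(1) .
    qed
    then have "(\<lambda>x. Re (complex_of_real (T x))) \<in> borel_measurable borel" by measurable
    then have Tm [measurable]: "T \<in> borel_measurable borel" by simp
    have dT: "norm (G x * T x) \<le> (B * M') / (1 + norm x) ^ (CARD('n) + 1)" for x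
    proof -
      have "\<bar>G x\<bar> * \<bar>T x\<bar> \<le> B / (1 + norm x) ^ (CARD('n) + 1) * M'"
        using B by (intro mult_mono decay M') (auto intro!: divide_nonneg_nonneg zero_le_power add_nonneg_nonneg)
      then show ?thesis by (simp add: abs_mult)
    qed
    have "complex_of_real (LINT x|lborel. G x * T x) = 0"
      using integrable_decay_times_trig[OF decay B Gm z T(1)] by (simp flip: integral_complex_of_real)
    then have "0 = (LINT x|lborel. G x * T x)" by simp
    also have "\<dots> = (LINT x|lborel. indicator unit_cell x *\<^sub>R periodisation (\<lambda>x. G x * T x) x)"
      by (rule integral_eq_periodisation[OF dT]) (auto simp: B M')
    also have "periodisation (\<lambda>x. G x * T x) = (\<lambda>x. ?\<Phi> x * T x)"
      unfolding periodisation_def Tp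
      by (intro ext infsum_cmult_left')
    finally have 0: "(LINT x|lborel. indicator unit_cell x *\<^sub>R (?\<Phi> x * T x)) = 0" by simp
    have iT: "integrable lborel (\<lambda>x. indicator unit_cell x *\<^sub>R (?\<Phi> x * T x))"
    proof (rule bdint)
      show "\<bar>?\<Phi> x * T x\<bar> \<le> M * M'" if "x \<in> unit_cell" for x
        using M[of x] M0 M' that unit_cell_box(2) unfolding abs_mult by (intro mult_mono) auto
    qed simp
    have "?I = (LINT x|lborel. indicator unit_cell x *\<^sub>R (?\<Phi> x * ?\<Phi> x) - indicator unit_cell x *\<^sub>R (?\<Phi> x * T x))"
      by (simp only: Bochner_Integration.integral_diff[OF i2 iT] 0 diff_zero)
    also have "\<dots> \<le> (LINT x|lborel. indicator (unit_cell :: (real ^ 'n) set) x * (M * e))"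
    proof (rule integral_mono)
      show "integrable lborel (\<lambda>x. indicator unit_cell x *\<^sub>R (?\<Phi> x * ?\<Phi> x) - indicator unit_cell x *\<^sub>R (?\<Phi> x * T x))"
        using i2 iT by (rule Bochner_Integration.integrable_diff)
      show "integrable lborel (\<lambda>x. indicator (unit_cell :: (real ^ 'n) set) x * (M * e))"
        using emeasure_unit_cell_finite by (intro integrable_mult_left integrable_real_indicator) auto
      fix x :: "real ^ 'n"
      show "indicator unit_cell x *\<^sub>R (?\<Phi> x * ?\<Phi> x) - indicator unit_cell x *\<^sub>R (?\<Phi> x * T x)
          \<le> indicator unit_cell x * (M * e)"
      proof (cases "x \<in> unit_cell")
        case True
        then have "x \<in> ?Q" using unit_cell_box by blast
        then have "\<bar>?\<Phi> x\<bar> * \<bar>?\<Phi> x - T x\<bar> \<le> M * e"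
          using M T(2) M0 by (intro mult_mono) (auto intro: less_imp_le)
        then have "?\<Phi> x * (?\<Phi> x - T x) \<le> M * e" by (metis abs_ge_self abs_mult order_trans)
        then show ?thesis using True by (simp add: right_diff_distrib)
      qed simp
    qed
    also have "\<dots> = M * e" by (simp add: measure_unit_cell)
    finally show ?thesis .
  qed
  have "?I \<le> 0"
  proof (rule field_le_epsilon)
    fix e :: real assume "0 < e"
    \<comment> \<open>Dividing by \<open>M + 1\<close> rather than \<open>M\<close> covers the case \<open>M = 0\<close>.\<close>
    then have "?I \<le> M * (e / (M + 1))" using M0 by (intro small) simp
    also have "\<dots> \<le> e" using M0 \<open>0 < e\<close> by (simp add: field_simps)
    finally show "?I \<le> 0 + e" by simp
  qed
  moreover have "0 \<le> ?I" by (intro Bochner_Integration.integral_nonneg) (auto simp: indicator_def)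
  ultimately have "?I = 0" by (rule antisym)
  then have AE: "AE x in lborel. indicator unit_cell x *\<^sub>R (?\<Phi> x * ?\<Phi> x) = 0"
    using integral_nonneg_eq_0_iff_AE[OF i2] by (auto simp: indicator_def)
  have box0: "?\<Phi> x = 0" if "x \<in> box 0 1" for x
  proof (rule zero_if_AE_zero_on_open[OF open_box contU _ that])
    show "AE x in lborel. x \<in> box 0 1 \<longrightarrow> ?\<Phi> x = 0"
      using AE by eventually_elim (use unit_cell_box(1) in \<open>auto simp: indicator_def split: if_splits\<close>)
  qed
  \<comment> \<open>The boundary of the cube is reached by continuity from the open box.\<close>
  have cube: "?\<Phi> x = 0" if "x \<in> ?Q" for x
  proof -
    have "box 0 1 \<noteq> ({} :: (real ^ 'n) set)"
    proof -
      have "(\<chi> i. 1 / 2) \<in> (box 0 1 :: (real ^ 'n) set)" by (simp add: mem_box_cart)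
      then show ?thesis by blast
    qed
    then have cl: "closure (box 0 1) = ?Q" by (rule closure_box)
    show ?thesis
      using continuous_constant_on_closure[of "box 0 1" ?\<Phi> 0 x] contU box0 that unfolding cl by blast
  qed
  let ?k = "(\<chi> i. - \<lfloor>x $ i\<rfloor>) :: int ^ 'n"
  have "x + vec_of_int ?k \<in> ?Q" using translate_unit_cell_iff[of x ?k] unit_cell_box(2) by blast
  then show ?thesis using cube periodisation_periodic[of G x ?k] by metis
qed

text \<open>The translation difference \<open>G(a + x) - G(x)\<close> has only vanishing Fourier coefficients, the mean
  included, so its periodisation vanishes. Hence the periodisation of \<open>G\<close> is constant, and its value is the
  integral because the cell has measure one.\<close>

theorem periodisation_eq_integral:
  fixes G :: "real ^ 'n \<Rightarrow> real"
  assumes decay: "\<And>x. \<bar>G x\<bar> \<le> B / (1 + norm x) ^ (CARD('n) + 1)" and B: "0 \<le> B"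
    and cont: "continuous_on UNIV G"
    and z: "\<And>k. k \<noteq> 0 \<Longrightarrow> (LINT x|lborel. complex_of_real (G x) * character k x) = 0"
  shows "periodisation G x = integral\<^sup>L lborel G"
proof -
  let ?K = "CARD('n) + 1"
  have [measurable]: "G \<in> borel_measurable borel" using cont by (rule borel_measurable_continuous_onI)
  have chm [measurable]: "character k \<in> borel_measurable borel" for k :: "int ^ 'n"
    using continuous_character by (rule borel_measurable_continuous_onI)
  have decay': "norm (G x) \<le> B / (1 + norm x) ^ ?K" for x using decay by simp
  have shift: "periodisation G (a + x) = periodisation G x" for a x
  proof -
    define D where "D y = G (a + y) - G y" for y
    let ?B' = "B * (1 + norm a) ^ ?K + B"
    have ta: "norm (G (a + y)) \<le> B * (1 + norm a) ^ ?K / (1 + norm y) ^ ?K" for y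
      using decay_translate[of G B ?K a "norm a" "- y", OF decay' B] by simp
    have dD: "\<bar>D y\<bar> \<le> ?B' / (1 + norm y) ^ ?K" for y
      using ta[of y] decay[of y] unfolding D_def add_divide_distrib by auto
    have "periodisation D x = 0"
    proof (rule periodisation_zero[OF dD])
      show "0 \<le> ?B'" using B by simp
      show "continuous_on UNIV D" unfolding D_def
        by (intro continuous_intros continuous_on_compose2[OF cont]) auto
      fix k :: "int ^ 'n"
      have iGk: "integrable lborel (\<lambda>x. complex_of_real (G x) * character k x)"
        by (rule integrable_if_decay[OF _ B]) (use decay in \<open>auto simp: norm_mult\<close>)
      have iGa: "integrable lborel (\<lambda>x. complex_of_real (G (a + x)) * character k x)"
        by (rule integrable_if_decay[where B = "B * (1 + norm a) ^ ?K"]) (use ta B in \<open>auto simp: norm_mult\<close>)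
      have "(LINT x|lborel. complex_of_real (G (a + x)) * character k x)
          = (LINT x|lborel. complex_of_real (G x) * character k (x - a))"
        by (subst (2) lborel_integral_translate[of _ a]) (auto simp: add.commute)
      also have "\<dots> = (LINT x|lborel. complex_of_real (G x) * character k x) * character k (- a)"
        unfolding diff_conv_add_uminus character_translate mult.assoc[symmetric] by (rule integral_mult_left_zero)
      also have "\<dots> = (LINT x|lborel. complex_of_real (G x) * character k x)"
      proof (cases "k = 0")
        case True
        then show ?thesis by (simp add: character_def vec_of_int_def inner_vec_def)
      qed (simp add: z)
      finally show "(LINT x|lborel. complex_of_real (D x) * character k x) = 0"
        unfolding D_def of_real_diff left_diff_distrib
        by (subst Bochner_Integration.integral_diff[OF iGa iGk]) simp
    qed
    moreover have "periodisation D x = periodisation G (a + x) - periodisation G x"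
    proof -
      have G: "((\<lambda>j. G (y - vec_of_int j)) has_sum periodisation G y) UNIV" for y
        unfolding periodisation_def by (rule has_sum_infsum[OF periodisation_summable[OF decay' B]])
      have "((\<lambda>j. - G (x - vec_of_int j)) has_sum - periodisation G x) UNIV"
        by (subst has_sum_uminus) (simp add: G)
      from infsumI[OF has_sum_add[OF G[of "a + x"] this]]
      show ?thesis unfolding periodisation_def[of D] D_def by (simp add: add_diff_eq)
    qed
    ultimately show ?thesis by simp
  qed
  have const: "periodisation G y = periodisation G x" for y
    using shift[of "y - x" x] by simp
  have "integral\<^sup>L lborel G = (LINT y|lborel. indicator unit_cell y *\<^sub>R periodisation G y)"
    by (rule integral_eq_periodisation[OF decay' B]) simp
  also have "\<dots> = (LINT y|lborel. indicator (unit_cell :: (real ^ 'n) set) y * periodisation G x)"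
    by (rule Bochner_Integration.integral_cong[OF refl]) (subst const, simp)
  also have "\<dots> = periodisation G x" by (simp add: measure_unit_cell)
  finally show ?thesis by simp
qed

section \<open>Taylor expansion with partial derivatives\<close>

text \<open>The partial derivatives are only known at parameter \<open>0\<close> of each coordinate line; moving the base
  point along the line gives the derivative at every parameter.\<close>

lemma coordinate_mean_value:
  fixes g :: "real ^ 'n \<Rightarrow> real"
  assumes d: "\<And>p. ((\<lambda>t. g (p + t *\<^sub>R axis i 1)) has_real_derivative d p) (at 0)"
  obtains \<theta> where "0 \<le> \<theta>" "\<theta> \<le> 1" "g (a + b *\<^sub>R axis i 1) - g a = b * d (a + (\<theta> * b) *\<^sub>R axis i 1)"
proof -
  have D: "((\<lambda>s. g (a + (s * b) *\<^sub>R axis i 1)) has_real_derivative b * d (a + (s * b) *\<^sub>R axis i 1)) (at s)" for s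
  proof -
    let ?p = "a + (s * b) *\<^sub>R axis i 1"
    have "((\<lambda>u. u * b) has_real_derivative b) (at 0)" by (auto intro!: derivative_eq_intros)
    from DERIV_chain2[of "\<lambda>t. g (?p + t *\<^sub>R axis i 1)" "d ?p" "\<lambda>u. u * b" 0, OF _ this]
    have "((\<lambda>u. g (?p + (u * b) *\<^sub>R axis i 1)) has_real_derivative d ?p * b) (at 0)"
      using d[of ?p] by simp
    then have "((\<lambda>u. g (a + ((u + s) * b) *\<^sub>R axis i 1)) has_real_derivative d ?p * b) (at 0)"
      by (simp add: algebra_simps)
    then show ?thesis
      using DERIV_shift[of "\<lambda>s. g (a + (s * b) *\<^sub>R axis i 1)" "d ?p * b" 0 s] by (simp add: mult.commute)
  qed
  obtain \<theta> where "0 < \<theta>" "\<theta> < 1"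
    "g (a + (1 * b) *\<^sub>R axis i 1) - g (a + (0 * b) *\<^sub>R axis i 1) = (1 - 0) * (b * d (a + (\<theta> * b) *\<^sub>R axis i 1))"
    using MVT2[of 0 1 "\<lambda>s. g (a + (s * b) *\<^sub>R axis i 1)" "\<lambda>s. b * d (a + (s * b) *\<^sub>R axis i 1)"] D
    by auto
  then show ?thesis using that[of \<theta>] by simp
qed

text \<open>Continuous partial derivatives give the chain rule along lines. The increment is telescoped by
  moving one coordinate at a time, so the induction runs over the set of coordinates already moved.\<close>

lemma directional_derivative:
  fixes g :: "real ^ 'n \<Rightarrow> real"
  assumes d: "\<And>i p. ((\<lambda>t. g (p + t *\<^sub>R axis i 1)) has_real_derivative d i p) (at 0)"
    and cont: "\<And>i. continuous_on UNIV (d i)"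
  shows "((\<lambda>t. g (x + t *\<^sub>R v)) has_real_derivative (\<Sum>i\<in>UNIV. v $ i * d i (x + t *\<^sub>R v))) (at t)"
proof -
  define w where "w S = (\<Sum>i\<in>S. (v $ i) *\<^sub>R (axis i 1 :: real ^ 'n))" for S
  have wU: "w UNIV = v" using basis_expansion[of v] by (simp add: w_def scalar_mult_eq_scaleR)
  have step: "((\<lambda>t. g (p + t *\<^sub>R w S)) has_real_derivative (\<Sum>i\<in>S. v $ i * d i p)) (at 0)"
    if "finite S" for S p
    using that
  proof (induction S rule: finite_induct)
    case empty
    then show ?case by (simp add: w_def)
  next
    case (insert i S)
    have wi: "w (insert i S) = w S + (v $ i) *\<^sub>R axis i 1" using insert by (simp add: w_def)
    have "\<exists>\<theta>. 0 \<le> \<theta> \<and> \<theta> \<le> 1 \<and> g (p + t *\<^sub>R w (insert i S)) - g (p + t *\<^sub>R w S)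
        = (t * v $ i) * d i (p + t *\<^sub>R w S + (\<theta> * (t * v $ i)) *\<^sub>R axis i 1)" for t
      using coordinate_mean_value[of g i "d i" "p + t *\<^sub>R w S" "t * v $ i", OF d]
      by (metis (no_types, lifting) wi add.assoc scaleR_add_right scaleR_scaleR)
    then obtain \<theta> where \<theta>: "\<And>t. 0 \<le> \<theta> t" "\<And>t. \<theta> t \<le> 1"
      "\<And>t. g (p + t *\<^sub>R w (insert i S)) - g (p + t *\<^sub>R w S)
        = (t * v $ i) * d i (p + t *\<^sub>R w S + (\<theta> t * (t * v $ i)) *\<^sub>R axis i 1)" by metis
    define \<xi> where "\<xi> t = p + t *\<^sub>R w S + (\<theta> t * (t * v $ i)) *\<^sub>R axis i 1" for t
    have "(\<xi> \<longlongrightarrow> p + 0 *\<^sub>R w S + 0 *\<^sub>R axis i 1) (at 0)"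
      unfolding \<xi>_def
    proof (intro tendsto_intros)
      show "((\<lambda>t. \<theta> t * (t * v $ i)) \<longlongrightarrow> 0) (at 0)"
      proof (rule Lim_null_comparison[of _ "\<lambda>t. \<bar>t * v $ i\<bar>"])
        show "\<forall>\<^sub>F t in at 0. norm (\<theta> t * (t * v $ i)) \<le> \<bar>t * v $ i\<bar>"
          using \<theta>(1,2) by (auto simp: abs_mult intro!: always_eventually mult_left_le_one_le)
        have "((\<lambda>t. \<bar>t * v $ i\<bar>) \<longlongrightarrow> \<bar>0 * v $ i\<bar>) (at 0)" by (intro tendsto_intros)
        then show "((\<lambda>t. \<bar>t * v $ i\<bar>) \<longlongrightarrow> 0) (at 0)" by simp
      qed
    qed
    then have "((\<lambda>t. d i (\<xi> t)) \<longlongrightarrow> d i p) (at 0)"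
      using cont[of i] by (intro isCont_tendsto_compose[of p "d i"]) (auto simp: continuous_on_eq_continuous_at)
    moreover have "((\<lambda>t. (g (p + t *\<^sub>R w S) - g p) / t) \<longlongrightarrow> (\<Sum>i\<in>S. v $ i * d i p)) (at 0)"
      using insert.IH by (simp add: has_field_derivative_iff)
    ultimately have "((\<lambda>t. v $ i * d i (\<xi> t) + (g (p + t *\<^sub>R w S) - g p) / t) \<longlongrightarrow>
        v $ i * d i p + (\<Sum>i\<in>S. v $ i * d i p)) (at 0)"
      by (intro tendsto_intros)
    moreover have "\<forall>\<^sub>F t in at 0. v $ i * d i (\<xi> t) + (g (p + t *\<^sub>R w S) - g p) / t
        = (g (p + t *\<^sub>R w (insert i S)) - g p) / t"
    proof -
      have "v $ i * d i (\<xi> t) + (g (p + t *\<^sub>R w S) - g p) / t = (g (p + t *\<^sub>R w (insert i S)) - g p) / t"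
        if "t \<noteq> 0" for t
        using \<theta>(3)[of t] that unfolding \<xi>_def[symmetric] by (simp add: field_simps)
      then show ?thesis by (auto simp: eventually_at_filter)
    qed
    ultimately have "((\<lambda>t. (g (p + t *\<^sub>R w (insert i S)) - g p) / t) \<longlongrightarrow>
        v $ i * d i p + (\<Sum>i\<in>S. v $ i * d i p)) (at 0)"
      by (rule Lim_transform_eventually)
    then show ?case using insert by (simp add: has_field_derivative_iff)
  qed
  have "((\<lambda>u. g ((x + t *\<^sub>R v) + u *\<^sub>R v)) has_real_derivative (\<Sum>i\<in>UNIV. v $ i * d i (x + t *\<^sub>R v))) (at 0)"
    using step[of UNIV "x + t *\<^sub>R v"] by (simp add: wU)
  then have "((\<lambda>u. g (x + (u + t) *\<^sub>R v)) has_real_derivative (\<Sum>i\<in>UNIV. v $ i * d i (x + t *\<^sub>R v))) (at 0)"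
    by (simp add: algebra_simps)
  then show ?thesis
    using DERIV_shift[of "\<lambda>t. g (x + t *\<^sub>R v)" "\<Sum>i\<in>UNIV. v $ i * d i (x + t *\<^sub>R v)" 0 t] by simp
qed

text \<open>The \<open>k\<close>-th derivative of \<open>f\<close> at \<open>x\<close> in direction \<open>v\<close>. Summing over all lists of coordinates
  counts each mixed derivative with its multiplicity, so passing from \<open>k\<close> to \<open>k + 1\<close> just prepends a
  coordinate.\<close>

definition homogeneous_taylor :: "nat \<Rightarrow> (real ^ 'n \<Rightarrow> real) \<Rightarrow> real ^ 'n \<Rightarrow> real ^ 'n \<Rightarrow> real" where
  "homogeneous_taylor k f x v = (\<Sum>is | length is = k. mon is v * partials is f x)"

lemma finite_lists_of_length: "finite {is :: 'n::finite list. length is = k}"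
  using finite_lists_length_eq[of "UNIV :: 'n set" k] by simp

lemma sum_lists_Suc:
  fixes F :: "'n::finite list \<Rightarrow> 'b::comm_monoid_add"
  shows "(\<Sum>is | length is = Suc k. F is) = (\<Sum>is | length is = k. \<Sum>i\<in>UNIV. F (i # is))"
proof -
  have "{is :: 'n list. length is = Suc k} = (\<lambda>p. snd p # fst p) ` ({is. length is = k} \<times> UNIV)"
    by (auto simp: length_Suc_conv image_iff)
  moreover have "inj_on (\<lambda>p :: 'n list \<times> 'n. snd p # fst p) ({is. length is = k} \<times> UNIV)"
    by (auto simp: inj_on_def)
  ultimately have "(\<Sum>is | length is = Suc k. F is) = (\<Sum>p\<in>{is. length is = k} \<times> UNIV. F (snd p # fst p))"
    by (simp add: sum.reindex o_def)
  then show ?thesis by (simp add: sum.cartesian_product case_prod_beta)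
qed

lemma partials_has_derivative:
  assumes "C_k N f" "length is < N"
  shows "((\<lambda>t. partials is f (p + t *\<^sub>R axis i 1)) has_real_derivative partials (i # is) f p) (at 0)"
proof -
  have "(\<lambda>t. partials is f (p + t *\<^sub>R axis i 1)) differentiable (at 0)"
    using assms unfolding C_k_def by blast
  then have "((\<lambda>t. partials is f (p + t *\<^sub>R axis i 1)) has_vector_derivative
      vector_derivative (\<lambda>t. partials is f (p + t *\<^sub>R axis i 1)) (at 0)) (at 0)"
    by (simp add: vector_derivative_works)
  then show ?thesis
    by (simp add: has_real_derivative_iff_has_vector_derivative partials_def partial_deriv_def)
qed

lemma homogeneous_taylor_derivative:
  assumes f: "C_k N f" and k: "k < N"
  shows "((\<lambda>t. homogeneous_taylor k f (x + t *\<^sub>R v) v) has_real_derivative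
    homogeneous_taylor (Suc k) f (x + t *\<^sub>R v) v) (at t)"
proof -
  have D: "((\<lambda>t. partials is f (x + t *\<^sub>R v)) has_real_derivative
      (\<Sum>i\<in>UNIV. v $ i * partials (i # is) f (x + t *\<^sub>R v))) (at t)" if "length is = k" for "is"
    using f k that by (intro directional_derivative partials_has_derivative) (auto simp: C_k_def)
  have "((\<lambda>t. homogeneous_taylor k f (x + t *\<^sub>R v) v) has_real_derivative
    (\<Sum>is | length is = k. mon is v * (\<Sum>i\<in>UNIV. v $ i * partials (i # is) f (x + t *\<^sub>R v)))) (at t)"
    unfolding homogeneous_taylor_def
    by (intro DERIV_sum DERIV_cmult D) simp
  also have "(\<Sum>is | length is = k. mon is v * (\<Sum>i\<in>UNIV. v $ i * partials (i # is) f (x + t *\<^sub>R v)))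
      = homogeneous_taylor (Suc k) f (x + t *\<^sub>R v) v"
    unfolding homogeneous_taylor_def sum_lists_Suc by (simp add: sum_distrib_left mult_ac)
  finally show ?thesis .
qed

definition taylor :: "nat \<Rightarrow> (real ^ 'n \<Rightarrow> real) \<Rightarrow> real ^ 'n \<Rightarrow> real ^ 'n \<Rightarrow> real" where
  "taylor N f x v = (\<Sum>k<N. homogeneous_taylor k f x v / fact k)"

lemma taylor_formula:
  assumes f: "C_k N f" and N: "0 < N"
  obtains t where "f (x + v) = taylor N f x v + homogeneous_taylor N f (x + t *\<^sub>R v) v / fact N"
proof -
  let ?diff = "\<lambda>k t. homogeneous_taylor k f (x + t *\<^sub>R v) v"
  have "\<exists>t::real. 0 < t \<and> t < 1 \<and>
      f (x + 1 *\<^sub>R v) = (\<Sum>k<N. ?diff k 0 / fact k * 1 ^ k) + ?diff N t / fact N * 1 ^ N"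
  proof (rule Maclaurin)
    have "{is :: 'a list. length is = 0} = {[]}" by auto
    then show "?diff 0 = (\<lambda>t. f (x + t *\<^sub>R v))"
      by (simp add: homogeneous_taylor_def partials_def)
  qed (use N in \<open>auto intro: homogeneous_taylor_derivative[OF f]\<close>)
  then show ?thesis using that by (auto simp: taylor_def)
qed

text \<open>The first bound is Lagrange's form of the remainder. The second is for large increments, where the
  boundedness of \<open>f\<close> leaves only the growth of the Taylor polynomial, one power less.\<close>

lemma taylor_remainder:
  fixes f :: "real ^ 'n \<Rightarrow> real"
  assumes f: "bounded_C_k N f" and N: "0 < N"
  obtains A where "0 \<le> A" "\<And>x v. \<bar>f (x + v) - taylor N f x v\<bar> \<le> A * norm v ^ N"
    "\<And>x v s. 1 \<le> s \<Longrightarrow> norm v \<le> s \<Longrightarrow> \<bar>f (x + v) - taylor N f x v\<bar> \<le> A * s ^ (N - 1)"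
proof -
  have "\<exists>M. \<forall>x. \<bar>partials is f x\<bar> \<le> M" if "length is \<le> N" for "is"
    using f that unfolding bounded_C_k_def bounded_iff by auto
  then obtain M where M: "\<And>is x. length is \<le> N \<Longrightarrow> \<bar>partials is f x\<bar> \<le> M is" by metis
  define c where "c k = (\<Sum>is :: 'n list | length is = k. M is)" for k
  have hb: "\<bar>homogeneous_taylor k f x v\<bar> \<le> c k * norm v ^ k" if k: "k \<le> N" for k x v
  proof -
    have "\<bar>homogeneous_taylor k f x v\<bar> \<le> (\<Sum>is | length is = k. norm v ^ k * M is)"
      unfolding homogeneous_taylor_def
    proof (rule order_trans[OF sum_abs sum_mono])
      fix "is" :: "'n list" assume "is \<in> {is. length is = k}"
      then show "\<bar>mon is v * partials is f x\<bar> \<le> norm v ^ k * M is"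
        using abs_mon_le[of "is" v] M[of "is" x] k unfolding abs_mult by (intro mult_mono) auto
    qed
    then show ?thesis by (simp add: c_def sum_distrib_left mult.commute)
  qed
  have c0: "0 \<le> c k" if "k \<le> N" for k
    unfolding c_def using that by (intro sum_nonneg) (auto intro: order_trans[OF abs_ge_zero M])
  define A where "A = c N + (c 0 + (\<Sum>k<N. c k))"
  have AN: "0 \<le> c N" "0 \<le> c 0" "0 \<le> (\<Sum>k<N. c k)" using c0 by (auto intro: sum_nonneg)
  show ?thesis
  proof
    show "0 \<le> A" using AN by (simp add: A_def)
  next
    fix x v :: "real ^ 'n"
    have Ck: "C_k N f" using f by (simp add: bounded_C_k_def)
    obtain t where t: "f (x + v) = taylor N f x v + homogeneous_taylor N f (x + t *\<^sub>R v) v / fact N"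
      using taylor_formula[OF Ck N] by blast
    have "\<bar>f (x + v) - taylor N f x v\<bar> = \<bar>homogeneous_taylor N f (x + t *\<^sub>R v) v\<bar> / fact N"
      by (simp add: t)
    also have "\<dots> \<le> \<bar>homogeneous_taylor N f (x + t *\<^sub>R v) v\<bar>"
      by (simp add: divide_le_eq mult_le_cancel_left1)
    also have "\<dots> \<le> c N * norm v ^ N" by (rule hb) simp
    also have "\<dots> \<le> A * norm v ^ N" using AN by (intro mult_right_mono) (auto simp: A_def)
    finally show "\<bar>f (x + v) - taylor N f x v\<bar> \<le> A * norm v ^ N" .
  next
    fix x v :: "real ^ 'n" and s :: real
    assume s: "1 \<le> s" "norm v \<le> s"
    have "{is :: 'n list. length is = 0} = {[]}" by auto
    then have "\<bar>f (x + v)\<bar> \<le> c 0" using M[of "[]" "x + v"] by (simp add: c_def partials_def)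
    also have "\<dots> \<le> c 0 * s ^ (N - 1)" using AN s by (simp add: mult_le_cancel_left1 one_le_power)
    finally have 1: "\<bar>f (x + v)\<bar> \<le> c 0 * s ^ (N - 1)" .
    have "\<bar>taylor N f x v\<bar> \<le> (\<Sum>k<N. c k * s ^ (N - 1))"
      unfolding taylor_def
    proof (rule order_trans[OF sum_abs sum_mono])
      fix k assume "k \<in> {..<N}"
      then have k: "k \<le> N" "k \<le> N - 1" by auto
      have "\<bar>homogeneous_taylor k f x v / fact k\<bar> \<le> \<bar>homogeneous_taylor k f x v\<bar>"
        by (simp add: divide_le_eq mult_le_cancel_left1)
      also have "\<dots> \<le> c k * norm v ^ k" by (rule hb[OF k(1)])
      also have "\<dots> \<le> c k * s ^ k" using s by (intro mult_left_mono power_mono c0 k) auto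
      also have "\<dots> \<le> c k * s ^ (N - 1)" using s by (intro mult_left_mono power_increasing c0 k) auto
      finally show "\<bar>homogeneous_taylor k f x v / fact k\<bar> \<le> c k * s ^ (N - 1)" .
    qed
    then have "\<bar>taylor N f x v\<bar> \<le> (\<Sum>k<N. c k) * s ^ (N - 1)" by (simp add: sum_distrib_right)
    moreover have "0 \<le> c N * s ^ (N - 1)" using AN s by simp
    ultimately show "\<bar>f (x + v) - taylor N f x v\<bar> \<le> A * s ^ (N - 1)"
      using 1 unfolding A_def distrib_right by linarith
  qed
qed

section \<open>Strang-Fix conditions\<close>

lemma norm_exp_ii_minus_1_le: "norm (exp (- \<i> * complex_of_real s) - 1) \<le> \<bar>s\<bar>"
  using Taylor_exp[of "- \<i> * complex_of_real s" 0] by (simp add: norm_mult)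

text \<open>Differentiation under the integral sign: the difference quotient of the exponential in the \<open>i\<close>-th
  frequency is dominated by \<open>\<bar>x\<^sub>i\<bar>\<close>.\<close>

lemma fourier_has_partial_derivative:
  fixes g :: "real ^ 'n \<Rightarrow> complex"
  assumes gi: "integrable lborel g" and xgi: "integrable lborel (\<lambda>x. complex_of_real (x $ i) * g x)"
  shows "((\<lambda>t. fourier g (y + t *\<^sub>R axis i 1)) has_vector_derivative
    fourier (\<lambda>x. - \<i> * (complex_of_real (x $ i) * g x)) y) (at 0)"
proof -
  let ?F = "\<lambda>t. fourier g (y + t *\<^sub>R axis i 1)"
  let ?D = "fourier (\<lambda>x. - \<i> * (complex_of_real (x $ i) * g x)) y"
  define e where "e x = exp (- \<i> * complex_of_real (y \<bullet> x))" for x :: "real ^ 'n"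
  define q where "q t a = (exp (- \<i> * complex_of_real (t * a)) - 1) / complex_of_real t" for t a :: real
  have [measurable]: "g \<in> borel_measurable borel" using gi by (simp add: borel_measurable_integrable)
  have [measurable]: "e \<in> borel_measurable borel" unfolding e_def by measurable
  have ne: "norm (e x) = 1" for x by (simp add: e_def)
  have qlim: "((\<lambda>t. q t a) \<longlongrightarrow> - \<i> * complex_of_real a) (at 0)" for a
  proof -
    let ?c = "- \<i> * complex_of_real a"
    have "((\<lambda>z. exp (z * ?c)) has_field_derivative ?c) (at 0)"
      by (auto intro!: derivative_eq_intros)
    then have "((\<lambda>z. (exp (z * ?c) - 1) / z) \<longlongrightarrow> ?c) (at 0)"
      by (simp add: has_field_derivative_iff)
    moreover have "filterlim complex_of_real (at 0) (at 0)"
      unfolding filterlim_at by (auto simp: eventually_at_filter intro!: tendsto_eq_intros)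
    ultimately have "((\<lambda>t. (exp (complex_of_real t * ?c) - 1) / complex_of_real t) \<longlongrightarrow> ?c) (at 0)"
      by (rule filterlim_compose)
    then show ?thesis by (simp add: q_def mult_ac)
  qed
  have qle: "norm (q t a) \<le> \<bar>a\<bar>" if "t \<noteq> 0" for t a
    using norm_exp_ii_minus_1_le[of "t * a"] that
    by (simp add: q_def norm_divide abs_mult divide_le_eq mult.commute)
  have int_e: "integrable lborel (\<lambda>x. g x * exp (- \<i> * complex_of_real (z \<bullet> x)))" for z
    by (rule Bochner_Integration.integrable_bound[OF gi]) (auto simp: norm_mult)
  have quot: "(?F t - ?F 0) / complex_of_real t = (LINT x|lborel. g x * e x * q t (x $ i))" if t: "t \<noteq> 0" for t
  proof -
    have "?F t - ?F 0 = (LINT x|lborel. g x * exp (- \<i> * complex_of_real ((y + t *\<^sub>R axis i 1) \<bullet> x)) - g x * e x)"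
      unfolding fourier_def e_def by (subst Bochner_Integration.integral_diff[OF int_e int_e]) simp
    also have "\<dots> = (LINT x|lborel. complex_of_real t * (g x * e x * q t (x $ i)))"
    proof (rule Bochner_Integration.integral_cong[OF refl])
      fix x :: "real ^ 'n"
      have "exp (- \<i> * complex_of_real ((y + t *\<^sub>R axis i 1) \<bullet> x)) = e x * exp (- \<i> * complex_of_real (t * x $ i))"
        by (simp add: e_def inner_add_left inner_axis' algebra_simps exp_add[symmetric])
      moreover have "complex_of_real t * q t (x $ i) = exp (- \<i> * complex_of_real (t * x $ i)) - 1"
        using t by (simp add: q_def)
      then have "complex_of_real t * (g x * e x * q t (x $ i))
          = g x * e x * (exp (- \<i> * complex_of_real (t * x $ i)) - 1)"
        by (metis mult.left_commute)
      ultimately show "g x * exp (- \<i> * complex_of_real ((y + t *\<^sub>R axis i 1) \<bullet> x)) - g x * e x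
          = complex_of_real t * (g x * e x * q t (x $ i))"
        by (simp only: right_diff_distrib mult.assoc mult_1_right)
    qed
    also have "\<dots> = complex_of_real t * (LINT x|lborel. g x * e x * q t (x $ i))"
      by (rule integral_mult_right_zero)
    finally show ?thesis using t by simp
  qed
  have "((\<lambda>t. (LINT x|lborel. g x * e x * q t (x $ i))) \<longlongrightarrow>
      (LINT x|lborel. g x * e x * (- \<i> * complex_of_real (x $ i)))) (at 0)"
    unfolding tendsto_at_iff_sequentially o_def
  proof (intro allI impI)
    fix X :: "nat \<Rightarrow> real"
    assume X: "\<forall>n. X n \<in> UNIV - {0}" "X \<longlonglongrightarrow> 0"
    show "(\<lambda>n. LINT x|lborel. g x * e x * q (X n) (x $ i)) \<longlonglongrightarrow>
        (LINT x|lborel. g x * e x * (- \<i> * complex_of_real (x $ i)))"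
    proof (rule integral_dominated_convergence[where w = "\<lambda>x. norm (complex_of_real (x $ i) * g x)"])
      show "integrable lborel (\<lambda>x. norm (complex_of_real (x $ i) * g x))"
        by (intro integrable_norm xgi)
      show "(\<lambda>x. g x * e x * q (X n) (x $ i)) \<in> borel_measurable lborel" for n
        unfolding q_def by measurable
      have "(\<lambda>n. q (X n) a) \<longlonglongrightarrow> - \<i> * complex_of_real a" for a
        using qlim[of a] X unfolding tendsto_at_iff_sequentially o_def by blast
      then show "AE x in lborel. (\<lambda>n. g x * e x * q (X n) (x $ i)) \<longlonglongrightarrow> g x * e x * (- \<i> * complex_of_real (x $ i))"
        by (intro always_eventually allI tendsto_intros)
      show "AE x in lborel. norm (g x * e x * q (X n) (x $ i)) \<le> norm (complex_of_real (x $ i) * g x)" for n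
        using X(1) qle by (auto simp: norm_mult ne mult.commute intro!: always_eventually mult_left_mono)
    qed simp
  qed
  also have "(LINT x|lborel. g x * e x * (- \<i> * complex_of_real (x $ i))) = ?D"
    unfolding fourier_def e_def by (intro Bochner_Integration.integral_cong refl) (simp add: mult_ac)
  finally have "((\<lambda>t. (?F t - ?F 0) / complex_of_real t) \<longlongrightarrow> ?D) (at 0)"
    by (rule Lim_transform_eventually) (use quot in \<open>auto simp: eventually_at_filter\<close>)
  then have "((\<lambda>t. norm ((?F t - ?F 0) / complex_of_real t - ?D)) \<longlongrightarrow> 0) (at 0)"
    by (simp add: LIM_zero_iff tendsto_norm_zero_iff)
  then have "((\<lambda>t. norm ((?F t - ?F 0) - (t - 0) *\<^sub>R ?D) / norm (t - 0)) \<longlongrightarrow> 0) (at 0)"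
  proof (rule Lim_transform_eventually)
    have "norm ((?F t - ?F 0) / complex_of_real t - ?D) = norm ((?F t - ?F 0) - (t - 0) *\<^sub>R ?D) / norm (t - 0)"
      if "t \<noteq> 0" for t
    proof -
      have "(?F t - ?F 0) / complex_of_real t - ?D = ((?F t - ?F 0) - t *\<^sub>R ?D) / complex_of_real t"
        using that by (simp add: diff_divide_distrib scaleR_conv_of_real)
      then show ?thesis by (simp add: norm_divide)
    qed
    then show "\<forall>\<^sub>F t in at 0. norm ((?F t - ?F 0) / complex_of_real t - ?D)
        = norm ((?F t - ?F 0) - (t - 0) *\<^sub>R ?D) / norm (t - 0)"
      by (auto simp: eventually_at_filter)
  qed
  then show ?thesis
    unfolding has_vector_derivative_def has_derivative_iff_norm
    by (simp add: bounded_linear_scaleR_left)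
qed

lemma partials_fourier:
  fixes \<psi> :: "real ^ 'n \<Rightarrow> real"
  assumes decay: "\<And>x. \<bar>\<psi> x\<bar> \<le> B / (1 + norm x) ^ (L + (CARD('n) + 1))" and B: "0 \<le> B"
    and [measurable]: "\<psi> \<in> borel_measurable borel" and len: "length is \<le> L"
  shows "partials is (fourier (\<lambda>x. complex_of_real (\<psi> x)))
    = fourier (\<lambda>x. (- \<i>) ^ length is * complex_of_real (mon is x * \<psi> x))"
  using len
proof (induction "is")
  case Nil
  then show ?case by (simp add: partials_def)
next
  case (Cons i "is")
  have monm [measurable]: "mon js \<in> borel_measurable borel" for js :: "'n list"
    by (intro borel_measurable_continuous_onI continuous_on_mon continuous_on_id)
  have int: "integrable lborel (\<lambda>x. c * complex_of_real (mon js x * \<psi> x))" if "length js \<le> L" for js c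
  proof (rule integrable_mult_right, rule integrable_if_decay[OF _ B])
    show "norm (complex_of_real (mon js x * \<psi> x)) \<le> B / (1 + norm x) ^ (CARD('n) + 1)" for x
      using mon_decay[OF decay that B, of x] by (simp only: norm_of_real)
  qed simp
  let ?g = "\<lambda>x. (- \<i>) ^ length is * complex_of_real (mon is x * \<psi> x)"
  have "((\<lambda>t. fourier ?g (y + t *\<^sub>R axis i 1)) has_vector_derivative
    fourier (\<lambda>x. - \<i> * (complex_of_real (x $ i) * ?g x)) y) (at 0)" for y
  proof (rule fourier_has_partial_derivative)
    show "integrable lborel ?g" using Cons.prems by (intro int) simp
    show "integrable lborel (\<lambda>x. complex_of_real (x $ i) * ?g x)"
      using int[of "i # is" "(- \<i>) ^ length is"] Cons.prems by (simp add: mult_ac)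
  qed
  then have "partial_deriv i (fourier ?g) = fourier (\<lambda>x. - \<i> * (complex_of_real (x $ i) * ?g x))"
    unfolding partial_deriv_def by (intro ext vector_derivative_at)
  moreover have "partials (i # is) (fourier (\<lambda>x. complex_of_real (\<psi> x))) = partial_deriv i (fourier ?g)"
    using Cons by (simp add: partials_def)
  ultimately show ?case by (simp add: mult_ac)
qed

text \<open>For \<open>G = mon is * \<psi>\<close> the derivatives of \<open>\<Psi>\<close> at \<open>2\<pi>k\<close> are, up to a power of \<open>-\<i>\<close>, the Fourier
  coefficients of the periodisation of \<open>G\<close>. So the periodisation is constant, equal to the value at
  \<open>k = 0\<close>.\<close>

lemma strang_fix_reproduction:
  fixes \<psi> :: "real ^ 'n \<Rightarrow> real"
  assumes decay: "\<And>x. \<bar>\<psi> x\<bar> \<le> B / (1 + norm x) ^ (L + (CARD('n) + 1))" and B: "0 \<le> B"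
    and cont: "continuous_on UNIV \<psi>"
  defines "\<Psi> \<equiv> fourier (\<lambda>x. complex_of_real (\<psi> x))"
  assumes value_0: "\<Psi> 0 = 1"
    and derivs_0: "\<And>\<alpha>. 1 \<le> multi_order \<alpha> \<Longrightarrow> multi_order \<alpha> \<le> L \<Longrightarrow> multi_deriv \<alpha> \<Psi> 0 = 0"
    and derivs_j: "\<And>j \<alpha>. j \<noteq> 0 \<Longrightarrow> multi_order \<alpha> \<le> L \<Longrightarrow>
      multi_deriv \<alpha> \<Psi> ((2 * pi) *\<^sub>R vec_of_int j) = 0"
    and len: "length is \<le> L"
  shows "((\<lambda>j. mon is (y - vec_of_int j) * \<psi> (y - vec_of_int j)) has_sum (if is = [] then 1 else 0)) UNIV"
proof -
  have m [measurable]: "\<psi> \<in> borel_measurable borel" using cont by (rule borel_measurable_continuous_onI)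
  define G where "G x = mon is x * \<psi> x" for x
  have dG: "\<bar>G x\<bar> \<le> B / (1 + norm x) ^ (CARD('n) + 1)" for x
    unfolding G_def by (rule mon_decay[OF decay len B])
  have cG: "continuous_on UNIV G" unfolding G_def by (intro continuous_intros cont)
  obtain js where js: "multi_deriv (count_list is) \<Psi> = partials js \<Psi>" "mon js = mon is" "length js = length is"
    by (rule multi_deriv_eq_partials)
  have ord: "multi_order (count_list is) \<le> L" using len by (simp add: length_eq_multi_order)
  have "partials js \<Psi> = fourier (\<lambda>x. (- \<i>) ^ length is * complex_of_real (G x))"
    unfolding \<Psi>_def using partials_fourier[OF decay B m, of js] len js by (simp add: G_def)
  then have PG: "partials js \<Psi> z = (- \<i>) ^ length is * fourier (\<lambda>x. complex_of_real (G x)) z" for z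
    by (simp add: fourier_def mult.assoc)
  have char: "fourier (\<lambda>x. complex_of_real (G x)) ((2 * pi) *\<^sub>R vec_of_int k)
      = (LINT x|lborel. complex_of_real (G x) * character k x)" for k
    by (simp add: fourier_def character_def)
  have z: "(LINT x|lborel. complex_of_real (G x) * character k x) = 0" if "k \<noteq> 0" for k
  proof -
    have "partials js \<Psi> ((2 * pi) *\<^sub>R vec_of_int k) = 0" using derivs_j[OF that ord] by (simp add: js)
    then show ?thesis by (simp add: PG char)
  qed
  have F0: "complex_of_real (integral\<^sup>L lborel G) = fourier (\<lambda>x. complex_of_real (G x)) 0"
    by (simp add: fourier_def)
  have "integral\<^sup>L lborel G = (if is = [] then 1 else 0)"
  proof (cases "is = []")
    case True
    then have "fourier (\<lambda>x. complex_of_real (G x)) 0 = 1" using value_0 by (simp add: \<Psi>_def G_def)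
    then show ?thesis using F0 True by simp
  next
    case False
    then have "1 \<le> multi_order (count_list is)" by (simp flip: length_eq_multi_order add: Suc_le_eq)
    then have "partials js \<Psi> 0 = 0" using derivs_0[OF _ ord] by (simp add: js)
    then show ?thesis using F0 False by (simp add: PG)
  qed
  moreover have "periodisation G y = integral\<^sup>L lborel G"
    by (rule periodisation_eq_integral[OF dG B cG z])
  moreover have "((\<lambda>j. G (y - vec_of_int j)) has_sum periodisation G y) UNIV"
    unfolding periodisation_def
    by (rule has_sum_infsum, rule periodisation_summable[OF _ B]) (use dG in simp)
  ultimately show ?thesis by (simp add: G_def)
qed

section \<open>Decay of the quasi-interpolation kernel\<close>

text \<open>Inside a large ball continuity bounds \<open>\<psi>\<close>; outside it \<open>\<parallel>x\<parallel>\<close> and \<open>1 + \<parallel>x\<parallel>\<close> are comparable.\<close>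

lemma global_decay:
  fixes \<psi> :: "real ^ 'n \<Rightarrow> real"
  assumes cont: "continuous_on UNIV \<psi>"
    and decay: "\<psi> \<in> O[at_infinity](\<lambda>x. norm x powi (- int K))"
  obtains B where "0 \<le> B" "\<And>x. \<bar>\<psi> x\<bar> \<le> B / (1 + norm x) ^ K"
proof -
  obtain c where c: "0 < c" "\<forall>\<^sub>F x in at_infinity. norm (\<psi> x) \<le> c * norm (norm x powi (- int K))"
    using landau_o.bigE[OF decay] by blast
  then obtain b where b: "\<And>x. b \<le> norm x \<Longrightarrow> \<bar>\<psi> x\<bar> \<le> c * (1 / norm x ^ K)"
    by (auto simp: eventually_at_infinity power_int_minus divide_inverse norm_power)
  define R where "R = max 1 b"
  have R: "1 \<le> R" "b \<le> R" by (simp_all add: R_def)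
  have "compact (cball (0 :: real ^ 'n) R)" by simp
  then have "bounded (\<psi> ` cball 0 R)"
    by (intro compact_imp_bounded compact_continuous_image continuous_on_subset[OF cont]) auto
  then obtain M where "\<forall>z\<in>\<psi> ` cball 0 R. norm z \<le> M" unfolding bounded_iff by blast
  then have M: "\<bar>\<psi> x\<bar> \<le> M" if "norm x \<le> R" for x :: "real ^ 'n" using that by simp
  have M0: "0 \<le> M" using order_trans[OF abs_ge_zero M[of 0]] R by simp
  show ?thesis
  proof
    show "0 \<le> M * (1 + R) ^ K + c * 2 ^ K" using M0 c R by simp
    fix x :: "real ^ 'n"
    have p: "0 < (1 + norm x) ^ K" by (simp add: add_pos_nonneg)
    show "\<bar>\<psi> x\<bar> \<le> (M * (1 + R) ^ K + c * 2 ^ K) / (1 + norm x) ^ K"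
    proof (cases "norm x \<le> R")
      case True
      have "\<bar>\<psi> x\<bar> * (1 + norm x) ^ K \<le> M * (1 + R) ^ K"
        using M[OF True] True M0 by (intro mult_mono power_mono) auto
      also have "\<dots> \<le> M * (1 + R) ^ K + c * 2 ^ K" using c by simp
      finally show ?thesis using p by (simp add: pos_le_divide_eq)
    next
      case False
      then have x: "1 \<le> norm x" "b \<le> norm x" using R by auto
      have "(1 + norm x) ^ K \<le> (2 * norm x) ^ K" using x by (intro power_mono) auto
      then have "\<bar>\<psi> x\<bar> * (1 + norm x) ^ K \<le> c * (1 / norm x ^ K) * (2 * norm x) ^ K"
        using b[OF x(2)] c x by (intro mult_mono) auto
      also have "\<dots> = c * 2 ^ K" using x by (auto simp: power_mult_distrib)
      also have "\<dots> \<le> M * (1 + R) ^ K + c * 2 ^ K" using M0 R by simp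
      finally show ?thesis using p by (simp add: pos_le_divide_eq)
    qed
  qed
qed

lemma continuous_shift_comb:
  assumes "continuous_on UNIV \<phi>"
  shows "continuous_on UNIV (shift_comb \<Delta> \<mu> \<phi>)"
  unfolding shift_comb_def
  by (intro continuous_intros continuous_on_compose2[OF assms]) auto

lemma shift_comb_decay:
  fixes w :: "real ^ 'n \<Rightarrow> real"
  assumes w: "\<And>z. \<bar>w z\<bar> \<le> C / (1 + norm z) ^ K" and C: "0 \<le> C"
  obtains C' where "0 \<le> C'" "\<And>z. \<bar>shift_comb \<Delta> \<mu> w z\<bar> \<le> C' / (1 + norm z) ^ K"
proof
  let ?C = "\<Sum>k\<in>\<Delta>. \<bar>\<mu> k\<bar> * (C * (1 + norm (vec_of_int k :: real ^ 'n)) ^ K)"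
  show "0 \<le> ?C" using C by (intro sum_nonneg mult_nonneg_nonneg) auto
  fix z :: "real ^ 'n"
  have "\<bar>shift_comb \<Delta> \<mu> w z\<bar> \<le> (\<Sum>k\<in>\<Delta>. \<bar>\<mu> k\<bar> * (C * (1 + norm (vec_of_int k :: real ^ 'n)) ^ K / (1 + norm z) ^ K))"
    unfolding shift_comb_def
  proof (rule order_trans[OF sum_abs sum_mono])
    fix k
    have "norm (w (- vec_of_int k - (- z))) \<le> C * (1 + norm (vec_of_int k :: real ^ 'n)) ^ K / (1 + norm (- z)) ^ K"
      by (rule decay_translate[OF _ C]) (use w in auto)
    then show "\<bar>\<mu> k * w (z - vec_of_int k)\<bar> \<le> \<bar>\<mu> k\<bar> * (C * (1 + norm (vec_of_int k :: real ^ 'n)) ^ K / (1 + norm z) ^ K)"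
      by (simp only: abs_mult) (intro mult_left_mono, auto)
  qed
  then show "\<bar>shift_comb \<Delta> \<mu> w z\<bar> \<le> ?C / (1 + norm z) ^ K" by (simp add: sum_divide_distrib)
qed

section \<open>Polynomial reproduction and the approximation order\<close>

text \<open>Reproduction phrased in the local variable \<open>y - j\<close>. In this form
  every series converges by the decay of the kernel, and Taylor expansions about the evaluation point
  can be summed directly.\<close>

definition reproduces_polynomials :: "nat \<Rightarrow> (real ^ 'n \<Rightarrow> real) \<Rightarrow> bool" where
  "reproduces_polynomials L \<psi> \<longleftrightarrow> (\<forall>is y. length is \<le> L \<longrightarrow>
     ((\<lambda>j. mon is (y - vec_of_int j) * \<psi> (y - vec_of_int j)) has_sum (if is = [] then 1 else 0)) UNIV)"

text \<open>Writing \<open>j\<^sub>i = y\<^sub>i - (y - j)\<^sub>i\<close> trades one factor in the node for one in the local variable; the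
  generalisation over \<open>as\<close> carries the factors already traded.\<close>

lemma reproduces_mon:
  fixes \<psi> :: "real ^ 'n \<Rightarrow> real"
  assumes rep: "reproduces_polynomials L \<psi>" and len: "length is + length as \<le> L"
  shows "((\<lambda>j. mon is (vec_of_int j) * mon as (y - vec_of_int j) * \<psi> (y - vec_of_int j))
    has_sum (if as = [] then mon is y else 0)) UNIV"
  using len
proof (induction "is" arbitrary: as)
  case Nil
  then show ?case using rep[unfolded reproduces_polynomials_def, rule_format, of as y] by (cases "as = []") auto
next
  case (Cons i "is")
  let ?T = "\<lambda>as j. mon is (vec_of_int j) * mon as (y - vec_of_int j) * \<psi> (y - vec_of_int j)"
  have "((\<lambda>j. y $ i * ?T as j) has_sum (y $ i * (if as = [] then mon is y else 0))) UNIV"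
    using Cons by (intro has_sum_cmult_right Cons.IH) simp
  moreover have "((\<lambda>j. (-1) * ?T (i # as) j) has_sum (-1) * (if i # as = [] then mon is y else 0)) UNIV"
    using Cons by (intro has_sum_cmult_right Cons.IH) simp
  ultimately have "((\<lambda>j. y $ i * ?T as j + (-1) * ?T (i # as) j) has_sum
      (y $ i * (if as = [] then mon is y else 0) + (-1) * (if i # as = [] then mon is y else 0))) UNIV"
    by (rule has_sum_add)
  then show ?case by (simp add: algebra_simps split: if_splits)
qed

lemma finite_multi_order: "finite {\<alpha> :: 'n::finite \<Rightarrow> nat. multi_order \<alpha> \<le> M}"
proof (rule finite_subset)
  show "finite (PiE (UNIV :: 'n set) (\<lambda>_. {..M}))" by (intro finite_PiE) auto
  have "\<alpha> i \<le> multi_order \<alpha>" for \<alpha> :: "'n \<Rightarrow> nat" and i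
    unfolding multi_order_def by (rule member_le_sum) auto
  then show "{\<alpha> :: 'n \<Rightarrow> nat. multi_order \<alpha> \<le> M} \<subseteq> PiE UNIV (\<lambda>_. {..M})"
    by (auto intro: order_trans)
qed

lemma quasi_interp_polynomial:
  fixes \<psi> :: "real ^ 'n \<Rightarrow> real"
  assumes rep: "reproduces_polynomials L \<psi>" and h: "0 < h" and p: "p \<in> polys_upto L"
  shows "(quasi_term \<psi> h p x has_sum p x) UNIV"
proof -
  obtain c where c: "\<And>x. p x = (\<Sum>\<alpha> | multi_order \<alpha> \<le> L. c \<alpha> * (\<Prod>i\<in>UNIV. (x $ i) ^ \<alpha> i))"
    using p by (auto simp: polys_upto_def)
  obtain l :: "('n \<Rightarrow> nat) \<Rightarrow> 'n list" where l: "\<And>\<alpha>. count_list (l \<alpha>) = \<alpha>"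
    using ex_list_with_counts by metis
  have pm: "p x = (\<Sum>\<alpha> | multi_order \<alpha> \<le> L. c \<alpha> * mon (l \<alpha>) x)" for x
    by (simp add: c mon_eq_prod_count l)
  let ?y = "x /\<^sub>R h"
  have "((\<lambda>j. mon (l \<alpha>) (vec_of_int j) * \<psi> (?y - vec_of_int j)) has_sum mon (l \<alpha>) ?y) UNIV"
    if "multi_order \<alpha> \<le> L" for \<alpha>
    using reproduces_mon[OF rep, of "l \<alpha>" "[]" ?y] that by (simp add: length_eq_multi_order[of "l \<alpha>"] l)
  then have "((\<lambda>j. \<Sum>\<alpha> | multi_order \<alpha> \<le> L. (c \<alpha> * h ^ length (l \<alpha>)) * (mon (l \<alpha>) (vec_of_int j) * \<psi> (?y - vec_of_int j)))
      has_sum (\<Sum>\<alpha> | multi_order \<alpha> \<le> L. (c \<alpha> * h ^ length (l \<alpha>)) * mon (l \<alpha>) ?y)) UNIV"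
    by (intro has_sum_finite_sum has_sum_cmult_right finite_multi_order) auto
  moreover have "(\<Sum>\<alpha> | multi_order \<alpha> \<le> L. (c \<alpha> * h ^ length (l \<alpha>)) * mon (l \<alpha>) ?y) = p x"
  proof -
    have "h ^ length (l \<alpha>) * mon (l \<alpha>) ?y = mon (l \<alpha>) x" for \<alpha>
      using mon_scaleR[of "l \<alpha>" h ?y] h by simp
    then show ?thesis by (simp add: pm mult.assoc)
  qed
  moreover have "(\<Sum>\<alpha> | multi_order \<alpha> \<le> L. (c \<alpha> * h ^ length (l \<alpha>)) * (mon (l \<alpha>) (vec_of_int j) * \<psi> (?y - vec_of_int j)))
      = quasi_term \<psi> h p x j" for j
    by (simp add: quasi_term_def pm mon_scaleR sum_distrib_left mult_ac)
  ultimately show ?thesis by simp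
qed

text \<open>The increment \<open>h j - x\<close> is \<open>- h\<close> times the local variable, so only the constant term of the Taylor
  polynomial survives the summation.\<close>

lemma taylor_reproduced:
  fixes \<psi> :: "real ^ 'n \<Rightarrow> real"
  assumes rep: "reproduces_polynomials L \<psi>" and h: "0 < h"
  shows "((\<lambda>j. taylor (Suc L) f x (h *\<^sub>R vec_of_int j - x) * \<psi> (x /\<^sub>R h - vec_of_int j)) has_sum f x) UNIV"
proof -
  let ?y = "x /\<^sub>R h"
  have v: "mon is (h *\<^sub>R vec_of_int j - x) = (- h) ^ length is * mon is (?y - vec_of_int j)" for "is" j
    using mon_scaleR[of "is" "- h" "?y - vec_of_int j"] h by (simp add: scaleR_diff_right)
  have "((\<lambda>j. \<Sum>k<Suc L. \<Sum>is | length is = k. ((- h) ^ length is * partials is f x / fact k)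
        * (mon is (?y - vec_of_int j) * \<psi> (?y - vec_of_int j)))
      has_sum (\<Sum>k<Suc L. \<Sum>is | length is = k. ((- h) ^ length is * partials is f x / fact k) * (if is = [] then 1 else 0))) UNIV"
    using rep by (intro has_sum_finite_sum has_sum_cmult_right finite_lists_of_length) (auto simp: reproduces_polynomials_def)
  moreover have "(\<Sum>k<Suc L. \<Sum>is | length is = k. ((- h) ^ length is * partials is f x / fact k) * (if is = [] then 1 else 0)) = f x"
  proof -
    have z: "{is :: 'n list. length is = 0} = {[]}" by auto
    have "(\<Sum>is | length is = Suc k. ((- h) ^ length is * partials is f x / fact (Suc k)) * (if is = [] then 1 else 0)) = 0" for k
      by (intro sum.neutral) auto
    then show ?thesis by (simp only: sum.lessThan_Suc_shift sum.neutral_const) (simp add: z partials_def)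
  qed
  moreover have "(\<Sum>k<Suc L. \<Sum>is | length is = k. ((- h) ^ length is * partials is f x / fact k)
        * (mon is (?y - vec_of_int j) * \<psi> (?y - vec_of_int j)))
      = taylor (Suc L) f x (h *\<^sub>R vec_of_int j - x) * \<psi> (?y - vec_of_int j)" for j
    unfolding taylor_def homogeneous_taylor_def v
    by (simp add: sum_distrib_left sum_distrib_right sum_divide_distrib mult_ac del: sum.lessThan_Suc)
  ultimately show ?thesis by simp
qed

lemma quasi_term_summable:
  fixes \<psi> :: "real ^ 'n \<Rightarrow> real"
  assumes decay: "\<And>z. \<bar>\<psi> z\<bar> \<le> B / (1 + norm z) ^ (CARD('n) + 1)" and M: "\<And>x. \<bar>f x\<bar> \<le> M"
  shows "quasi_term \<psi> h f x summable_on UNIV"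
proof (rule abs_summable_summable, rule summable_on_comparison_test)
  show "(\<lambda>j. M * norm (\<psi> (x /\<^sub>R h - vec_of_int j))) summable_on UNIV"
    by (intro summable_on_cmult_right lattice_abs_summable[of \<psi>]) (use decay in simp)
  show "norm (quasi_term \<psi> h f x j) \<le> M * norm (\<psi> (x /\<^sub>R h - vec_of_int j))" for j
    unfolding quasi_term_def norm_mult by (intro mult_right_mono) (use M in auto)
qed simp

text \<open>Subtracting the reproduced Taylor polynomial leaves the remainders. With \<open>r = h (1 + d)\<close>, they are
  at most \<open>A r\<^sup>N min 1 (1 / r)\<close>: the first bound of \<open>taylor_remainder\<close> serves for \<open>r \<le> 1\<close>, the second
  for \<open>r > 1\<close>. Multiplication by the decay of the kernel produces the weight of \<open>lattice_log_sum\<close>.\<close>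

lemma quasi_interp_error:
  fixes \<psi> :: "real ^ 'n \<Rightarrow> real"
  assumes rep: "reproduces_polynomials L \<psi>"
    and decay: "\<And>z. \<bar>\<psi> z\<bar> \<le> B / (1 + norm z) ^ (Suc L + CARD('n))" and B: "0 \<le> B"
    and f: "bounded_C_k (Suc L) f"
  obtains C where "\<And>h x. 0 < h \<Longrightarrow> h < 1 / 2 \<Longrightarrow>
    \<bar>quasi_interp \<psi> h f x - f x\<bar> \<le> C * (h ^ Suc L * ln (1 / h))"
proof -
  let ?n = "CARD('n)" and ?N = "Suc L"
  obtain A where A: "0 \<le> A" "\<And>x v. \<bar>f (x + v) - taylor ?N f x v\<bar> \<le> A * norm v ^ ?N"
    "\<And>x v s. 1 \<le> s \<Longrightarrow> norm v \<le> s \<Longrightarrow> \<bar>f (x + v) - taylor ?N f x v\<bar> \<le> A * s ^ (?N - 1)"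
    using taylor_remainder[OF f] by (metis zero_less_Suc)
  have "bounded (range f)" using f unfolding bounded_C_k_def
    by (auto simp: partials_def dest!: conjunct2 spec[of _ "[]"])
  then obtain M where M: "\<And>x. \<bar>f x\<bar> \<le> M" by (auto simp: bounded_iff)
  have decay': "\<bar>\<psi> z\<bar> \<le> B / (1 + norm z) ^ (?n + 1)" for z
    using mon_decay[of \<psi> B L "?n + 1" "[]" z] decay B by (simp add: add_ac)
  let ?C = "A * B * (3 ^ ?n * (2 ^ ?n * (6 / ln 2)))"
  have "\<bar>quasi_interp \<psi> h f x - f x\<bar> \<le> ?C * (h ^ ?N * ln (1 / h))" if h: "0 < h" "h < 1 / 2" for h x
  proof -
    let ?y = "x /\<^sub>R h"
    define d where "d j = 1 + norm (?y - vec_of_int j)" for j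
    define E where "E j = (f (h *\<^sub>R vec_of_int j) - taylor ?N f x (h *\<^sub>R vec_of_int j - x)) * \<psi> (?y - vec_of_int j)" for j
    define w where "w j = min 1 (1 / (h * (1 + norm (?y - vec_of_int j)))) / (1 + norm (?y - vec_of_int j)) ^ ?n" for j
    have ws: "w summable_on UNIV" and wb: "infsum w UNIV \<le> 3 ^ ?n * (2 ^ ?n * (6 / ln 2 * ln (1 / h)))"
      unfolding w_def by (rule lattice_log_summable[OF h], rule lattice_log_bound[OF h])
    have Eb: "\<bar>E j\<bar> \<le> A * B * h ^ ?N * w j" for j
    proof -
      let ?v = "h *\<^sub>R vec_of_int j - x"
      let ?r = "\<bar>f (x + ?v) - taylor ?N f x ?v\<bar>"
      have d1: "1 \<le> d j" by (simp add: d_def)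
      have "?v = (- h) *\<^sub>R (?y - vec_of_int j)" using h by (simp add: scaleR_diff_right)
      then have "norm ?v = h * norm (?y - vec_of_int j)" using h by (metis abs_minus_cancel abs_of_pos norm_scaleR)
      also have "\<dots> \<le> h * d j" using h by (intro mult_left_mono) (auto simp: d_def)
      finally have v: "norm ?v \<le> h * d j" .
      have hd: "0 < h * d j" using h d1 by simp
      have r1: "?r \<le> A * (h * d j) ^ ?N"
        using A(2)[of x ?v] v by (meson A(1) mult_left_mono norm_ge_zero order_trans power_mono)
      have "?r \<le> A * (h * d j) ^ ?N * min 1 (1 / (h * d j))"
      proof (cases "h * d j \<le> 1")
        case True
        then have "1 \<le> 1 / (h * d j)" using hd by (simp add: le_divide_eq)
        then show ?thesis using r1 by (simp add: min_def)
      next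
        case False
        then have "?r \<le> A * (h * d j) ^ L" using A(3)[of "h * d j" ?v x] v by simp
        also have "\<dots> = A * (h * d j) ^ ?N * (1 / (h * d j))" using hd h d1 by (simp add: power_Suc)
        also have "1 / (h * d j) = min 1 (1 / (h * d j))" using False hd by (simp add: min_def divide_le_eq)
        finally show ?thesis .
      qed
      then have "?r * \<bar>\<psi> (?y - vec_of_int j)\<bar> \<le> (A * (h * d j) ^ ?N * min 1 (1 / (h * d j))) * (B / d j ^ (?N + ?n))"
        using decay[of "?y - vec_of_int j"] hd A(1) unfolding d_def[symmetric]
        by (intro mult_mono) (auto simp del: power_Suc intro!: mult_nonneg_nonneg zero_le_power)
      also have "\<dots> = A * B * h ^ ?N * (min 1 (1 / (h * d j)) / d j ^ ?n)"
      proof -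
        have "(A * (h * D) ^ N * m) * (B / D ^ (N + k)) = A * B * h ^ N * (m / D ^ k)"
          if "D \<noteq> 0" for D m :: real and N k :: nat
          using that by (simp add: power_mult_distrib power_add)
        from this[of "d j" ?N "min 1 (1 / (h * d j))" ?n] show ?thesis using d1 by linarith
      qed
      finally show ?thesis by (simp add: E_def w_def d_def abs_mult)
    qed
    have Qs: "(quasi_term \<psi> h f x has_sum quasi_interp \<psi> h f x) UNIV"
      unfolding quasi_interp_def by (rule has_sum_infsum, rule quasi_term_summable[OF decay' M])
    have "((\<lambda>j. (-1) * (taylor ?N f x (h *\<^sub>R vec_of_int j - x) * \<psi> (?y - vec_of_int j))) has_sum (-1) * f x) UNIV"
      by (intro has_sum_cmult_right taylor_reproduced rep h)
    moreover have "E = (\<lambda>j. quasi_term \<psi> h f x j + (-1) * (taylor ?N f x (h *\<^sub>R vec_of_int j - x) * \<psi> (?y - vec_of_int j)))"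
      by (simp add: fun_eq_iff E_def quasi_term_def algebra_simps)
    ultimately have "(E has_sum (quasi_interp \<psi> h f x - f x)) UNIV"
      using has_sum_add[OF Qs] by fastforce
    then have eq: "quasi_interp \<psi> h f x - f x = infsum E UNIV" by (simp add: infsumI)
    have wsA: "(\<lambda>j. A * B * h ^ ?N * w j) summable_on UNIV" by (intro summable_on_cmult_right ws)
    have Es: "(\<lambda>j. norm (E j)) summable_on UNIV"
      by (rule summable_on_comparison_test[OF wsA]) (use Eb in auto)
    have "\<bar>infsum E UNIV\<bar> \<le> infsum (\<lambda>j. norm (E j)) UNIV" using norm_infsum_bound[OF Es] by simp
    also have "\<dots> \<le> infsum (\<lambda>j. A * B * h ^ ?N * w j) UNIV" by (rule infsum_mono[OF Es wsA]) (use Eb in auto)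
    also have "\<dots> = A * B * h ^ ?N * infsum w UNIV" by (rule infsum_cmult_right')
    also have "\<dots> \<le> A * B * h ^ ?N * (3 ^ ?n * (2 ^ ?n * (6 / ln 2 * ln (1 / h))))"
      using A(1) B h by (intro mult_left_mono wb) auto
    finally show ?thesis by (simp add: eq mult_ac)
  qed
  then show ?thesis using that by blast
qed

theorem theorem3:
  fixes m n :: nat
    and \<Delta> :: "(int ^ 'n) set"
    and \<mu> :: "int ^ 'n \<Rightarrow> real"
    and \<psi>u \<psi> :: "real ^ 'n \<Rightarrow> real"
    and \<psi>u_hat u_hat :: "real ^ 'n \<Rightarrow> complex"
  assumes n: "n = CARD('n)" and odd: "odd m" "odd n"
    and u_hat: "is_generalised_fourier (\<lambda>x. complex_of_real (rbf_u m x)) u_hat"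
    and fin: "finite \<Delta>"
    and \<psi>u: "\<psi>u = shift_comb \<Delta> \<mu> (rbf_u m)"
    and \<psi>u_hat: "\<psi>u_hat = fourier (\<lambda>x. complex_of_real (\<psi>u x))"
    and decay: "\<psi>u \<in> O[at_infinity](\<lambda>x. norm x powi (- int (2 * n + m)))"
    and product: "\<forall>\<^sub>F y in at 0. \<psi>u_hat y = trig_poly \<Delta> \<mu> y * u_hat y"
    and origin: "(\<lambda>y. \<psi>u_hat y - 1) \<in> O[at 0](\<lambda>y. norm y ^ (n + m))"
    and value_0: "\<psi>u_hat 0 = 1"
    and derivs_0: "\<And>\<alpha>. 1 \<le> multi_order \<alpha> \<Longrightarrow> multi_order \<alpha> \<le> n + m - 1 \<Longrightarrow>
                      multi_deriv \<alpha> \<psi>u_hat 0 = 0"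
    and derivs_j: "\<And>j \<alpha>. j \<noteq> 0 \<Longrightarrow> multi_order \<alpha> \<le> n + m - 1 \<Longrightarrow>
                      multi_deriv \<alpha> \<psi>u_hat ((2 * pi) *\<^sub>R vec_of_int j) = 0"
    and \<psi>: "\<psi> = shift_comb \<Delta> \<mu> (rbf_g m)"
  shows "(\<forall>h>0. \<forall>p\<in>polys_upto (n + m - 1).
            quasi_interp_defined \<psi> h p \<and> quasi_interp \<psi> h p = p) \<and>
         (\<forall>f. bounded_C_k (n + m) f \<longrightarrow>
            (\<forall>h>0. quasi_interp_defined \<psi> h f) \<and>
            (\<forall>\<^sub>F h in at_right 0. bounded (range (\<lambda>x. quasi_interp \<psi> h f x - f x))) \<and>
            (\<lambda>h. SUP x. \<bar>quasi_interp \<psi> h f x - f x\<bar>)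
              \<in> O[at_right 0](\<lambda>h. h ^ (n + m) * ln (1 / h)))"
proof -
  let ?L = "n + m - 1"
  have n1: "1 \<le> n" using n by simp
  then have SL: "Suc ?L = n + m" by simp
  have cont_u: "continuous_on UNIV (rbf_u m :: real ^ 'n \<Rightarrow> real)"
    unfolding rbf_u_def by (intro continuous_intros)
  have cont_\<psi>u: "continuous_on UNIV \<psi>u" unfolding \<psi>u by (rule continuous_shift_comb[OF cont_u])
  obtain B where B: "0 \<le> B" "\<And>x. \<bar>\<psi>u x\<bar> \<le> B / (1 + norm x) ^ (2 * n + m)"
    by (rule global_decay[OF cont_\<psi>u decay]) blast
  have "((\<lambda>y. \<psi>u_hat y - 1) \<longlongrightarrow> 0) (at 0)"
  proof -
    obtain c where c: "\<forall>\<^sub>F y in at 0. norm (\<psi>u_hat y - 1) \<le> c * norm (complex_of_real (norm y ^ (n + m)))"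
      using landau_o.bigE[OF origin] by auto
    have "((\<lambda>y :: real ^ 'n. c * norm (complex_of_real (norm y ^ (n + m)))) \<longlongrightarrow> c * norm (complex_of_real (norm (0 :: real ^ 'n) ^ (n + m)))) (at 0)"
      by (intro tendsto_intros)
    then have "((\<lambda>y :: real ^ 'n. c * norm (complex_of_real (norm y ^ (n + m)))) \<longlongrightarrow> 0) (at 0)"
      using n1 by (simp add: power_0_left)
    then show ?thesis by (rule Lim_null_comparison[OF c])
  qed
  then have lim: "(\<psi>u_hat \<longlongrightarrow> 1) (at 0)" by (simp add: LIM_zero_iff)
  have ann: "annihilates_polynomials (n + m) \<Delta> \<mu>"
    unfolding n by (rule annihilates_polynomials_if_product_tends_to_1[OF u_hat product lim])
  have "\<psi> x = \<psi>u x + shift_comb \<Delta> \<mu> (rbf_diff m) x" for x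
    by (simp add: \<psi> \<psi>u shift_comb_def rbf_diff_def sum.distrib[symmetric] algebra_simps)
  then have \<psi>_eq: "\<psi> = (\<lambda>x. \<psi>u x + shift_comb \<Delta> \<mu> (rbf_diff m) x)" by (rule ext)
  have rep: "reproduces_polynomials ?L \<psi>"
    unfolding reproduces_polynomials_def
  proof (intro allI impI)
    fix "is" :: "'n list" and y :: "real ^ 'n"
    assume len: "length is \<le> ?L"
    have e: "?L + (CARD('n) + 1) = 2 * n + m" using n n1 by simp
    have "((\<lambda>j. mon is (y - vec_of_int j) * \<psi>u (y - vec_of_int j)) has_sum (if is = [] then 1 else 0)) UNIV"
    proof (rule strang_fix_reproduction[OF _ B(1) cont_\<psi>u _ _ _ len])
      show "\<bar>\<psi>u x\<bar> \<le> B / (1 + norm x) ^ (?L + (CARD('n) + 1))" for x unfolding e by (rule B)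
    qed (use value_0 derivs_0 derivs_j in \<open>unfold \<psi>u_hat, blast+\<close>)
    moreover obtain C where C: "0 \<le> C"
      "\<And>z :: real ^ 'n. \<bar>rbf_diff m z\<bar> \<le> C / (1 + norm z) ^ (length is + CARD('n) + 1)"
      using rbf_diff_decay[where m = m and K = "length is + CARD('n) + 1"] by blast
    have "((\<lambda>j. mon is (y - vec_of_int j) * shift_comb \<Delta> \<mu> (rbf_diff m) (y - vec_of_int j)) has_sum 0) UNIV"
      by (rule has_sum_shift_comb_zero[OF ann _ C(2) C(1) fin]) (use len SL in simp)
    ultimately have "((\<lambda>j. mon is (y - vec_of_int j) * \<psi>u (y - vec_of_int j)
        + mon is (y - vec_of_int j) * shift_comb \<Delta> \<mu> (rbf_diff m) (y - vec_of_int j))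
        has_sum ((if is = [] then 1 else 0) + 0)) UNIV"
      by (rule has_sum_add)
    then show "((\<lambda>j. mon is (y - vec_of_int j) * \<psi> (y - vec_of_int j)) has_sum (if is = [] then 1 else 0)) UNIV"
      by (simp add: \<psi>_eq distrib_left)
  qed
  obtain C where C: "0 \<le> C" "\<And>z :: real ^ 'n. \<bar>rbf_diff m z\<bar> \<le> C / (1 + norm z) ^ (2 * n + m)"
    using rbf_diff_decay[where m = m and K = "2 * n + m"] by blast
  obtain C' where C': "0 \<le> C'" "\<And>z. \<bar>shift_comb \<Delta> \<mu> (rbf_diff m) z\<bar> \<le> C' / (1 + norm z) ^ (2 * n + m)"
    using shift_comb_decay[OF C(2) C(1)] by blast
  have dec: "\<bar>\<psi> z\<bar> \<le> (B + C') / (1 + norm z) ^ (2 * n + m)" for z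
    using B(2)[of z] C'(2)[of z] unfolding \<psi>_eq add_divide_distrib by linarith
  have BC: "0 \<le> B + C'" using B C' by simp
  have dec1: "\<bar>\<psi> z\<bar> \<le> (B + C') / (1 + norm z) ^ (CARD('n) + 1)" for z
  proof -
    have "2 * n + m = ?L + (CARD('n) + 1)" using n n1 by simp
    then show ?thesis using mon_decay[of \<psi> "B + C'" ?L "CARD('n) + 1" "[]" z] dec BC by simp
  qed
  show ?thesis
  proof (intro conjI allI impI ballI)
    fix h :: real and p :: "real ^ 'n \<Rightarrow> real"
    assume h: "0 < h" and p: "p \<in> polys_upto ?L"
    note s = quasi_interp_polynomial[OF rep h p]
    show "quasi_interp_defined \<psi> h p"
      unfolding quasi_interp_defined_def using has_sum_imp_summable[OF s] by blast
    show "quasi_interp \<psi> h p = p"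
      unfolding quasi_interp_def using infsumI[OF s] by blast
  next
    fix f :: "real ^ 'n \<Rightarrow> real"
    assume f: "bounded_C_k (n + m) f"
    then have f': "bounded_C_k (Suc ?L) f" unfolding SL .
    show "quasi_interp_defined \<psi> h f" for h
    proof -
      have "bounded (range (partials [] f))"
        using conjunct2[OF f[unfolded bounded_C_k_def], rule_format, of "[]"] by simp
      then obtain M where "\<And>x. \<bar>f x\<bar> \<le> M" by (auto simp: bounded_iff partials_def)
      then show ?thesis unfolding quasi_interp_defined_def using quasi_term_summable[OF dec1] by blast
    qed
    have "\<bar>\<psi> z\<bar> \<le> (B + C') / (1 + norm z) ^ (Suc ?L + CARD('n))" for z
    proof -
      have e: "Suc ?L + CARD('n) = 2 * n + m" using n n1 by simp
      show ?thesis unfolding e by (rule dec)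
    qed
    then obtain K where K: "\<And>h x. 0 < h \<Longrightarrow> h < 1 / 2 \<Longrightarrow>
        \<bar>quasi_interp \<psi> h f x - f x\<bar> \<le> K * (h ^ Suc ?L * ln (1 / h))"
      using quasi_interp_error[OF rep _ BC f'] by blast
    have small: "\<forall>\<^sub>F h in at_right (0::real). 0 < h \<and> h < 1 / 2"
      by (auto simp: eventually_at_right_field intro!: exI[of _ "1/2"])
    then show "\<forall>\<^sub>F h in at_right 0. bounded (range (\<lambda>x. quasi_interp \<psi> h f x - f x))"
      by eventually_elim (use K in \<open>auto simp: bounded_iff\<close>)
    show "(\<lambda>h. SUP x. \<bar>quasi_interp \<psi> h f x - f x\<bar>) \<in> O[at_right 0](\<lambda>h. h ^ (n + m) * ln (1 / h))"
    proof (rule bigoI)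
      show "\<forall>\<^sub>F h in at_right 0. norm (SUP x. \<bar>quasi_interp \<psi> h f x - f x\<bar>) \<le> K * norm (h ^ (n + m) * ln (1 / h))"
        using small
      proof eventually_elim
        case (elim h)
        let ?e = "\<lambda>x. \<bar>quasi_interp \<psi> h f x - f x\<bar>"
        have b: "?e x \<le> K * (h ^ (n + m) * ln (1 / h))" for x using K[of h x] elim unfolding SL by blast
        then have "(SUP x. ?e x) \<le> K * (h ^ (n + m) * ln (1 / h))" by (intro cSUP_least) auto
        moreover have "0 \<le> ?e 0" by simp
        then have "0 \<le> (SUP x. ?e x)"
          by (rule order_trans) (rule cSUP_upper[OF UNIV_I bdd_aboveI2[OF b]])
        moreover have "0 \<le> h ^ (n + m) * ln (1 / h)" using elim by (intro mult_nonneg_nonneg) auto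
        ultimately show ?case by simp
      qed
    qed
  qed
qed

end
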